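(* Let $k$ be a field of characteristic zero. Let $\mathcal{C}\to\mathcal{EBV}$ be the morphism of DG operads obtained as the composite $\mathcal{C}\to\mathcal{BV}/\Delta\to\mathcal{EBV}$, where $\mathcal{C}\to\mathcal{BV}/\Delta$ is given by $\mu\mapsto\mu$ and $\mathcal{BV}/\Delta\to\mathcal{EBV}$ is given by $\mu\mapsto\mu$, $\Delta\mapsto -d(i)$, $\phi_1\mapsto i$, and $\phi_n\mapsto 0$ for $n\geq 2$. Then $\mathcal{C}\to\mathcal{EBV}$ is a quasi-isomorphism.
   Context: Operads are symmetric DG operads over $k$; complexes are cochain complexes (differentials have degree $+1$). The right action of $\tau\in\mathbb{S}_n$ is normalized so that $(f\cdot\tau)(x_1,\dots,x_n)=\pm f(x_{\tau^{-1}(1)},\dots,x_{\tau^{-1}(n)})$ with Koszul sign. Products of arity $1$ elements are compositions, $[a,b]=ab-(-1)^{|a||b|}ba$. "DG operad generated by $X$" means generated by the elements of $X$ and their differentials, the differentials being free unless a relation says otherwise. $\mathcal{C}$ is the operad for (non-unital) commutative associative algebras, with trivial differential, generated by $\mu\in\mathcal{C}(2)^0$, $\mu\cdot(1\ 2)=\mu$, with $\mu\circ_1\mu=\mu\circ_2\mu$. In any operad with such a $\mu$, $\mu^{(m)}$ denotes the iterated product of arity $m$, with $\mu^{(1)}$ the operadic unit. Order relation: for an arity $1$ element $D$ and $n\geq1$, $\mathrm{DO}_n(D)$ denotes the relation $$\sum_{\substack{p+q=n+1\\ p\geq1}}(-1)^p\sum_{\sigma\in \mathrm{Sh}_{p,q}}\bigl(\mu^{(q+1)}\circ_1(D\circ_1\mu^{(p)})\bigr)\cdot\sigma^{-1}=0,$$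 where $\mathrm{Sh}_{p,q}\subset\mathbb{S}_{n+1}$ is the set of $(p,q)$-shuffles ($\sigma(1)<\dots<\sigma(p)$, $\sigma(p+1)<\dots<\sigma(p+q)$). It says that $D$ is a differential operator of order $\leq n$. $\mathcal{EBV}$ (exact Batalin--Vilkovisky operad) is the DG operad generated by $\mu\in\mathcal{EBV}(2)^0$ and $i\in\mathcal{EBV}(1)^{-2}$ with $\mu\cdot(1\ 2)=\mu$, subject to $d(\mu)=0$, $\mu\circ_1\mu=\mu\circ_2\mu$, $i\,d(i)=d(i)\,i$, and $\mathrm{DO}_2(i)$. $\mathcal{BV}/\Delta$ (trivialized Batalin--Vilkovisky operad) is the DG operad generated by $\mu$ in arity $2$ and degree $0$, $\Delta$ in arity $1$ and degree $-1$, and $\phi_n$ in arity $1$ and degree $-2n$, $n\geq1$, with $\mu\cdot(1\ 2)=\mu$, subject to $d(\mu)=0$, $\mu\circ_1\mu=\mu\circ_2\mu$, $d(\Delta)=0$, $\Delta^2=0$, $\mathrm{DO}_2(\Delta)$, $d(\phi_1)=-\Delta$, and for $n\geq2$ $$d(\phi_n)+\sum_{p=2}^n\frac{1}{p!}\sum_{\substack{q_1+\cdots+q_p=n\\ q_1,\dots,q_p\geq 1}}[\phi_{q_1},\dots[\phi_{q_{p-1}},d(\phi_{q_p})]\dots]=0.$$ A quasi-isomorphism of DG operads is a morphism inducing an isomorphism on cohomology in every arity. *)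

theory Defs
  imports Complex_Main "HOL-Combinatorics.Permutations"
begin

section \<open>Symmetric DG operads\<close>

text \<open>
  A DG operad is given by its homogeneous components: \<open>el P n e\<close> is the vector space of elements of
  arity \<open>n\<close> and cohomological degree \<open>e\<close>. The other operations only matter on these components.
  \<open>ocomp P x i y\<close> is the partial composition, i.e. \<open>y\<close> plugged into the \<open>i\<close>-th input of \<open>x\<close>, with
  inputs numbered from 1; permutations in arity \<open>n\<close> are functions that permute \<open>{1..n}\<close>.
\<close>

record ('k, 'a) dg_operad_data =
  el :: "nat \<Rightarrow> int \<Rightarrow> 'a set"
  ozero :: "nat \<Rightarrow> int \<Rightarrow> 'a"
  oadd :: "'a \<Rightarrow> 'a \<Rightarrow> 'a"
  osmult :: "'k \<Rightarrow> 'a \<Rightarrow> 'a"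
  ounit :: "'a"
  ocomp :: "'a \<Rightarrow> nat \<Rightarrow> 'a \<Rightarrow> 'a"
  oact :: "'a \<Rightarrow> (nat \<Rightarrow> nat) \<Rightarrow> 'a"
  odiff :: "'a \<Rightarrow> 'a"

text \<open>
  The permutation \<open>\<rho>\<close> with \<open>(f \<cdot> \<sigma>) \<circ>\<^bsub>i\<^esub> (g \<cdot> \<tau>) = (f \<circ>\<^bsub>\<sigma>(i)\<^esub> g) \<cdot> \<rho>\<close>, where \<open>g\<close> has arity \<open>n\<close>. With the
  normalization \<open>(f \<cdot> \<tau>)(x\<^sub>1, \<dots>, x\<^sub>m) = \<plusminus> f(x\<^bsub>\<tau>\<inverse>(1)\<^esub>, \<dots>, x\<^bsub>\<tau>\<inverse>(m)\<^esub>)\<close> the \<open>j\<close>-th variable is put into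
  the slot \<open>\<tau>(j)\<close> of \<open>f\<close>.
\<close>

definition comp_perm :: "nat \<Rightarrow> nat \<Rightarrow> (nat \<Rightarrow> nat) \<Rightarrow> (nat \<Rightarrow> nat) \<Rightarrow> nat \<Rightarrow> nat" where
  "comp_perm n i \<sigma> \<tau> = (\<lambda>x.
     let shift = (\<lambda>s. if s < \<sigma> i then s else s + n - 1) in
     if x < i then shift (\<sigma> x)
     else if x < i + n then \<sigma> i + \<tau> (x + 1 - i) - 1
     else shift (\<sigma> (x + 1 - n)))"

locale dg_operad =
  fixes P :: "('k::field, 'a) dg_operad_data"
  assumes zero_closed: "ozero P n e \<in> el P n e"
    and add_closed: "\<lbrakk>x \<in> el P n e; y \<in> el P n e\<rbrakk> \<Longrightarrow> oadd P x y \<in> el P n e"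
    and smult_closed: "x \<in> el P n e \<Longrightarrow> osmult P c x \<in> el P n e"
    and add_assoc: "\<lbrakk>x \<in> el P n e; y \<in> el P n e; z \<in> el P n e\<rbrakk>
      \<Longrightarrow> oadd P (oadd P x y) z = oadd P x (oadd P y z)"
    and add_commute: "\<lbrakk>x \<in> el P n e; y \<in> el P n e\<rbrakk> \<Longrightarrow> oadd P x y = oadd P y x"
    and add_zero: "x \<in> el P n e \<Longrightarrow> oadd P x (ozero P n e) = x"
    and add_neg: "x \<in> el P n e \<Longrightarrow> oadd P x (osmult P (- 1) x) = ozero P n e"
    and smult_add: "\<lbrakk>x \<in> el P n e; y \<in> el P n e\<rbrakk>
      \<Longrightarrow> osmult P c (oadd P x y) = oadd P (osmult P c x) (osmult P c y)"
    and add_smult: "x \<in> el P n e \<Longrightarrow> osmult P (b + c) x = oadd P (osmult P b x) (osmult P c x)"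
    and smult_smult: "x \<in> el P n e \<Longrightarrow> osmult P b (osmult P c x) = osmult P (b * c) x"
    and smult_one: "x \<in> el P n e \<Longrightarrow> osmult P 1 x = x"
    \<comment> \<open>the symmetric group acts linearly from the right\<close>
    and act_closed: "\<lbrakk>x \<in> el P n e; \<sigma> permutes {1..n}\<rbrakk> \<Longrightarrow> oact P x \<sigma> \<in> el P n e"
    and act_add: "\<lbrakk>x \<in> el P n e; y \<in> el P n e; \<sigma> permutes {1..n}\<rbrakk>
      \<Longrightarrow> oact P (oadd P x y) \<sigma> = oadd P (oact P x \<sigma>) (oact P y \<sigma>)"
    and act_smult: "\<lbrakk>x \<in> el P n e; \<sigma> permutes {1..n}\<rbrakk>
      \<Longrightarrow> oact P (osmult P c x) \<sigma> = osmult P c (oact P x \<sigma>)"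
    and act_id: "x \<in> el P n e \<Longrightarrow> oact P x id = x"
    and act_act: "\<lbrakk>x \<in> el P n e; \<sigma> permutes {1..n}; \<tau> permutes {1..n}\<rbrakk>
      \<Longrightarrow> oact P (oact P x \<sigma>) \<tau> = oact P x (\<sigma> \<circ> \<tau>)"
    \<comment> \<open>partial compositions are bilinear, unital, associative and equivariant\<close>
    and unit_closed: "ounit P \<in> el P 1 0"
    and comp_closed: "\<lbrakk>x \<in> el P m e; y \<in> el P n e'; 1 \<le> i; i \<le> m\<rbrakk>
      \<Longrightarrow> ocomp P x i y \<in> el P (m + n - 1) (e + e')"
    and comp_add_left: "\<lbrakk>x \<in> el P m e; x' \<in> el P m e; y \<in> el P n e'; 1 \<le> i; i \<le> m\<rbrakk>
      \<Longrightarrow> ocomp P (oadd P x x') i y = oadd P (ocomp P x i y) (ocomp P x' i y)"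
    and comp_add_right: "\<lbrakk>x \<in> el P m e; y \<in> el P n e'; y' \<in> el P n e'; 1 \<le> i; i \<le> m\<rbrakk>
      \<Longrightarrow> ocomp P x i (oadd P y y') = oadd P (ocomp P x i y) (ocomp P x i y')"
    and comp_smult_left: "\<lbrakk>x \<in> el P m e; y \<in> el P n e'; 1 \<le> i; i \<le> m\<rbrakk>
      \<Longrightarrow> ocomp P (osmult P c x) i y = osmult P c (ocomp P x i y)"
    and comp_smult_right: "\<lbrakk>x \<in> el P m e; y \<in> el P n e'; 1 \<le> i; i \<le> m\<rbrakk>
      \<Longrightarrow> ocomp P x i (osmult P c y) = osmult P c (ocomp P x i y)"
    and comp_unit_right: "\<lbrakk>x \<in> el P m e; 1 \<le> i; i \<le> m\<rbrakk> \<Longrightarrow> ocomp P x i (ounit P) = x"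
    and comp_unit_left: "x \<in> el P m e \<Longrightarrow> ocomp P (ounit P) 1 x = x"
    and comp_sequential: "\<lbrakk>x \<in> el P l e; y \<in> el P m e'; z \<in> el P n e'';
        1 \<le> i; i \<le> l; 1 \<le> j; j \<le> m\<rbrakk>
      \<Longrightarrow> ocomp P (ocomp P x i y) (i + j - 1) z = ocomp P x i (ocomp P y j z)"
    and comp_parallel: "\<lbrakk>x \<in> el P l e; y \<in> el P m e'; z \<in> el P n e''; 1 \<le> i; i < j; j \<le> l\<rbrakk>
      \<Longrightarrow> ocomp P (ocomp P x i y) (j + m - 1) z
        = osmult P ((- 1) powi (e' * e'')) (ocomp P (ocomp P x j z) i y)"
    and comp_act: "\<lbrakk>x \<in> el P m e; y \<in> el P n e'; 1 \<le> i; i \<le> m;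
        \<sigma> permutes {1..m}; \<tau> permutes {1..n}\<rbrakk>
      \<Longrightarrow> ocomp P (oact P x \<sigma>) i (oact P y \<tau>) = oact P (ocomp P x (\<sigma> i) y) (comp_perm n i \<sigma> \<tau>)"
    \<comment> \<open>the differential has degree \<open>+1\<close> and is compatible with the operad structure\<close>
    and diff_closed: "x \<in> el P n e \<Longrightarrow> odiff P x \<in> el P n (e + 1)"
    and diff_add: "\<lbrakk>x \<in> el P n e; y \<in> el P n e\<rbrakk>
      \<Longrightarrow> odiff P (oadd P x y) = oadd P (odiff P x) (odiff P y)"
    and diff_smult: "x \<in> el P n e \<Longrightarrow> odiff P (osmult P c x) = osmult P c (odiff P x)"
    and diff_diff: "x \<in> el P n e \<Longrightarrow> odiff P (odiff P x) = ozero P n (e + 2)"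
    and diff_act: "\<lbrakk>x \<in> el P n e; \<sigma> permutes {1..n}\<rbrakk>
      \<Longrightarrow> odiff P (oact P x \<sigma>) = oact P (odiff P x) \<sigma>"
    and diff_comp: "\<lbrakk>x \<in> el P m e; y \<in> el P n e'; 1 \<le> i; i \<le> m\<rbrakk>
      \<Longrightarrow> odiff P (ocomp P x i y)
        = oadd P (ocomp P (odiff P x) i y) (osmult P ((- 1) powi e) (ocomp P x i (odiff P y)))"

locale dg_operad_hom = P: dg_operad P + Q: dg_operad Q
  for P :: "('k::field, 'a) dg_operad_data" and Q :: "('k, 'b) dg_operad_data" +
  fixes f :: "'a \<Rightarrow> 'b"
  assumes hom_closed: "x \<in> el P n e \<Longrightarrow> f x \<in> el Q n e"
    and hom_add: "\<lbrakk>x \<in> el P n e; y \<in> el P n e\<rbrakk> \<Longrightarrow> f (oadd P x y) = oadd Q (f x) (f y)"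
    and hom_smult: "x \<in> el P n e \<Longrightarrow> f (osmult P c x) = osmult Q c (f x)"
    and hom_unit: "f (ounit P) = ounit Q"
    and hom_comp: "\<lbrakk>x \<in> el P m e; y \<in> el P n e'; 1 \<le> i; i \<le> m\<rbrakk>
      \<Longrightarrow> f (ocomp P x i y) = ocomp Q (f x) i (f y)"
    and hom_act: "\<lbrakk>x \<in> el P n e; \<sigma> permutes {1..n}\<rbrakk> \<Longrightarrow> f (oact P x \<sigma>) = oact Q (f x) \<sigma>"
    and hom_diff: "x \<in> el P n e \<Longrightarrow> f (odiff P x) = odiff Q (f x)"


section \<open>Cohomology and quasi-isomorphisms\<close>

definition cocycles :: "('k, 'a) dg_operad_data \<Rightarrow> nat \<Rightarrow> int \<Rightarrow> 'a set" where
  "cocycles P n e = {x \<in> el P n e. odiff P x = ozero P n (e + 1)}"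

definition cohomologous :: "('k, 'a) dg_operad_data \<Rightarrow> nat \<Rightarrow> int \<Rightarrow> ('a \<times> 'a) set" where
  "cohomologous P n e = {(x, y). x \<in> cocycles P n e \<and> y \<in> cocycles P n e
     \<and> (\<exists>b \<in> el P n (e - 1). y = oadd P x (odiff P b))}"

definition cohomology :: "('k, 'a) dg_operad_data \<Rightarrow> nat \<Rightarrow> int \<Rightarrow> 'a set set" where
  "cohomology P n e = cocycles P n e // cohomologous P n e"

text \<open>The induced map sends the class \<open>X\<close> of \<open>x\<close> to the class of \<open>f x\<close>.\<close>

definition cohomology_map ::
  "('k, 'b) dg_operad_data \<Rightarrow> nat \<Rightarrow> int \<Rightarrow> ('a \<Rightarrow> 'b) \<Rightarrow> 'a set \<Rightarrow> 'b set" where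
  "cohomology_map Q n e f X = cohomologous Q n e `` (f ` X)"

text \<open>The induced maps are linear, so being isomorphisms means being bijective.\<close>

definition quasi_isomorphism ::
  "('k::field, 'a) dg_operad_data \<Rightarrow> ('k, 'b) dg_operad_data \<Rightarrow> ('a \<Rightarrow> 'b) \<Rightarrow> bool" where
  "quasi_isomorphism P Q f \<longleftrightarrow> dg_operad_hom P Q f \<and>
     (\<forall>n e. bij_betw (cohomology_map Q n e f) (cohomology P n e) (cohomology Q n e))"


section \<open>DG operads presented by generators and relations\<close>

text \<open>
  Formal expressions in generators of type \<open>'g\<close>, built with the operations of DG operads. In
  particular \<open>Diff (Gen g)\<close> is the formal differential of the generator \<open>g\<close>.
\<close>

datatype ('k, 'g) oterm =
    Gen 'g
  | Zero nat int
  | Add "('k, 'g) oterm" "('k, 'g) oterm"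
  | Scale 'k "('k, 'g) oterm"
  | Unit
  | Comp "('k, 'g) oterm" nat "('k, 'g) oterm"
  | Act "('k, 'g) oterm" "nat \<Rightarrow> nat"
  | Diff "('k, 'g) oterm"

record ('k, 'g) presentation =
  gens :: "'g set"
  gen_arity :: "'g \<Rightarrow> nat"
  gen_degree :: "'g \<Rightarrow> int"
  rels :: "(('k, 'g) oterm \<times> ('k, 'g) oterm) set"

inductive is_term :: "('k, 'g) presentation \<Rightarrow> nat \<Rightarrow> int \<Rightarrow> ('k, 'g) oterm \<Rightarrow> bool"
  for p where
  "g \<in> gens p \<Longrightarrow> is_term p (gen_arity p g) (gen_degree p g) (Gen g)"
| "is_term p n e (Zero n e)"
| "\<lbrakk>is_term p n e s; is_term p n e t\<rbrakk> \<Longrightarrow> is_term p n e (Add s t)"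
| "is_term p n e t \<Longrightarrow> is_term p n e (Scale c t)"
| "is_term p 1 0 Unit"
| "\<lbrakk>is_term p m e s; is_term p n e' t; 1 \<le> i; i \<le> m\<rbrakk>
    \<Longrightarrow> is_term p (m + n - 1) (e + e') (Comp s i t)"
| "\<lbrakk>is_term p n e t; \<sigma> permutes {1..n}\<rbrakk> \<Longrightarrow> is_term p n e (Act t \<sigma>)"
| "is_term p n e t \<Longrightarrow> is_term p n (e + 1) (Diff t)"

text \<open>
  The least congruence on expressions of arity \<open>n\<close> and degree \<open>e\<close> that contains the relations and for
  which the axioms of DG operads hold.
\<close>

inductive teq :: "('k::field, 'g) presentation \<Rightarrow> nat \<Rightarrow> int \<Rightarrow> ('k, 'g) oterm \<Rightarrow> ('k, 'g) oterm \<Rightarrow> bool"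
  for p where
  teq_rel: "\<lbrakk>(s, t) \<in> rels p; is_term p n e s; is_term p n e t\<rbrakk> \<Longrightarrow> teq p n e s t"
\<comment> \<open>congruence\<close>
| teq_refl: "is_term p n e t \<Longrightarrow> teq p n e t t"
| teq_sym: "teq p n e s t \<Longrightarrow> teq p n e t s"
| teq_trans: "\<lbrakk>teq p n e s t; teq p n e t u\<rbrakk> \<Longrightarrow> teq p n e s u"
| teq_Add: "\<lbrakk>teq p n e s s'; teq p n e t t'\<rbrakk> \<Longrightarrow> teq p n e (Add s t) (Add s' t')"
| teq_Scale: "teq p n e t t' \<Longrightarrow> teq p n e (Scale c t) (Scale c t')"
| teq_Comp: "\<lbrakk>teq p m e s s'; teq p n e' t t'; 1 \<le> i; i \<le> m\<rbrakk>
    \<Longrightarrow> teq p (m + n - 1) (e + e') (Comp s i t) (Comp s' i t')"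
| teq_Act: "\<lbrakk>teq p n e t t'; \<sigma> permutes {1..n}\<rbrakk> \<Longrightarrow> teq p n e (Act t \<sigma>) (Act t' \<sigma>)"
| teq_Diff: "teq p n e t t' \<Longrightarrow> teq p n (e + 1) (Diff t) (Diff t')"
\<comment> \<open>vector space axioms\<close>
| teq_add_assoc: "\<lbrakk>is_term p n e s; is_term p n e t; is_term p n e u\<rbrakk>
    \<Longrightarrow> teq p n e (Add (Add s t) u) (Add s (Add t u))"
| teq_add_commute: "\<lbrakk>is_term p n e s; is_term p n e t\<rbrakk> \<Longrightarrow> teq p n e (Add s t) (Add t s)"
| teq_add_zero: "is_term p n e t \<Longrightarrow> teq p n e (Add t (Zero n e)) t"
| teq_add_neg: "is_term p n e t \<Longrightarrow> teq p n e (Add t (Scale (- 1) t)) (Zero n e)"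
| teq_smult_add: "\<lbrakk>is_term p n e s; is_term p n e t\<rbrakk>
    \<Longrightarrow> teq p n e (Scale c (Add s t)) (Add (Scale c s) (Scale c t))"
| teq_add_smult: "is_term p n e t \<Longrightarrow> teq p n e (Scale (b + c) t) (Add (Scale b t) (Scale c t))"
| teq_smult_smult: "is_term p n e t \<Longrightarrow> teq p n e (Scale b (Scale c t)) (Scale (b * c) t)"
| teq_smult_one: "is_term p n e t \<Longrightarrow> teq p n e (Scale 1 t) t"
\<comment> \<open>symmetric group actions\<close>
| teq_act_add: "\<lbrakk>is_term p n e s; is_term p n e t; \<sigma> permutes {1..n}\<rbrakk>
    \<Longrightarrow> teq p n e (Act (Add s t) \<sigma>) (Add (Act s \<sigma>) (Act t \<sigma>))"
| teq_act_smult: "\<lbrakk>is_term p n e t; \<sigma> permutes {1..n}\<rbrakk>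
    \<Longrightarrow> teq p n e (Act (Scale c t) \<sigma>) (Scale c (Act t \<sigma>))"
| teq_act_id: "is_term p n e t \<Longrightarrow> teq p n e (Act t id) t"
| teq_act_act: "\<lbrakk>is_term p n e t; \<sigma> permutes {1..n}; \<tau> permutes {1..n}\<rbrakk>
    \<Longrightarrow> teq p n e (Act (Act t \<sigma>) \<tau>) (Act t (\<sigma> \<circ> \<tau>))"
\<comment> \<open>partial compositions\<close>
| teq_comp_add_left: "\<lbrakk>is_term p m e s; is_term p m e s'; is_term p n e' t; 1 \<le> i; i \<le> m\<rbrakk>
    \<Longrightarrow> teq p (m + n - 1) (e + e') (Comp (Add s s') i t) (Add (Comp s i t) (Comp s' i t))"
| teq_comp_add_right: "\<lbrakk>is_term p m e s; is_term p n e' t; is_term p n e' t'; 1 \<le> i; i \<le> m\<rbrakk>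
    \<Longrightarrow> teq p (m + n - 1) (e + e') (Comp s i (Add t t')) (Add (Comp s i t) (Comp s i t'))"
| teq_comp_smult_left: "\<lbrakk>is_term p m e s; is_term p n e' t; 1 \<le> i; i \<le> m\<rbrakk>
    \<Longrightarrow> teq p (m + n - 1) (e + e') (Comp (Scale c s) i t) (Scale c (Comp s i t))"
| teq_comp_smult_right: "\<lbrakk>is_term p m e s; is_term p n e' t; 1 \<le> i; i \<le> m\<rbrakk>
    \<Longrightarrow> teq p (m + n - 1) (e + e') (Comp s i (Scale c t)) (Scale c (Comp s i t))"
| teq_comp_unit_right: "\<lbrakk>is_term p m e s; 1 \<le> i; i \<le> m\<rbrakk> \<Longrightarrow> teq p m e (Comp s i Unit) s"
| teq_comp_unit_left: "is_term p m e s \<Longrightarrow> teq p m e (Comp Unit 1 s) s"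
| teq_comp_sequential: "\<lbrakk>is_term p l e s; is_term p m e' t; is_term p n e'' u;
      1 \<le> i; i \<le> l; 1 \<le> j; j \<le> m\<rbrakk>
    \<Longrightarrow> teq p (l + m + n - 2) (e + e' + e'')
          (Comp (Comp s i t) (i + j - 1) u) (Comp s i (Comp t j u))"
| teq_comp_parallel: "\<lbrakk>is_term p l e s; is_term p m e' t; is_term p n e'' u; 1 \<le> i; i < j; j \<le> l\<rbrakk>
    \<Longrightarrow> teq p (l + m + n - 2) (e + e' + e'')
          (Comp (Comp s i t) (j + m - 1) u) (Scale ((- 1) powi (e' * e'')) (Comp (Comp s j u) i t))"
| teq_comp_act: "\<lbrakk>is_term p m e s; is_term p n e' t; 1 \<le> i; i \<le> m;
      \<sigma> permutes {1..m}; \<tau> permutes {1..n}\<rbrakk>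
    \<Longrightarrow> teq p (m + n - 1) (e + e')
          (Comp (Act s \<sigma>) i (Act t \<tau>)) (Act (Comp s (\<sigma> i) t) (comp_perm n i \<sigma> \<tau>))"
\<comment> \<open>differential\<close>
| teq_diff_add: "\<lbrakk>is_term p n e s; is_term p n e t\<rbrakk>
    \<Longrightarrow> teq p n (e + 1) (Diff (Add s t)) (Add (Diff s) (Diff t))"
| teq_diff_smult: "is_term p n e t \<Longrightarrow> teq p n (e + 1) (Diff (Scale c t)) (Scale c (Diff t))"
| teq_diff_diff: "is_term p n e t \<Longrightarrow> teq p n (e + 2) (Diff (Diff t)) (Zero n (e + 2))"
| teq_diff_act: "\<lbrakk>is_term p n e t; \<sigma> permutes {1..n}\<rbrakk>
    \<Longrightarrow> teq p n (e + 1) (Diff (Act t \<sigma>)) (Act (Diff t) \<sigma>)"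
| teq_diff_comp: "\<lbrakk>is_term p m e s; is_term p n e' t; 1 \<le> i; i \<le> m\<rbrakk>
    \<Longrightarrow> teq p (m + n - 1) (e + e' + 1) (Diff (Comp s i t))
          (Add (Comp (Diff s) i t) (Scale ((- 1) powi e) (Comp s i (Diff t))))"

definition tclass :: "('k::field, 'g) presentation \<Rightarrow> ('k, 'g) oterm \<Rightarrow> ('k, 'g) oterm set" where
  "tclass p t = {s. \<exists>n e. teq p n e t s}"

definition presented_operad ::
  "('k::field, 'g) presentation \<Rightarrow> ('k, ('k, 'g) oterm set) dg_operad_data" where
  "presented_operad p = \<lparr>
     el = (\<lambda>n e. {tclass p t | t. is_term p n e t}),
     ozero = (\<lambda>n e. tclass p (Zero n e)),
     oadd = (\<lambda>X Y. \<Union>s\<in>X. \<Union>t\<in>Y. tclass p (Add s t)),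
     osmult = (\<lambda>c X. \<Union>t\<in>X. tclass p (Scale c t)),
     ounit = tclass p Unit,
     ocomp = (\<lambda>X i Y. \<Union>s\<in>X. \<Union>t\<in>Y. tclass p (Comp s i t)),
     oact = (\<lambda>X \<sigma>. \<Union>t\<in>X. tclass p (Act t \<sigma>)),
     odiff = (\<lambda>X. \<Union>t\<in>X. tclass p (Diff t)) \<rparr>"

definition gen_class :: "('k::field, 'g) presentation \<Rightarrow> 'g \<Rightarrow> ('k, 'g) oterm set" where
  "gen_class p g = tclass p (Gen g)"


subsection \<open>Presented operads are DG operads with the expected universal property\<close>

lemma comp_perm_permutes:
  assumes "\<sigma> permutes {1..m}" "\<tau> permutes {1..n}" "1 \<le> i" "i \<le> m"
  shows "comp_perm n i \<sigma> \<tau> permutes {1..m + n - 1}"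
proof -
  have s1: "\<sigma> x \<in> {1..m} \<longleftrightarrow> x \<in> {1..m}" for x using permutes_in_image[OF assms(1)] .
  have t1: "\<tau> x \<in> {1..n} \<longleftrightarrow> x \<in> {1..n}" for x using permutes_in_image[OF assms(2)] .
  have s2: "\<sigma> x = x" if "x \<notin> {1..m}" for x using permutes_not_in[OF assms(1) that] .
  have s3: "\<sigma> x = \<sigma> y \<longleftrightarrow> x = y" for x y using permutes_inj[OF assms(1)] by (auto dest: injD)
  have t3: "\<tau> x = \<tau> y \<longleftrightarrow> x = y" for x y using permutes_inj[OF assms(2)] by (auto dest: injD)
  define \<rho> where "\<rho> = comp_perm n i \<sigma> \<tau>"
  define sh where "sh = (\<lambda>s. if s < \<sigma> i then s else s + n - 1)"
  have rho: "\<rho> x = (if x < i then sh (\<sigma> x) else if x < i + n then \<sigma> i + \<tau> (x + 1 - i) - 1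
      else sh (\<sigma> (x + 1 - n)))" for x
    by (simp add: \<rho>_def comp_perm_def sh_def Let_def)
  have si: "1 \<le> \<sigma> i" "\<sigma> i \<le> m" using s1[of i] assms by auto
  have ti: "1 \<le> \<tau> (x + 1 - i) \<and> \<tau> (x + 1 - i) \<le> n" if "i \<le> x" "x < i + n" for x
    using t1[of "x + 1 - i"] that by auto
  have A: "\<rho> x \<in> {1..m + n - 1}" if "x \<in> {1..m + n - 1}" for x
  proof -
    consider "x < i" | "i \<le> x" "x < i + n" | "i + n \<le> x" by linarith
    then show ?thesis
    proof cases
      case 1
      then have "\<sigma> x \<in> {1..m}" "\<sigma> x \<noteq> \<sigma> i" using s1[of x] s3 that assms by auto
      then show ?thesis using 1 si by (auto simp: rho sh_def)
    next
      case 2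
      then show ?thesis using ti[of x] si by (auto simp: rho)
    next
      case 3
      then have "\<sigma> (x + 1 - n) \<in> {1..m}" "\<sigma> (x + 1 - n) \<noteq> \<sigma> i"
        using s1[of "x + 1 - n"] s3 that assms by auto
      then show ?thesis using 3 si by (auto simp: rho sh_def)
    qed
  qed
  have B: "\<rho> x = x" if "x \<notin> {1..m + n - 1}" for x
  proof -
    from that have "x = 0 \<or> m + n \<le> x" by auto
    then show ?thesis
    proof
      assume "x = 0"
      then show ?thesis using s2[of 0] si assms by (auto simp: rho sh_def)
    next
      assume x: "m + n \<le> x"
      then have "\<sigma> (x + 1 - n) = x + 1 - n" by (intro s2) auto
      then show ?thesis using x si assms by (auto simp: rho sh_def)
    qed
  qed
  have sh_inj: "a = b" if "sh a = sh b" "a \<noteq> \<sigma> i" "b \<noteq> \<sigma> i" for a b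
    using that by (auto simp: sh_def split: if_splits)
  have sh_out: "sh a < \<sigma> i \<or> \<sigma> i + n \<le> sh a" if "a \<noteq> \<sigma> i" for a
    using that by (auto simp: sh_def)
  have mid: "\<sigma> i \<le> \<rho> x \<and> \<rho> x < \<sigma> i + n \<longleftrightarrow> i \<le> x \<and> x < i + n" for x
  proof (cases "i \<le> x \<and> x < i + n")
    case True
    then show ?thesis using ti[of x] si by (auto simp: rho)
  next
    case False
    then show ?thesis
      using sh_out[of "\<sigma> x"] sh_out[of "\<sigma> (x + 1 - n)"] s3[of x i] s3[of "x + 1 - n" i]
      by (cases "x < i") (auto simp: rho)
  qed
  have C: "inj_on \<rho> {1..m + n - 1}"
  proof (rule inj_onI)
    fix x y assume "x \<in> {1..m + n - 1}" "y \<in> {1..m + n - 1}" and eq: "\<rho> x = \<rho> y"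
    show "x = y"
    proof (cases "i \<le> x \<and> x < i + n")
      case True
      moreover have "i \<le> y \<and> y < i + n" using True mid[of x] mid[of y] eq by simp
      moreover have "\<tau> (x + 1 - i) = \<tau> (y + 1 - i)"
        using eq calculation ti[of x] ti[of y] si by (auto simp: rho)
      ultimately show ?thesis by (auto simp: t3)
    next
      case False
      define r where "r = (\<lambda>z. if z < i then z else z + 1 - n)"
      have ny: "\<not> (i \<le> y \<and> y < i + n)" using False mid[of x] mid[of y] eq by simp
      have "\<rho> z = sh (\<sigma> (r z)) \<and> r z \<noteq> i" if "\<not> (i \<le> z \<and> z < i + n)" for z
        using that by (auto simp: rho r_def)
      then have "sh (\<sigma> (r x)) = sh (\<sigma> (r y))" "r x \<noteq> i" "r y \<noteq> i" using False ny eq by auto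
      then have "r x = r y" using sh_inj s3 by metis
      then show ?thesis using False ny by (auto simp: r_def split: if_splits)
    qed
  qed
  have "\<rho> ` {1..m + n - 1} = {1..m + n - 1}"
    using A C by (intro endo_inj_surj) auto
  then have "bij_betw \<rho> {1..m + n - 1} {1..m + n - 1}" using C by (simp add: bij_betw_def)
  then show ?thesis using B unfolding \<rho>_def by (intro bij_imp_permutes) auto
qed

context
  notes One_nat_def [simp del]
begin

lemma is_term_unique: "is_term p n e t \<Longrightarrow> is_term p n' e' t \<Longrightarrow> n = n' \<and> e = e'"
proof (induction arbitrary: n' e' rule: is_term.induct)
  case (1 g)
  from "1.prems" show ?case by cases auto
next
  case (2 n e)
  from "2.prems" show ?case by cases auto
next
  case (3 n e s t)
  from "3.prems" show ?case by cases (use "3.IH" in blast)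
next
  case (4 n e t c)
  from "4.prems" show ?case by cases (use "4.IH" in blast)
next
  case 5
  from "5.prems" show ?case by cases auto
next
  case Comp: (6 m e s n e' t i)
  from Comp.prems show ?case
  proof cases
    case (6 m1 e1 n1 e1')
    then show ?thesis using Comp.IH by metis
  qed
next
  case (7 n e t \<sigma>)
  from "7.prems" show ?case by cases (use "7.IH" in blast)
next
  case (8 n e t)
  from "8.prems" show ?case by cases (use "8.IH" in blast)
qed

lemma is_term_Comp:
  "\<lbrakk>is_term p m e s; is_term p n e' t; 1 \<le> i; i \<le> m; N = m + n - 1; E = e + e'\<rbrakk>
    \<Longrightarrow> is_term p N E (Comp s i t)"
  using is_term.intros(6) by blast

lemma is_term_Diff: "\<lbrakk>is_term p n e t; E = e + 1\<rbrakk> \<Longrightarrow> is_term p n E (Diff t)"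
  using is_term.intros(8) by blast

lemma teq_is_term: "teq p n e s t \<Longrightarrow> is_term p n e s \<and> is_term p n e t"
proof (induction rule: teq.induct)
  case (teq_comp_sequential l e s m e' t n e'' u i j)
  have "is_term p (l + m + n - 2) (e + e' + e'') (Comp (Comp s i t) (i + j - 1) u)"
    using teq_comp_sequential
    by (intro is_term_Comp[where m = "l + m - 1" and n = n and e = "e + e'" and e' = e'']
        is_term_Comp[where m = l and n = m and e = e and e' = e']) auto
  moreover have "is_term p (l + m + n - 2) (e + e' + e'') (Comp s i (Comp t j u))"
    using teq_comp_sequential
    by (intro is_term_Comp[where m = l and n = "m + n - 1" and e = e and e' = "e' + e''"]
        is_term_Comp[where m = m and n = n and e = e' and e' = e'']) auto
  ultimately show ?case by simp
next
  case (teq_comp_parallel l e s m e' t n e'' u i j)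
  have "is_term p (l + m + n - 2) (e + e' + e'') (Comp (Comp s i t) (j + m - 1) u)"
    using teq_comp_parallel
    by (intro is_term_Comp[where m = "l + m - 1" and n = n and e = "e + e'" and e' = e'']
        is_term_Comp[where m = l and n = m and e = e and e' = e']) auto
  moreover have "is_term p (l + m + n - 2) (e + e' + e'') (Comp (Comp s j u) i t)"
    using teq_comp_parallel
    by (intro is_term_Comp[where m = "l + n - 1" and n = m and e = "e + e''" and e' = e']
        is_term_Comp[where m = l and n = n and e = e and e' = e'']) auto
  ultimately show ?case by (simp add: is_term.intros)
next
  case (teq_comp_act m e s n e' t i \<sigma> \<tau>)
  have "1 \<le> \<sigma> i" "\<sigma> i \<le> m"
    using permutes_in_image[OF \<open>\<sigma> permutes {1..m}\<close>, of i] teq_comp_act by auto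
  then have "is_term p (m + n - 1) (e + e') (Comp s (\<sigma> i) t)"
    using teq_comp_act by (intro is_term.intros)
  moreover have "is_term p (m + n - 1) (e + e') (Comp (Act s \<sigma>) i (Act t \<tau>))"
    using teq_comp_act by (intro is_term.intros)
  ultimately show ?case using teq_comp_act comp_perm_permutes[of \<sigma> m \<tau> n i]
    by (simp add: is_term.intros(7))
next
  case (teq_diff_comp m e s n e' t i)
  note st = teq_diff_comp(1,2)
  have "is_term p (m + n - 1) (e + e' + 1) (Comp (Diff s) i t)"
    using teq_diff_comp by (intro is_term_Comp[OF is_term.intros(8)[OF st(1)] st(2)]) auto
  moreover have "is_term p (m + n - 1) (e + e' + 1) (Comp s i (Diff t))"
    using teq_diff_comp by (intro is_term_Comp[OF st(1) is_term.intros(8)[OF st(2)]]) auto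
  moreover have "is_term p (m + n - 1) (e + e' + 1) (Diff (Comp s i t))"
    using teq_diff_comp by (intro is_term.intros)
  ultimately show ?case by (simp add: is_term.intros(3,4))
next
  case (teq_act_act n e t \<sigma> \<tau>)
  then show ?case by (simp add: is_term.intros(7) permutes_compose)
next
  case (teq_diff_diff n e t)
  then show ?case by (auto intro: is_term.intros(2) is_term_Diff[OF is_term_Diff[OF _ refl]])
next
  case (teq_comp_unit_right m e s i)
  then show ?case using is_term_Comp[OF teq_comp_unit_right(1) is_term.intros(5)] by simp
next
  case (teq_comp_unit_left m e s)
  then show ?case using is_term_Comp[OF is_term.intros(5) teq_comp_unit_left(1)] by simp
qed ((elim conjE)?, intro conjI; (rule is_term.intros permutes_id | assumption)+)+

end
context
  notes One_nat_def [simp del]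
begin

lemma teq_imp_is_term:
  assumes "teq p n e s t"
  shows "is_term p n e s" "is_term p n e t"
  using teq_is_term[OF assms] by auto

lemma tclass_eq_iff:
  assumes "is_term p n e s"
  shows "tclass p s = tclass p t \<longleftrightarrow> teq p n e s t"
proof
  assume "tclass p s = tclass p t"
  moreover have "s \<in> tclass p s" unfolding tclass_def using assms teq_refl by blast
  ultimately obtain n' e' where "teq p n' e' t s" unfolding tclass_def by blast
  moreover have "n' = n \<and> e' = e" using is_term_unique[OF teq_imp_is_term(2)[OF calculation] assms] .
  ultimately show "teq p n e s t" by (auto intro: teq_sym)
next
  assume eq: "teq p n e s t"
  have "teq p n' e' t u" if "teq p n' e' s u" for n' e' u
    using is_term_unique[OF teq_imp_is_term(1)[OF that] assms] that eq teq_sym teq_trans by metis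
  moreover have "teq p n' e' s u" if "teq p n' e' t u" for n' e' u
    using is_term_unique[OF teq_imp_is_term(1)[OF that] teq_imp_is_term(2)[OF eq]] that eq teq_trans
    by metis
  ultimately show "tclass p s = tclass p t" unfolding tclass_def by blast
qed

lemma tclassD: "s \<in> tclass p t \<Longrightarrow> is_term p n e t \<Longrightarrow> teq p n e t s"
  unfolding tclass_def using is_term_unique teq_imp_is_term(1) by blast

lemma tclass_self: "is_term p n e t \<Longrightarrow> t \<in> tclass p t"
  unfolding tclass_def using teq_refl by blast

lemma tclass_UN:
  assumes "is_term p n e t" and "\<And>s. teq p n e t s \<Longrightarrow> F s = F t"
  shows "(\<Union>s\<in>tclass p t. F s) = F t"
proof -
  have "F s = F t" if "s \<in> tclass p t" for s
    using assms(2)[OF tclassD[OF that assms(1)]] .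
  moreover have "tclass p t \<noteq> {}" using tclass_self[OF assms(1)] by blast
  ultimately show ?thesis by (rule SUP_eq_const[rotated])
qed

lemma tclass_eqI: "teq p n e s t \<Longrightarrow> tclass p s = tclass p t"
  using tclass_eq_iff teq_imp_is_term(1) by blast

context
  notes One_nat_def [simp del]
  fixes p :: "('k::field, 'g) presentation"
begin

lemma el_presented: "el (presented_operad p) n e = {tclass p t | t. is_term p n e t}"
  by (simp add: presented_operad_def)

lemma ozero_presented: "ozero (presented_operad p) n e = tclass p (Zero n e)"
  by (simp add: presented_operad_def)

lemma ounit_presented: "ounit (presented_operad p) = tclass p Unit"
  by (simp add: presented_operad_def)

lemma oadd_presented:
  assumes "is_term p n e s" "is_term p n e t"
  shows "oadd (presented_operad p) (tclass p s) (tclass p t) = tclass p (Add s t)"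
proof -
  have *: "(\<Union>t'\<in>tclass p t. tclass p (Add s' t')) = tclass p (Add s' t)" if "teq p n e s s'" for s'
    using teq_refl[OF teq_imp_is_term(2)[OF that]]
    by (intro tclass_UN[OF assms(2)] tclass_eqI[OF teq_sym] teq_Add)
  have "(\<Union>s'\<in>tclass p s. \<Union>t'\<in>tclass p t. tclass p (Add s' t')) = (\<Union>t'\<in>tclass p t. tclass p (Add s t'))"
  proof (rule tclass_UN[OF assms(1)])
    fix s' assume s': "teq p n e s s'"
    have "tclass p (Add s' t) = tclass p (Add s t)"
      using s' teq_refl[OF assms(2)] by (intro tclass_eqI[OF teq_sym] teq_Add)
    then show "(\<Union>t'\<in>tclass p t. tclass p (Add s' t')) = (\<Union>t'\<in>tclass p t. tclass p (Add s t'))"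
      using *[OF s'] *[OF teq_refl[OF assms(1)]] by simp
  qed
  then show ?thesis using *[OF teq_refl[OF assms(1)]] by (simp add: presented_operad_def)
qed

lemma osmult_presented:
  assumes "is_term p n e t"
  shows "osmult (presented_operad p) c (tclass p t) = tclass p (Scale c t)"
  unfolding presented_operad_def dg_operad_data.select_convs
  by (rule tclass_UN[OF assms]) (rule tclass_eqI[OF teq_sym[OF teq_Scale]])

lemma ocomp_presented:
  assumes "is_term p m e s" "is_term p n e' t" "1 \<le> i" "i \<le> m"
  shows "ocomp (presented_operad p) (tclass p s) i (tclass p t) = tclass p (Comp s i t)"
proof -
  have *: "(\<Union>t'\<in>tclass p t. tclass p (Comp s' i t')) = tclass p (Comp s' i t)" if "teq p m e s s'" for s'
    by (rule tclass_UN[OF assms(2)])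
      (rule tclass_eqI[OF teq_sym[OF teq_Comp[OF teq_refl[OF teq_imp_is_term(2)[OF that]] _ assms(3,4)]]])
  have "(\<Union>s'\<in>tclass p s. \<Union>t'\<in>tclass p t. tclass p (Comp s' i t')) = (\<Union>t'\<in>tclass p t. tclass p (Comp s i t'))"
  proof (rule tclass_UN[OF assms(1)])
    fix s' assume s': "teq p m e s s'"
    have "tclass p (Comp s' i t) = tclass p (Comp s i t)"
      by (rule tclass_eqI[OF teq_sym[OF teq_Comp[OF s' teq_refl[OF assms(2)] assms(3,4)]]])
    then show "(\<Union>t'\<in>tclass p t. tclass p (Comp s' i t')) = (\<Union>t'\<in>tclass p t. tclass p (Comp s i t'))"
      using *[OF s'] *[OF teq_refl[OF assms(1)]] by simp
  qed
  then show ?thesis using *[OF teq_refl[OF assms(1)]] by (simp add: presented_operad_def)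
qed

lemma oact_presented:
  assumes "is_term p n e t" "\<sigma> permutes {1..n}"
  shows "oact (presented_operad p) (tclass p t) \<sigma> = tclass p (Act t \<sigma>)"
  unfolding presented_operad_def dg_operad_data.select_convs
  by (rule tclass_UN[OF assms(1)]) (rule tclass_eqI[OF teq_sym[OF teq_Act[OF _ assms(2)]]])

lemma odiff_presented:
  assumes "is_term p n e t"
  shows "odiff (presented_operad p) (tclass p t) = tclass p (Diff t)"
  unfolding presented_operad_def dg_operad_data.select_convs
  by (rule tclass_UN[OF assms]) (rule tclass_eqI[OF teq_sym[OF teq_Diff]])

lemmas ops_presented = ozero_presented oadd_presented osmult_presented oact_presented odiff_presented

lemma elE:
  assumes "x \<in> el (presented_operad p) n e"
  obtains t where "x = tclass p t" "is_term p n e t"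
  using assms unfolding el_presented by blast

lemma elI: "is_term p n e t \<Longrightarrow> tclass p t \<in> el (presented_operad p) n e"
  unfolding el_presented by blast

lemma dg_operad_presented: "dg_operad (presented_operad p)"
proof (unfold_locales, goal_cases)
  case (1 n e) show ?case by (simp add: ops_presented[of n e] elI is_term.intros)
next
  case (2 x n e y)
  then show ?case by (elim elE) (simp add: ops_presented[of n e] elI is_term.intros)
next
  case (3 x n e c)
  then show ?case by (elim elE) (simp add: ops_presented[of n e] elI is_term.intros)
next
  case (4 x n e y z)
  then show ?case by (elim elE)
      (simp add: ops_presented[of n e] is_term.intros tclass_eqI[OF teq_add_assoc, of p n e])
next
  case (5 x n e y)
  then show ?case by (elim elE)
      (simp add: ops_presented[of n e] is_term.intros tclass_eqI[OF teq_add_commute, of p n e])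
next
  case (6 x n e)
  then show ?case by (elim elE)
      (simp add: ops_presented[of n e] is_term.intros tclass_eqI[OF teq_add_zero, of p n e])
next
  case (7 x n e)
  then show ?case by (elim elE)
      (simp add: ops_presented[of n e] is_term.intros tclass_eqI[OF teq_add_neg, of p n e])
next
  case (8 x n e y c)
  then show ?case by (elim elE)
      (simp add: ops_presented[of n e] is_term.intros tclass_eqI[OF teq_smult_add, of p n e])
next
  case (9 x n e b c)
  then show ?case by (elim elE)
      (simp add: ops_presented[of n e] is_term.intros tclass_eqI[OF teq_add_smult, of p n e])
next
  case (10 x n e b c)
  then show ?case by (elim elE)
      (simp add: ops_presented[of n e] is_term.intros tclass_eqI[OF teq_smult_smult, of p n e])
next
  case (11 x n e)
  then show ?case by (elim elE)
      (simp add: ops_presented[of n e] is_term.intros tclass_eqI[OF teq_smult_one, of p n e])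
next
  case (12 x n e \<sigma>)
  then show ?case by (elim elE) (simp add: ops_presented[of n e] elI is_term.intros)
next
  case (13 x n e y \<sigma>)
  then show ?case by (elim elE)
      (simp add: ops_presented[of n e] is_term.intros tclass_eqI[OF teq_act_add, of p n e])
next
  case (14 x n e \<sigma> c)
  then show ?case by (elim elE)
      (simp add: ops_presented[of n e] is_term.intros tclass_eqI[OF teq_act_smult, of p n e])
next
  case (15 x n e)
  then show ?case by (elim elE)
      (simp add: oact_presented[of n e] permutes_id tclass_eqI[OF teq_act_id, of p n e])
next
  case (16 x n e \<sigma> \<tau>)
  then show ?case
    by (elim elE) (simp add: oact_presented[of n e] is_term.intros permutes_compose
        tclass_eqI[OF teq_act_act, of p n e])
next
  case 17
  show ?case by (simp add: ounit_presented elI is_term.intros(5))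
next
  case (18 x m e y n e' i)
  then show ?case
    by (elim elE) (simp add: ocomp_presented[of m e _ n e'] elI is_term_Comp[of p m e _ n e'])
next
  case (19 x m e x' y n e' i)
  then show ?case
    by (elim elE) (simp add: ocomp_presented[of m e _ n e'] oadd_presented[of m e]
        oadd_presented[of "m + n - 1" "e + e'"] is_term_Comp[of p m e _ n e']
        is_term.intros(3) tclass_eqI[OF teq_comp_add_left, of p m e _ _ n e'])
next
  case (20 x m e y n e' y' i)
  then show ?case
    by (elim elE) (simp add: ocomp_presented[of m e _ n e'] oadd_presented[of n e']
        oadd_presented[of "m + n - 1" "e + e'"] is_term_Comp[of p m e _ n e']
        is_term.intros(3) tclass_eqI[OF teq_comp_add_right, of p m e _ n e'])
next
  case (21 x m e y n e' i c)
  then show ?case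
    by (elim elE) (simp add: ocomp_presented[of m e _ n e'] osmult_presented[of m e]
        osmult_presented[of "m + n - 1" "e + e'"] is_term_Comp[of p m e _ n e']
        is_term.intros(4) tclass_eqI[OF teq_comp_smult_left, of p m e _ n e'])
next
  case (22 x m e y n e' i c)
  then show ?case
    by (elim elE) (simp add: ocomp_presented[of m e _ n e'] osmult_presented[of n e']
        osmult_presented[of "m + n - 1" "e + e'"] is_term_Comp[of p m e _ n e']
        is_term.intros(4) tclass_eqI[OF teq_comp_smult_right, of p m e _ n e'])
next
  case (23 x m e i)
  then show ?case
    by (elim elE) (simp add: ounit_presented ocomp_presented[of m e _ 1 0] is_term.intros(5)
        tclass_eqI[OF teq_comp_unit_right, of p m e])
next
  case (24 x m e)
  then show ?case
    by (elim elE) (simp add: ounit_presented ocomp_presented[of 1 0 _ m e] is_term.intros(5)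
        tclass_eqI[OF teq_comp_unit_left, of p m e])
next
  case (25 x l e y m e' z n e'' i j)
  from 25(1-3) obtain s t u where
    x: "x = tclass p s" "is_term p l e s" and y: "y = tclass p t" "is_term p m e' t" and
    z: "z = tclass p u" "is_term p n e'' u"
    by (elim elE) blast
  have st: "is_term p (l + m - 1) (e + e') (Comp s i t)"
    and tu: "is_term p (m + n - 1) (e' + e'') (Comp t j u)"
    using 25 by (auto intro!: is_term_Comp[OF x(2) y(2)] is_term_Comp[OF y(2) z(2)])
  show ?case
    using x y z 25 tclass_eqI[OF teq_comp_sequential[OF x(2) y(2) z(2)]]
    by (simp add: ocomp_presented[OF st z(2)] ocomp_presented[OF x(2) tu]
        ocomp_presented[OF x(2) y(2)] ocomp_presented[OF y(2) z(2)])
next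
  case (26 x l e y m e' z n e'' i j)
  from 26(1-3) obtain s t u where
    x: "x = tclass p s" "is_term p l e s" and y: "y = tclass p t" "is_term p m e' t" and
    z: "z = tclass p u" "is_term p n e'' u"
    by (elim elE) blast
  have st: "is_term p (l + m - 1) (e + e') (Comp s i t)"
    and su: "is_term p (l + n - 1) (e + e'') (Comp s j u)"
    using 26 by (auto intro!: is_term_Comp[OF x(2) y(2)] is_term_Comp[OF x(2) z(2)])
  have sut: "is_term p (l + n - 1 + m - 1) (e + e'' + e') (Comp (Comp s j u) i t)"
    using 26 by (intro is_term_Comp[OF su y(2)]) auto
  show ?case
    using x y z 26 tclass_eqI[OF teq_comp_parallel[OF x(2) y(2) z(2)]]
    by (simp add: ocomp_presented[OF st z(2)] ocomp_presented[OF su y(2)] osmult_presented[OF sut]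
        ocomp_presented[OF x(2) y(2)] ocomp_presented[OF x(2) z(2)])
next
  case (27 x m e y n e' i \<sigma> \<tau>)
  from 27(1,2) obtain s t where
    x: "x = tclass p s" "is_term p m e s" and y: "y = tclass p t" "is_term p n e' t"
    by (elim elE) blast
  have s: "1 \<le> \<sigma> i" "\<sigma> i \<le> m" using permutes_in_image[OF 27(5), of i] 27 by auto
  have st: "is_term p (m + n - 1) (e + e') (Comp s (\<sigma> i) t)"
    using x y s by (auto intro!: is_term_Comp)
  show ?case
    using 27 x y s tclass_eqI[OF teq_comp_act[OF x(2) y(2) 27(3-6)]]
      comp_perm_permutes[OF 27(5,6,3,4)]
    by (simp add: oact_presented[OF x(2)] oact_presented[OF y(2)] oact_presented[OF st]
        ocomp_presented[of m e _ n e'] is_term.intros)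
next
  case (28 x n e)
  then show ?case by (elim elE) (simp add: odiff_presented[of n e] elI is_term.intros)
next
  case (29 x n e y)
  then show ?case
    by (elim elE) (simp add: odiff_presented[of n e] oadd_presented[of n e]
        oadd_presented[of n "e + 1"] is_term.intros tclass_eqI[OF teq_diff_add, of p n e])
next
  case (30 x n e c)
  then show ?case
    by (elim elE) (simp add: odiff_presented[of n e] osmult_presented[of n e]
        osmult_presented[of n "e + 1"] is_term.intros tclass_eqI[OF teq_diff_smult, of p n e])
next
  case (31 x n e)
  then show ?case
    by (elim elE) (simp add: odiff_presented[of n e] odiff_presented[of n "e + 1"] ozero_presented
        is_term.intros tclass_eqI[OF teq_diff_diff, of p n e])
next
  case (32 x n e \<sigma>)
  then show ?case
    by (elim elE) (simp add: odiff_presented[of n e] oact_presented[of n e]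
        oact_presented[of n "e + 1"] is_term.intros tclass_eqI[OF teq_diff_act, of p n e])
next
  case (33 x m e y n e' i)
  from 33(1,2) obtain s t where
    x: "x = tclass p s" "is_term p m e s" and y: "y = tclass p t" "is_term p n e' t"
    by (elim elE) blast
  have st: "is_term p (m + n - 1) (e + e') (Comp s i t)"
    and dst: "is_term p (m + n - 1) (e + e' + 1) (Comp (Diff s) i t)"
    and sdt: "is_term p (m + n - 1) (e + e' + 1) (Comp s i (Diff t))"
    using x y 33
    by (auto intro!: is_term_Comp[OF x(2) y(2)] is_term_Comp[OF is_term.intros(8)[OF x(2)] y(2)]
        is_term_Comp[OF x(2) is_term.intros(8)[OF y(2)]])
  show ?case
    using 33 x y tclass_eqI[OF teq_diff_comp[OF x(2) y(2) 33(3,4)]]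
    by (simp add: odiff_presented[OF x(2)] odiff_presented[OF y(2)] odiff_presented[OF st]
        ocomp_presented[OF x(2) y(2)] ocomp_presented[OF is_term.intros(8)[OF x(2)] y(2)]
        ocomp_presented[OF x(2) is_term.intros(8)[OF y(2)]] osmult_presented[OF sdt]
        oadd_presented[OF dst is_term.intros(4)[OF sdt]])
qed

end

end

primrec teval :: "('k, 'a) dg_operad_data \<Rightarrow> ('g \<Rightarrow> 'a) \<Rightarrow> ('k, 'g) oterm \<Rightarrow> 'a" where
  "teval Q a (Gen g) = a g"
| "teval Q a (Zero n e) = ozero Q n e"
| "teval Q a (Add s t) = oadd Q (teval Q a s) (teval Q a t)"
| "teval Q a (Scale c t) = osmult Q c (teval Q a t)"
| "teval Q a Unit = ounit Q"
| "teval Q a (Comp s i t) = ocomp Q (teval Q a s) i (teval Q a t)"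
| "teval Q a (Act t \<sigma>) = oact Q (teval Q a t) \<sigma>"
| "teval Q a (Diff t) = odiff Q (teval Q a t)"

lemma (in dg_operad) teval_closed:
  assumes "is_term p n e t" "\<And>g. g \<in> gens p \<Longrightarrow> a g \<in> el P (gen_arity p g) (gen_degree p g)"
  shows "teval P a t \<in> el P n e"
  using assms(1)
  by induction (simp_all add: assms(2) zero_closed add_closed smult_closed unit_closed[simplified]
      comp_closed[simplified] act_closed[simplified] diff_closed)

lemma (in dg_operad) teval_sound:
  assumes "teq p n e s t" "\<And>g. g \<in> gens p \<Longrightarrow> a g \<in> el P (gen_arity p g) (gen_degree p g)"
    and "\<And>s t. (s, t) \<in> rels p \<Longrightarrow> teval P a s = teval P a t"
  shows "teval P a s = teval P a t"
  using assms(1)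
proof induction
  case (teq_comp_parallel l e s m e' t n e'' u i j)
  note c = teq_comp_parallel(1-3)[THEN teval_closed, OF assms(2)]
  show ?case using comp_parallel[OF c teq_comp_parallel(4-6)] by simp
next
  case (teq_comp_sequential l e s m e' t n e'' u i j)
  note c = teq_comp_sequential(1-3)[THEN teval_closed, OF assms(2)]
  show ?case using comp_sequential[OF c teq_comp_sequential(4-7)] by simp
next
  case (teq_comp_act m e s n e' t i \<sigma> \<tau>)
  note c = teq_comp_act(1,2)[THEN teval_closed, OF assms(2)]
  show ?case using comp_act[OF c teq_comp_act(3-6)] by simp
next
  case (teq_diff_comp m e s n e' t i)
  note c = teq_diff_comp(1,2)[THEN teval_closed, OF assms(2)]
  show ?case using diff_comp[OF c teq_diff_comp(3,4)] by simp
next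
  case (teq_comp_add_left m e s s' n e' t i)
  note c = teq_comp_add_left(1-3)[THEN teval_closed, OF assms(2)]
  show ?case using comp_add_left[OF c teq_comp_add_left(4,5)] by simp
next
  case (teq_comp_add_right m e s n e' t t' i)
  note c = teq_comp_add_right(1-3)[THEN teval_closed, OF assms(2)]
  show ?case using comp_add_right[OF c teq_comp_add_right(4,5)] by simp
next
  case (teq_comp_smult_left m e s n e' t i c)
  note c = teq_comp_smult_left(1,2)[THEN teval_closed, OF assms(2)]
  show ?case using comp_smult_left[OF c teq_comp_smult_left(3,4)] by simp
next
  case (teq_comp_smult_right m e s n e' t i c)
  note c = teq_comp_smult_right(1,2)[THEN teval_closed, OF assms(2)]
  show ?case using comp_smult_right[OF c teq_comp_smult_right(3,4)] by simp
next
  case (teq_comp_unit_right m e s i)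
  show ?case using comp_unit_right[OF teval_closed[OF teq_comp_unit_right(1) assms(2)]]
    teq_comp_unit_right by simp
next
  case (teq_comp_unit_left m e s)
  show ?case using comp_unit_left[OF teval_closed[OF teq_comp_unit_left(1) assms(2)]] by simp
next
  case (teq_act_add n e s t \<sigma>)
  note c = teq_act_add(1,2)[THEN teval_closed, OF assms(2)]
  show ?case using act_add[OF c teq_act_add(3)] by simp
next
  case (teq_act_smult n e t \<sigma> c)
  show ?case using act_smult[OF teval_closed[OF teq_act_smult(1) assms(2)] teq_act_smult(2)] by simp
next
  case (teq_act_act n e t \<sigma> \<tau>)
  show ?case using act_act[OF teval_closed[OF teq_act_act(1) assms(2)] teq_act_act(2,3)] by simp
next
  case (teq_diff_act n e t \<sigma>)
  show ?case using diff_act[OF teval_closed[OF teq_diff_act(1) assms(2)] teq_diff_act(2)] by simp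
next
  case (teq_add_assoc n e s t u)
  show ?case using teq_add_assoc[THEN teval_closed, OF assms(2)] by (simp add: add_assoc)
next
  case (teq_add_commute n e s t)
  show ?case using add_commute[OF teq_add_commute[THEN teval_closed, OF assms(2)]] by simp
next
  case (teq_add_zero n e t)
  show ?case using teq_add_zero[THEN teval_closed, OF assms(2)] by (simp add: add_zero)
next
  case (teq_add_neg n e t)
  show ?case using teq_add_neg[THEN teval_closed, OF assms(2)] by (simp add: add_neg)
next
  case (teq_smult_add n e s t c)
  show ?case using teq_smult_add[THEN teval_closed, OF assms(2)] by (simp add: smult_add)
next
  case (teq_add_smult n e t b c)
  show ?case using teq_add_smult[THEN teval_closed, OF assms(2)] by (simp add: add_smult)
next
  case (teq_smult_smult n e t b c)
  show ?case using teq_smult_smult[THEN teval_closed, OF assms(2)] by (simp add: smult_smult)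
next
  case (teq_smult_one n e t)
  show ?case using teq_smult_one[THEN teval_closed, OF assms(2)] by (simp add: smult_one)
next
  case (teq_act_id n e t)
  show ?case using teq_act_id[THEN teval_closed, OF assms(2)] by (simp add: act_id)
next
  case (teq_diff_add n e s t)
  show ?case using teq_diff_add[THEN teval_closed, OF assms(2)] by (simp add: diff_add)
next
  case (teq_diff_smult n e t c)
  show ?case using teq_diff_smult[THEN teval_closed, OF assms(2)] by (simp add: diff_smult)
next
  case (teq_diff_diff n e t)
  show ?case using teq_diff_diff[THEN teval_closed, OF assms(2)] by (simp add: diff_diff)
qed (simp_all add: assms(3))

theorem presented_operad_hom_exists:
  fixes p :: "('k::field, 'g) presentation" and Q :: "('k, 'a) dg_operad_data"
  assumes "dg_operad Q"
    and "\<And>g. g \<in> gens p \<Longrightarrow> a g \<in> el Q (gen_arity p g) (gen_degree p g)"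
    and "\<And>s t. (s, t) \<in> rels p \<Longrightarrow> teval Q a s = teval Q a t"
  shows "\<exists>f. dg_operad_hom (presented_operad p) Q f \<and> (\<forall>g\<in>gens p. f (gen_class p g) = a g)"
proof -
  interpret Q: dg_operad Q by fact
  interpret P: dg_operad "presented_operad p" by (rule dg_operad_presented)
  define f where "f = (\<lambda>X. teval Q a (SOME t. t \<in> X))"
  have f: "f (tclass p t) = teval Q a t" if "is_term p n e t" for n e t
  proof -
    have "(SOME s. s \<in> tclass p t) \<in> tclass p t" using tclass_self[OF that] by (rule someI)
    then have "teq p n e t (SOME s. s \<in> tclass p t)" using tclassD that by blast
    then show ?thesis unfolding f_def using Q.teval_sound[OF _ assms(2,3)] by metis
  qed
  have "dg_operad_hom (presented_operad p) Q f"
  proof (unfold_locales, goal_cases)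
    case (1 x n e)
    then show ?case using Q.teval_closed[OF _ assms(2)] f by (elim elE) metis
  next
    case (2 x n e y)
    then show ?case
      by (elim elE) (simp add: oadd_presented[of p n e] f[of n e] is_term.intros(3))
  next
    case (3 x n e c)
    then show ?case
      by (elim elE) (simp add: osmult_presented[of p n e] f[of n e] is_term.intros(4))
  next
    case 4
    show ?case using f[OF is_term.intros(5)] by (simp add: ounit_presented)
  next
    case (5 x m e y n e' i)
    from 5(1,2) obtain s t where "x = tclass p s" "is_term p m e s"
      "y = tclass p t" "is_term p n e' t" by (elim elE) blast
    then show ?case
      using 5 f[OF is_term.intros(6)] by (simp add: ocomp_presented[of p m e _ n e'] f)
  next
    case (6 x n e \<sigma>)
    then show ?case
      using f[OF is_term.intros(7)] by (elim elE) (simp add: oact_presented[of p n e] f[of n e])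
  next
    case (7 x n e)
    then show ?case
      using f[OF is_term.intros(8)] by (elim elE) (simp add: odiff_presented[of p n e] f[of n e])
  qed
  moreover have "f (gen_class p g) = a g" if "g \<in> gens p" for g
    using f[OF is_term.intros(1)[OF that]] by (simp add: gen_class_def)
  ultimately show ?thesis by blast
qed

lemma (in dg_operad_hom) hom_zero: "f (ozero P n e) = ozero Q n e"
proof -
  let ?z = "ozero P n e"
  have z: "?z \<in> el P n e" by (rule P.zero_closed)
  then have "f ?z = f (oadd P ?z (osmult P (- 1) ?z))" by (simp add: P.add_neg)
  also have "\<dots> = ozero Q n e"
    using z
    by (simp add: hom_add[of _ n e] hom_smult[of _ n e] P.smult_closed Q.add_neg[of _ n e] hom_closed)
  finally show ?thesis .
qed

theorem presented_operad_hom_unique: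
  assumes "dg_operad_hom (presented_operad p) Q f" "dg_operad_hom (presented_operad p) Q f'"
    and "\<And>g. g \<in> gens p \<Longrightarrow> f (gen_class p g) = f' (gen_class p g)"
    and "x \<in> el (presented_operad p) n e"
  shows "f x = f' x"
proof -
  interpret F: dg_operad_hom "presented_operad p" Q f by fact
  interpret F': dg_operad_hom "presented_operad p" Q f' by fact
  have "f (tclass p t) = f' (tclass p t)" if "is_term p n e t" for t n e
    using that
  proof induction
    case (1 g)
    then show ?case using assms(3) by (simp add: gen_class_def)
  next
    case (2 n e)
    show ?case using F.hom_zero[of n e] F'.hom_zero[of n e] by (simp add: ozero_presented)
  next
    case (3 n e s t)
    then show ?case using F.hom_add[OF elI elI] F'.hom_add[OF elI elI] oadd_presented by metis
  next
    case (4 n e t c)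
    then show ?case using F.hom_smult[OF elI] F'.hom_smult[OF elI] osmult_presented by metis
  next
    case 5
    show ?case using F.hom_unit F'.hom_unit by (simp add: ounit_presented)
  next
    case (6 m e s n e' t i)
    then show ?case
      using F.hom_comp[OF elI elI] F'.hom_comp[OF elI elI] ocomp_presented by metis
  next
    case (7 n e t \<sigma>)
    then show ?case using F.hom_act[OF elI] F'.hom_act[OF elI] oact_presented by metis
  next
    case (8 n e t)
    then show ?case using F.hom_diff[OF elI] F'.hom_diff[OF elI] odiff_presented by metis
  qed
  then show ?thesis using assms(4) by (elim elE) blast
qed

section \<open>Formal expressions used in the relations\<close>

text \<open>
  Formal sum of a family of expressions of arity \<open>n\<close> and degree \<open>e\<close> over a finite set. As addition is
  commutative in the presented operad, the choice of the enumeration does not matter.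
\<close>

definition term_sum ::
  "nat \<Rightarrow> int \<Rightarrow> ('i \<Rightarrow> ('k, 'g) oterm) \<Rightarrow> 'i set \<Rightarrow> ('k, 'g) oterm" where
  "term_sum n e F A = foldr (\<lambda>i t. Add (F i) t) (SOME xs. set xs = A \<and> distinct xs) (Zero n e)"

definition iter_prod :: "('k, 'g) oterm \<Rightarrow> nat \<Rightarrow> ('k, 'g) oterm" where
  "iter_prod \<mu> m = ((\<lambda>t. Comp \<mu> 1 t) ^^ (m - 1)) Unit"

definition shuffle_perms :: "nat \<Rightarrow> nat \<Rightarrow> (nat \<Rightarrow> nat) set" where
  "shuffle_perms p q = {\<sigma>. \<sigma> permutes {1..p + q}
     \<and> strict_mono_on {1..p} \<sigma> \<and> strict_mono_on {p + 1..p + q} \<sigma>}"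

text \<open>The left-hand side of the relation that \<open>D\<close>, of degree \<open>e\<close>, is an operator of order at most \<open>n\<close>.\<close>

definition DO :: "('k::field, 'g) oterm \<Rightarrow> nat \<Rightarrow> int \<Rightarrow> ('k, 'g) oterm \<Rightarrow> ('k, 'g) oterm" where
  "DO \<mu> n e D = term_sum (n + 1) e (\<lambda>(p, q). Scale ((- 1) ^ p)
     (term_sum (n + 1) e
       (\<lambda>\<sigma>. Act (Comp (iter_prod \<mu> (q + 1)) 1 (Comp D 1 (iter_prod \<mu> p))) (inv \<sigma>))
       (shuffle_perms p q)))
     {(p, q). p + q = n + 1 \<and> p \<ge> 1}"

text \<open>The graded commutator of \<open>a\<close> and \<open>b\<close>, of arity 1 and degrees \<open>d\<close> and \<open>e\<close>.\<close>

definition bracket ::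
  "int \<Rightarrow> int \<Rightarrow> ('k::field, 'g) oterm \<Rightarrow> ('k, 'g) oterm \<Rightarrow> ('k, 'g) oterm" where
  "bracket d e a b = Add (Comp a 1 b) (Scale (- ((- 1) powi (d * e))) (Comp b 1 a))"

definition comm_rels :: "('k, 'g) oterm \<Rightarrow> (('k, 'g) oterm \<times> ('k, 'g) oterm) set" where
  "comm_rels \<mu> = {(Diff \<mu>, Zero 2 1), (Act \<mu> (Transposition.transpose 1 2), \<mu>),
     (Comp \<mu> 1 \<mu>, Comp \<mu> 2 \<mu>)}"


section \<open>The operads \<open>C\<close>, \<open>EBV\<close> and \<open>BV/\<Delta>\<close>\<close>

datatype com_gen = Com_mu

definition com_presentation :: "('k::field, com_gen) presentation" where
  "com_presentation = \<lparr>gens = UNIV, gen_arity = (\<lambda>_. 2), gen_degree = (\<lambda>_. 0),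
     rels = comm_rels (Gen Com_mu)\<rparr>"

definition com_operad :: "('k::field, ('k, com_gen) oterm set) dg_operad_data" where
  "com_operad = presented_operad com_presentation"


datatype ebv_gen = EBV_mu | EBV_i

definition ebv_rels :: "(('k::field, ebv_gen) oterm \<times> ('k, ebv_gen) oterm) set" where
  "ebv_rels = (let \<mu> = Gen EBV_mu; i = Gen EBV_i in
     comm_rels \<mu> \<union> {(Comp i 1 (Diff i), Comp (Diff i) 1 i), (DO \<mu> 2 (- 2) i, Zero 3 (- 2))})"

definition ebv_presentation :: "('k::field, ebv_gen) presentation" where
  "ebv_presentation = \<lparr>gens = UNIV,
     gen_arity = (\<lambda>g. case g of EBV_mu \<Rightarrow> 2 | EBV_i \<Rightarrow> 1),
     gen_degree = (\<lambda>g. case g of EBV_mu \<Rightarrow> 0 | EBV_i \<Rightarrow> - 2),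
     rels = ebv_rels\<rparr>"

definition ebv_operad :: "('k::field, ('k, ebv_gen) oterm set) dg_operad_data" where
  "ebv_operad = presented_operad ebv_presentation"


datatype bvd_gen = BVD_mu | BVD_Delta | BVD_phi nat

text \<open>\<open>nested_bracket [q\<^sub>1, \<dots>, q\<^sub>p]\<close> is \<open>[\<phi>\<^bsub>q\<^sub>1\<^esub>, \<dots> [\<phi>\<^bsub>q\<^sub>p\<^sub>-\<^sub>1\<^esub>, d(\<phi>\<^bsub>q\<^sub>p\<^esub>)] \<dots>]\<close>.\<close>

fun nested_bracket :: "nat list \<Rightarrow> ('k::field, bvd_gen) oterm" where
  "nested_bracket [] = Zero 1 1"
| "nested_bracket [q] = Diff (Gen (BVD_phi q))"
| "nested_bracket (q # q' # qs) =
     bracket (- 2 * int q) (1 - 2 * int (sum_list (q' # qs)))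
       (Gen (BVD_phi q)) (nested_bracket (q' # qs))"

definition phi_rel_lhs :: "nat \<Rightarrow> ('k::field_char_0, bvd_gen) oterm" where
  "phi_rel_lhs n = Add (Diff (Gen (BVD_phi n)))
     (term_sum 1 (1 - 2 * int n)
       (\<lambda>p. Scale (1 / fact p) (term_sum 1 (1 - 2 * int n) nested_bracket
          {qs. length qs = p \<and> sum_list qs = n \<and> (\<forall>q\<in>set qs. q \<ge> 1)}))
       {2..n})"

definition bvd_rels :: "(('k::field_char_0, bvd_gen) oterm \<times> ('k, bvd_gen) oterm) set" where
  "bvd_rels = (let \<mu> = Gen BVD_mu; \<Delta> = Gen BVD_Delta in
     comm_rels \<mu> \<union>
     {(Diff \<Delta>, Zero 1 0), (Comp \<Delta> 1 \<Delta>, Zero 1 (- 2)), (DO \<mu> 2 (- 1) \<Delta>, Zero 3 (- 1)),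
      (Diff (Gen (BVD_phi 1)), Scale (- 1) \<Delta>)} \<union>
     {(phi_rel_lhs n, Zero 1 (1 - 2 * int n)) | n. n \<ge> 2})"

definition bvd_presentation :: "('k::field_char_0, bvd_gen) presentation" where
  "bvd_presentation = \<lparr>gens = {BVD_mu, BVD_Delta} \<union> {BVD_phi n | n. n \<ge> 1},
     gen_arity = (\<lambda>g. case g of BVD_mu \<Rightarrow> 2 | BVD_Delta \<Rightarrow> 1 | BVD_phi n \<Rightarrow> 1),
     gen_degree = (\<lambda>g. case g of BVD_mu \<Rightarrow> 0 | BVD_Delta \<Rightarrow> - 1 | BVD_phi n \<Rightarrow> - 2 * int n),
     rels = bvd_rels\<rparr>"

definition bvd_operad :: "('k::field_char_0, ('k, bvd_gen) oterm set) dg_operad_data" where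
  "bvd_operad = presented_operad bvd_presentation"


subsection \<open>All relations are between expressions of the same arity and degree\<close>

text \<open>Hence none of them is discarded by the typing premises of \<open>teq_rel\<close>.\<close>

lemma is_term_term_sum:
  assumes "finite A" "\<And>i. i \<in> A \<Longrightarrow> is_term p n e (F i)"
  shows "is_term p n e (term_sum n e F A)"
proof -
  define xs where "xs = (SOME xs. set xs = A \<and> distinct xs)"
  have "set xs = A \<and> distinct xs"
    unfolding xs_def by (rule someI_ex) (rule finite_distinct_list[OF assms(1)])
  then have "set xs \<subseteq> A" by simp
  then have "is_term p n e (foldr (\<lambda>i t. Add (F i) t) xs (Zero n e))"
    by (induction xs) (auto intro: is_term.intros(2,3) assms(2))
  then show ?thesis by (simp add: term_sum_def xs_def)
qed

lemma is_term_Gen: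
  "\<lbrakk>g \<in> gens p; gen_arity p g = n; gen_degree p g = e\<rbrakk> \<Longrightarrow> is_term p n e (Gen g)"
  using is_term.intros(1)[of g p] by simp

lemma is_term_iter_prod:
  assumes "is_term p 2 0 \<mu>" "m \<ge> 1"
  shows "is_term p m 0 (iter_prod \<mu> m)"
proof -
  have "is_term p (Suc k) 0 (((\<lambda>t. Comp \<mu> 1 t) ^^ k) Unit)" for k
  proof (induction k)
    case 0
    then show ?case using is_term.intros(5) by simp
  next
    case (Suc k)
    then show ?case using is_term_Comp[OF assms(1) Suc, of 1] by simp
  qed
  from this[of "m - 1"] show ?thesis using assms(2) by (simp add: iter_prod_def)
qed

lemma finite_shuffle_perms: "finite (shuffle_perms p q)"
  unfolding shuffle_perms_def by (rule finite_subset[OF _ finite_permutations[of "{1..p + q}"]]) auto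

lemma is_term_DO:
  assumes "is_term p 2 0 \<mu>" "is_term p 1 e D"
  shows "is_term p (n + 1) e (DO \<mu> n e D)"
  unfolding DO_def
proof (rule is_term_term_sum)
  have "{(r, q). r + q = n + 1 \<and> 1 \<le> r} \<subseteq> {..n + 1} \<times> {..n + 1}" by auto
  then show "finite {(r, q). r + q = n + 1 \<and> 1 \<le> r}" by (rule finite_subset) auto
next
  fix x assume "x \<in> {(r, q). r + q = n + 1 \<and> 1 \<le> r}"
  then obtain r q where x: "x = (r, q)" and rq: "r + q = n + 1" "1 \<le> r" by blast
  have D: "is_term p r e (Comp D 1 (iter_prod \<mu> r))"
    using is_term_Comp[OF assms(2) is_term_iter_prod[OF assms(1) rq(2)], of 1] by simp
  have "is_term p (n + 1) e (Comp (iter_prod \<mu> (q + 1)) 1 (Comp D 1 (iter_prod \<mu> r)))"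
    by (rule is_term_Comp[OF is_term_iter_prod[OF assms(1)] D]) (use rq in auto)
  moreover have "inv \<sigma> permutes {1..n + 1}" if "\<sigma> \<in> shuffle_perms r q" for \<sigma>
    using that rq unfolding shuffle_perms_def by (auto intro: permutes_inv)
  ultimately show "is_term p (n + 1) e (case x of (p, q) \<Rightarrow> Scale ((- 1) ^ p)
      (term_sum (n + 1) e
        (\<lambda>\<sigma>. Act (Comp (iter_prod \<mu> (q + 1)) 1 (Comp D 1 (iter_prod \<mu> p))) (inv \<sigma>))
        (shuffle_perms p q)))"
    unfolding x prod.case
    by (intro is_term.intros(4) is_term_term_sum finite_shuffle_perms is_term.intros(7))
qed

definition same_type :: "('k, 'g) presentation \<Rightarrow> ('k, 'g) oterm \<times> ('k, 'g) oterm \<Rightarrow> bool" where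
  "same_type p r \<longleftrightarrow> (\<exists>n e. is_term p n e (fst r) \<and> is_term p n e (snd r))"

lemma same_typeI: "is_term p n e s \<Longrightarrow> is_term p n e t \<Longrightarrow> same_type p (s, t)"
  unfolding same_type_def by auto

lemma comm_rels_same_type:
  assumes "is_term p 2 0 \<mu>" "r \<in> comm_rels \<mu>"
  shows "same_type p r"
proof -
  have "Transposition.transpose 1 2 permutes {1..2::nat}" by (rule permutes_swap_id) auto
  then have "same_type p (Act \<mu> (Transposition.transpose 1 2), \<mu>)"
    using assms(1) by (auto intro!: same_typeI is_term.intros(7))
  moreover have "same_type p (Diff \<mu>, Zero 2 1)"
    using assms(1) by (intro same_typeI[of _ 2 1] is_term_Diff is_term.intros(2)) auto
  moreover have "same_type p (Comp \<mu> 1 \<mu>, Comp \<mu> 2 \<mu>)"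
    by (intro same_typeI[of _ 3 0] is_term_Comp[OF assms(1) assms(1)]) auto
  ultimately show ?thesis using assms(2) by (auto simp: comm_rels_def)
qed

lemma com_rels_same_type: "r \<in> rels com_presentation \<Longrightarrow> same_type com_presentation r"
  using is_term.intros(1)[of Com_mu com_presentation]
  by (auto simp: com_presentation_def intro: comm_rels_same_type)

lemma ebv_rels_same_type:
  assumes "r \<in> rels (ebv_presentation :: ('k::field, ebv_gen) presentation)"
  shows "same_type ebv_presentation r"
proof -
  let ?p = "ebv_presentation :: ('k, ebv_gen) presentation"
  have mu: "is_term ?p 2 0 (Gen EBV_mu)" and i: "is_term ?p 1 (- 2) (Gen EBV_i)"
    by (rule is_term_Gen; simp add: ebv_presentation_def)+
  have di: "is_term ?p 1 (- 1) (Diff (Gen EBV_i))" by (rule is_term_Diff[OF i]) simp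
  have "same_type ?p (Comp (Gen EBV_i) 1 (Diff (Gen EBV_i)), Comp (Diff (Gen EBV_i)) 1 (Gen EBV_i))"
    by (intro same_typeI[of _ 1 "- 3"] is_term_Comp[OF i di] is_term_Comp[OF di i]) auto
  moreover have "same_type ?p (DO (Gen EBV_mu) 2 (- 2) (Gen EBV_i), Zero 3 (- 2))"
    using is_term_DO[OF mu i, of 2] by (auto intro: same_typeI is_term.intros(2))
  moreover have "r \<in> ebv_rels" using assms by (simp add: ebv_presentation_def)
  ultimately show ?thesis using comm_rels_same_type[OF mu] unfolding ebv_rels_def Let_def by blast
qed

lemma is_term_nested_bracket:
  assumes "qs \<noteq> []" "\<forall>q\<in>set qs. q \<ge> 1"
  shows "is_term (bvd_presentation :: ('k::field_char_0, bvd_gen) presentation)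
    1 (1 - 2 * int (sum_list qs)) (nested_bracket qs)"
proof -
  let ?p = "bvd_presentation :: ('k, bvd_gen) presentation"
  have phi: "is_term ?p 1 (- 2 * int q) (Gen (BVD_phi q))" if "q \<ge> 1" for q
    by (rule is_term_Gen) (use that in \<open>simp_all add: bvd_presentation_def\<close>)
  show ?thesis
    using assms
  proof (induction qs rule: nested_bracket.induct)
    case (2 q)
    then show ?case using is_term_Diff[OF phi[of q]] by simp
  next
    case (3 q q' qs)
    then have a: "is_term ?p 1 (- 2 * int q) (Gen (BVD_phi q))"
      and b: "is_term ?p 1 (1 - 2 * int (sum_list (q' # qs))) (nested_bracket (q' # qs))"
      using phi by simp_all
    show ?case
      unfolding nested_bracket.simps bracket_def
      by (intro is_term.intros(3,4) is_term_Comp[OF a b] is_term_Comp[OF b a]) auto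
  qed simp
qed

lemma bvd_rels_same_type:
  assumes "r \<in> rels (bvd_presentation :: ('k::field_char_0, bvd_gen) presentation)"
  shows "same_type bvd_presentation r"
proof -
  let ?p = "bvd_presentation :: ('k, bvd_gen) presentation"
  have mu: "is_term ?p 2 0 (Gen BVD_mu)" and De: "is_term ?p 1 (- 1) (Gen BVD_Delta)"
    and phi: "\<And>q. q \<ge> 1 \<Longrightarrow> is_term ?p 1 (- 2 * int q) (Gen (BVD_phi q))"
    by (rule is_term_Gen; simp add: bvd_presentation_def)+
  have "same_type ?p (Diff (Gen BVD_Delta), Zero 1 0)"
    using is_term_Diff[OF De] by (auto intro: same_typeI is_term.intros(2))
  moreover have "same_type ?p (Comp (Gen BVD_Delta) 1 (Gen BVD_Delta), Zero 1 (- 2))"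
    by (intro same_typeI[of _ 1 "- 2"] is_term_Comp[OF De De] is_term.intros(2)) auto
  moreover have "same_type ?p (DO (Gen BVD_mu) 2 (- 1) (Gen BVD_Delta), Zero 3 (- 1))"
    using is_term_DO[OF mu De, of 2] by (auto intro: same_typeI is_term.intros(2))
  moreover have "same_type ?p (Diff (Gen (BVD_phi 1)), Scale (- 1) (Gen BVD_Delta))"
    by (intro same_typeI[of _ 1 "- 1"] is_term_Diff[OF phi] is_term.intros(4) De) auto
  moreover have "same_type ?p (phi_rel_lhs n, Zero 1 (1 - 2 * int n))" if n: "n \<ge> 2" for n
  proof (rule same_typeI[OF _ is_term.intros(2)])
    have fin: "finite {qs. length qs = m \<and> sum_list qs = n \<and> (\<forall>q\<in>set qs. 1 \<le> q)}" for m
      by (rule finite_subset[OF _ finite_lists_length_eq[of "{..n}" m]])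
        (auto intro: member_le_sum_list)
    have nb: "is_term ?p 1 (1 - 2 * int n) (nested_bracket qs)"
      if "m \<in> {2..n}" "qs \<in> {qs. length qs = m \<and> sum_list qs = n \<and> (\<forall>q\<in>set qs. 1 \<le> q)}" for m qs
    proof -
      have "qs \<noteq> []" using that by auto
      then show ?thesis using is_term_nested_bracket[of qs] that by simp
    qed
    have d: "is_term ?p 1 (1 - 2 * int n) (Diff (Gen (BVD_phi n)))"
      by (rule is_term_Diff[OF phi]) (use n in auto)
    show "is_term ?p 1 (1 - 2 * int n) (phi_rel_lhs n)"
      unfolding phi_rel_lhs_def
      by (intro is_term.intros(3,4) d is_term_term_sum finite_atLeastAtMost fin nb)
  qed
  moreover have "r \<in> bvd_rels" using assms by (simp add: bvd_presentation_def)
  ultimately show ?thesis using comm_rels_same_type[OF mu] unfolding bvd_rels_def Let_def by blast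
qed


subsection \<open>The morphisms between these operads\<close>

definition com_to_bvd ::
  "(('k::field_char_0, com_gen) oterm set \<Rightarrow> ('k, bvd_gen) oterm set) \<Rightarrow> bool" where
  "com_to_bvd f \<longleftrightarrow> dg_operad_hom com_operad bvd_operad f \<and>
     f (gen_class com_presentation Com_mu) = gen_class bvd_presentation BVD_mu"

definition bvd_to_ebv ::
  "(('k::field_char_0, bvd_gen) oterm set \<Rightarrow> ('k, ebv_gen) oterm set) \<Rightarrow> bool" where
  "bvd_to_ebv g \<longleftrightarrow> dg_operad_hom bvd_operad ebv_operad g \<and>
     g (gen_class bvd_presentation BVD_mu) = gen_class ebv_presentation EBV_mu \<and>
     g (gen_class bvd_presentation BVD_Delta) =
       osmult ebv_operad (- 1) (odiff ebv_operad (gen_class ebv_presentation EBV_i)) \<and>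
     g (gen_class bvd_presentation (BVD_phi 1)) = gen_class ebv_presentation EBV_i \<and>
     (\<forall>n\<ge>2. g (gen_class bvd_presentation (BVD_phi n)) = ozero ebv_operad 1 (- 2 * int n))"

end

theory Submission
  imports Defs
begin

text \<open>
  The operad \<open>EBV\<close> is graded by weight, the number of occurrences of \<open>i\<close> and \<open>d i\<close>: every relation is
  homogeneous, and \<open>d\<close> preserves the weight. The part of weight 0 is \<open>C\<close>, so the claim is that the
  part of positive weight is acyclic. For this consider the derivation \<open>h\<close> of degree \<open>-1\<close> with
  \<open>h(d i) = i\<close> and \<open>h(i) = h(\<mu>) = 0\<close>. It respects the ideal of relations: it sends
  \<open>i (d i) - (d i) i\<close> to \<open>i i - i i = 0\<close>, the differential \<open>2 (d i) (d i)\<close> of that relation back to a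
  multiple of it, and the order relation for \<open>d i\<close> to the one for \<open>i\<close>. The derivation \<open>E = d h + h d\<close>
  agrees on the generators, hence everywhere, with multiplication by the weight. In characteristic 0 a
  cocycle of weight \<open>w \<ge> 1\<close> is thus the differential of \<open>(1/w) h\<close> of itself.

  Well-definedness of \<open>E\<close> and \<open>h\<close> on the quotient by the relations comes from the universal property:
  for the graded commutative DG algebra spanned by \<open>1, t, \<epsilon>\<close>, where \<open>t\<close> has degree 0, \<open>\<epsilon> = d t\<close> and
  all products of \<open>t\<close> and \<open>\<epsilon>\<close> vanish, tensoring an operad with it gives an operad
  (\<open>dg_operad_path_ext\<close>), and \<open>i \<mapsto> i + i t\<close> satisfies the relations there
  (\<open>exact_BV_pair_path_ext\<close>). The coefficients at \<open>t\<close> and \<open>\<epsilon>\<close> of the resulting morphism are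
  \<open>E\<close> and \<open>h\<close> (\<open>euler_homotopyI\<close>).

  In place of a direct sum decomposition by weight, \<open>positive_weight\<close> singles out the elements killed by some product of operators \<open>E - w\<close> with \<open>w \<ge> 1\<close>. These form an ideal, every
  element of \<open>EBV\<close> is the sum of one of them and of one from \<open>C\<close> (\<open>ebv_decomposition\<close>), and those
  that are cocycles are exact (\<open>positive_weight_exact\<close>). Hence \<open>C \<rightarrow> EBV\<close> is surjective on cohomology.
  It is injective because \<open>i \<mapsto> 0\<close> defines a retraction \<open>EBV \<rightarrow> C\<close>.

  The morphism \<open>BV/\<Delta> \<rightarrow> EBV\<close> exists because, once \<open>\<phi>\<^sub>n\<close> vanishes for \<open>n \<ge> 2\<close>, the relation for \<open>d \<phi>\<^sub>n\<close>
  involves, apart from zeros, only nested brackets whose innermost one is \<open>[i, d i] = 0\<close> (\<open>teval_nested_bracket\<close>).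
\<close>

text \<open>
  Unary elements have arity \<open>1\<close>, and rewriting it to \<open>Suc 0\<close> would keep typing facts from matching.
\<close>

declare One_nat_def [simp del]

section \<open>Presented operads\<close>

lemma teval_gen_class:
  assumes "is_term p n e t"
  shows "teval (presented_operad p) (gen_class p) t = tclass p t"
  using assms
proof induction
  case (6 m e s n e' t i)
  then show ?case by (simp add: ocomp_presented[of p m e _ n e'])
qed (simp_all add: gen_class_def ounit_presented ozero_presented oadd_presented osmult_presented
    oact_presented odiff_presented)

text \<open>
  A relation has an effect only if both sides have the same type, since the congruence compares
  expressions of equal arity and degree.
\<close>

lemma presented_relation:
  assumes "(s, t) \<in> rels p" "same_type p (s, t)"
  shows "teval (presented_operad p) (gen_class p) s = teval (presented_operad p) (gen_class p) t"
proof -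
  from assms(2) obtain n e where st: "is_term p n e s" "is_term p n e t"
    by (auto simp: same_type_def)
  then have "tclass p s = tclass p t" using assms(1) by (intro tclass_eqI teq_rel)
  then show ?thesis using st by (simp add: teval_gen_class)
qed

lemma gen_class_closed:
  "g \<in> gens p \<Longrightarrow> gen_class p g \<in> el (presented_operad p) (gen_arity p g) (gen_degree p g)"
  unfolding gen_class_def by (intro elI is_term.intros)

lemma presented_operad_induct [consumes 1, case_names gen zero add smult unit comp act diff]:
  assumes "x \<in> el (presented_operad p) n e"
    and "\<And>g. g \<in> gens p \<Longrightarrow> S (gen_arity p g) (gen_degree p g) (gen_class p g)"
    and "\<And>n e. S n e (ozero (presented_operad p) n e)"
    and "\<And>n e x y. \<lbrakk>x \<in> el (presented_operad p) n e; y \<in> el (presented_operad p) n e;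
      S n e x; S n e y\<rbrakk> \<Longrightarrow> S n e (oadd (presented_operad p) x y)"
    and "\<And>n e x c. \<lbrakk>x \<in> el (presented_operad p) n e; S n e x\<rbrakk>
      \<Longrightarrow> S n e (osmult (presented_operad p) c x)"
    and "S 1 0 (ounit (presented_operad p))"
    and "\<And>m e n e' x y i. \<lbrakk>x \<in> el (presented_operad p) m e; y \<in> el (presented_operad p) n e';
      S m e x; S n e' y; 1 \<le> i; i \<le> m\<rbrakk> \<Longrightarrow> S (m + n - 1) (e + e') (ocomp (presented_operad p) x i y)"
    and "\<And>n e x \<sigma>. \<lbrakk>x \<in> el (presented_operad p) n e; S n e x; \<sigma> permutes {1..n}\<rbrakk>
      \<Longrightarrow> S n e (oact (presented_operad p) x \<sigma>)"
    and "\<And>n e x. \<lbrakk>x \<in> el (presented_operad p) n e; S n e x\<rbrakk>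
      \<Longrightarrow> S n (e + 1) (odiff (presented_operad p) x)"
  shows "S n e x"
proof -
  have "S n e (tclass p t)" if "is_term p n e t" for t n e
    using that
  proof induction
    case (1 g)
    then show ?case using assms(2) by (simp add: gen_class_def)
  next
    case (2 n e)
    show ?case using assms(3) by (simp add: ozero_presented)
  next
    case (3 n e s t)
    then show ?case using assms(4)[OF elI elI] by (metis oadd_presented)
  next
    case (4 n e t c)
    then show ?case using assms(5)[OF elI] by (metis osmult_presented)
  next
    case 5
    show ?case using assms(6) by (simp add: ounit_presented)
  next
    case (6 m e s n e' t i)
    then show ?case using assms(7)[OF elI elI] by (metis ocomp_presented)
  next
    case (7 n e t \<sigma>)
    then show ?case using assms(8)[OF elI] by (metis oact_presented)
  next
    case (8 n e t)
    then show ?case using assms(9)[OF elI] by (metis odiff_presented)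
  qed
  then show ?thesis using assms(1) by (elim elE) blast
qed

lemma dg_operad_hom_comp:
  assumes "dg_operad_hom P Q f" "dg_operad_hom Q R g"
  shows "dg_operad_hom P R (g \<circ> f)"
proof -
  interpret F: dg_operad_hom P Q f by fact
  interpret G: dg_operad_hom Q R g by fact
  show ?thesis
  proof (unfold_locales, goal_cases)
    case (1 x n e) then show ?case by (simp add: F.hom_closed G.hom_closed)
  next
    case (2 x n e y)
    then show ?case by (simp add: F.hom_closed F.hom_add[of x n e] G.hom_add[of _ n e])
  next
    case (3 x n e c)
    then show ?case by (simp add: F.hom_closed F.hom_smult[of x n e] G.hom_smult[of _ n e])
  next
    case 4 show ?case by (simp add: F.hom_unit G.hom_unit)
  next
    case (5 x m e y n e' i)
    then show ?case
      by (simp add: F.hom_closed F.hom_comp[of x m e y n e'] G.hom_comp[of _ m e _ n e'])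
  next
    case (6 x n e \<sigma>)
    then show ?case by (simp add: F.hom_closed F.hom_act[of x n e] G.hom_act[of _ n e])
  next
    case (7 x n e)
    then show ?case by (simp add: F.hom_closed F.hom_diff[of x n e] G.hom_diff[of _ n e])
  qed
qed

lemma dg_operad_hom_id: "dg_operad P \<Longrightarrow> dg_operad_hom P P (\<lambda>x. x)"
  by (simp add: dg_operad_hom_def dg_operad_hom_axioms_def)

section \<open>Linear algebra in a DG operad\<close>

context dg_operad
begin

lemma comp_closed':
  "\<lbrakk>x \<in> el P m e; y \<in> el P n e'; 1 \<le> i; i \<le> m; N = m + n - 1; E = e + e'\<rbrakk>
    \<Longrightarrow> ocomp P x i y \<in> el P N E"
  using comp_closed by blast

lemma diff_closed': "\<lbrakk>x \<in> el P n e; E = e + 1\<rbrakk> \<Longrightarrow> odiff P x \<in> el P n E"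
  using diff_closed by blast

lemma add_left_commute:
  "\<lbrakk>x \<in> el P n e; y \<in> el P n e; z \<in> el P n e\<rbrakk>
    \<Longrightarrow> oadd P x (oadd P y z) = oadd P y (oadd P x z)"
  using add_assoc[of x n e y z] add_assoc[of y n e x z] add_commute[of x n e y] by simp

lemma zero_add: "x \<in> el P n e \<Longrightarrow> oadd P (ozero P n e) x = x"
  using add_commute[OF zero_closed, of x n e] add_zero[of x n e] by simp

text \<open>
  The zeros of different arities and degrees are different elements. Writing a zero as \<open>0 \<cdot> 0\<close> turns
  every statement about preservation of zero, with its change of type, into one about scalars.
\<close>

lemma zero_smult: "x \<in> el P n e \<Longrightarrow> osmult P 0 x = ozero P n e"
  using add_smult[of x n e 1 "- 1"] smult_one[of x n e] add_neg[of x n e] by simp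

lemma smult_zero: "osmult P c (ozero P n e) = ozero P n e"
proof -
  have z: "osmult P 0 (ozero P n e) = ozero P n e" by (rule zero_smult[OF zero_closed])
  have "osmult P c (osmult P 0 (ozero P n e)) = osmult P 0 (ozero P n e)"
    by (subst smult_smult[OF zero_closed]) simp
  then show ?thesis unfolding z .
qed

lemma act_zero: "\<sigma> permutes {1..n} \<Longrightarrow> oact P (ozero P n e) \<sigma> = ozero P n e"
  using act_smult[OF zero_closed, of \<sigma> n 0 e] act_closed[OF zero_closed, of \<sigma> n e]
  by (simp add: zero_smult[of _ n e] zero_closed)

lemma diff_zero: "E = e + 1 \<Longrightarrow> odiff P (ozero P n e) = ozero P n E"
  using diff_smult[OF zero_closed, of 0 n e] diff_closed[OF zero_closed, of n e]
  by (simp add: zero_smult[of _ n e] zero_smult[of _ n "e + 1"] zero_closed)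

lemma zero_comp:
  assumes "y \<in> el P n e'" "1 \<le> i" "i \<le> m" "N = m + n - 1" "E = e + e'"
  shows "ocomp P (ozero P m e) i y = ozero P N E"
proof -
  have "ocomp P (osmult P 0 (ozero P m e)) i y = osmult P 0 (ocomp P (ozero P m e) i y)"
    using zero_closed assms(1-3) by (rule comp_smult_left)
  also have "\<dots> = ozero P N E"
    using assms(1-3) unfolding assms(4,5) by (intro zero_smult comp_closed zero_closed)
  finally show ?thesis by (simp only: zero_smult[OF zero_closed])
qed

lemma comp_zero:
  assumes "x \<in> el P m e" "1 \<le> i" "i \<le> m" "N = m + n - 1" "E = e + e'"
  shows "ocomp P x i (ozero P n e') = ozero P N E"
proof -
  have "ocomp P x i (osmult P 0 (ozero P n e')) = osmult P 0 (ocomp P x i (ozero P n e'))"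
    using assms(1) zero_closed assms(2,3) by (rule comp_smult_right)
  also have "\<dots> = ozero P N E"
    using assms(1-3) unfolding assms(4,5) by (intro zero_smult comp_closed zero_closed)
  finally show ?thesis by (simp only: zero_smult[OF zero_closed])
qed

lemma add_eq_zeroD:
  assumes "x \<in> el P n e" "y \<in> el P n e" "oadd P x y = ozero P n e"
  shows "x = osmult P (- 1) y"
proof -
  have "x = oadd P (oadd P x y) (osmult P (- 1) y)"
    using assms(1,2) by (simp add: add_assoc[of _ n e] smult_closed add_neg[of _ n e] add_zero)
  then show ?thesis using assms by (simp add: zero_add[of _ n e] smult_closed)
qed

lemma add_cancel_right:
  assumes "x \<in> el P n e" "y \<in> el P n e"
  shows "oadd P (oadd P x y) (osmult P (- 1) y) = x"
  using assms by (simp add: add_assoc[of _ n e] smult_closed add_neg[of _ n e] add_zero)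

text \<open>
  The derivation rule for \<open>1 = 1 \<circ>\<^sub>1 1\<close> gives \<open>d 1 = d 1 + d 1\<close>.
\<close>

lemma diff_unit: "odiff P (ounit P) = ozero P 1 1"
proof -
  have u: "ounit P \<in> el P 1 0" and du: "odiff P (ounit P) \<in> el P 1 1"
    using unit_closed diff_closed[OF unit_closed] by simp_all
  have "odiff P (ocomp P (ounit P) 1 (ounit P)) = oadd P (odiff P (ounit P)) (odiff P (ounit P))"
    using diff_comp[OF u u, of 1]
    by (simp add: comp_unit_right[OF du] comp_unit_left[OF du] smult_one[OF du])
  then have "oadd P (odiff P (ounit P)) (odiff P (ounit P)) = odiff P (ounit P)"
    by (simp add: comp_unit_left[OF u])
  then show ?thesis using add_cancel_right[OF du du] add_neg[OF du] by simp
qed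

lemma add_add_swap:
  assumes "a \<in> el P n e" "b \<in> el P n e" "c \<in> el P n e" "d \<in> el P n e"
  shows "oadd P (oadd P a b) (oadd P c d) = oadd P (oadd P a c) (oadd P b d)"
  using assms by (simp add: add_assoc[of _ n e] add_closed add_left_commute[of _ n e])

end

section \<open>The order relation\<close>

text \<open>
  The order relation as an operation of the operad \<open>P\<close> itself, on a product \<open>m\<close> and a unary \<open>x\<close>; the
  generator type \<open>bool\<close> serves to name these two arguments.
\<close>

definition op_DO :: "('k::field, 'a) dg_operad_data \<Rightarrow> 'a \<Rightarrow> nat \<Rightarrow> int \<Rightarrow> 'a \<Rightarrow> 'a" where
  "op_DO P m n e x = teval P (\<lambda>b. if b then x else m) (DO (Gen False) n e (Gen True))"

lemma teval_term_sum:
  "teval P a (term_sum n e F A)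
    = foldr (\<lambda>i t. oadd P (teval P a (F i)) t) (SOME xs. set xs = A \<and> distinct xs) (ozero P n e)"
proof -
  have "teval P a (foldr (\<lambda>i t. Add (F i) t) xs (Zero n e))
    = foldr (\<lambda>i t. oadd P (teval P a (F i)) t) xs (ozero P n e)" for xs
    by (induction xs) auto
  then show ?thesis by (simp add: term_sum_def)
qed

lemma teval_iter_prod:
  "teval P a (iter_prod \<mu> k) = ((\<lambda>t. ocomp P (teval P a \<mu>) 1 t) ^^ (k - 1)) (ounit P)"
proof -
  have "teval P a (((\<lambda>t. Comp \<mu> 1 t) ^^ j) Unit)
    = ((\<lambda>t. ocomp P (teval P a \<mu>) 1 t) ^^ j) (ounit P)" for j
    by (induction j) auto
  then show ?thesis by (simp add: iter_prod_def)
qed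

lemma teval_DO: "teval P a (DO \<mu> n e D) = op_DO P (teval P a \<mu>) n e (teval P a D)"
  unfolding op_DO_def DO_def
  by (simp add: teval_term_sum teval_iter_prod case_prod_beta)

text \<open>
  The order relation is built from \<open>D\<close> by linear operations, permutations, and compositions with
  iterated products on either side. So a linear map \<open>\<phi>\<close>, of any degree, that commutes with a single
  \<open>\<mu>\<close> on either side carries it along. This one principle gives that order relations are linear in
  \<open>D\<close>, that they are inherited by \<open>d D\<close>, and that they are checked componentwise in the extension
  by \<open>t\<close> and \<open>\<epsilon>\<close> below.
\<close>

lemma op_DO_natural:
  assumes "dg_operad P" "dg_operad Q" and m: "m \<in> el P 2 0" "m' \<in> el Q 2 0"
    and closed: "\<And>n x. x \<in> el P n e \<Longrightarrow> \<phi> x \<in> el Q n e'"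
    and add: "\<And>n x y. \<lbrakk>x \<in> el P n e; y \<in> el P n e\<rbrakk> \<Longrightarrow> \<phi> (oadd P x y) = oadd Q (\<phi> x) (\<phi> y)"
    and smult: "\<And>n x c. x \<in> el P n e \<Longrightarrow> \<phi> (osmult P c x) = osmult Q c (\<phi> x)"
    and act: "\<And>n x \<sigma>. \<lbrakk>x \<in> el P n e; \<sigma> permutes {1..n}\<rbrakk> \<Longrightarrow> \<phi> (oact P x \<sigma>) = oact Q (\<phi> x) \<sigma>"
    and left: "\<And>n x. x \<in> el P n e \<Longrightarrow> \<phi> (ocomp P m 1 x) = ocomp Q m' 1 (\<phi> x)"
    and right: "\<And>n x. \<lbrakk>x \<in> el P n e; 1 \<le> n\<rbrakk> \<Longrightarrow> \<phi> (ocomp P x 1 m) = ocomp Q (\<phi> x) 1 m'"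
    and x: "x \<in> el P 1 e"
  shows "\<phi> (op_DO P m n e x) = op_DO Q m' n e' (\<phi> x)"
proof -
  interpret P: dg_operad P by fact
  interpret Q: dg_operad Q by fact
  \<comment> \<open>\<open>pp k\<close> and \<open>qq k\<close> are the iterated products of arity \<open>k + 1\<close>; by associativity, \<open>\<phi>\<close> passes them
    one factor at a time\<close>
  define pp where "pp = (\<lambda>k. ((\<lambda>t. ocomp P m 1 t) ^^ k) (ounit P))"
  define qq where "qq = (\<lambda>k. ((\<lambda>t. ocomp Q m' 1 t) ^^ k) (ounit Q))"
  have pp_Suc: "pp (Suc k) = ocomp P m 1 (pp k)" and qq_Suc: "qq (Suc k) = ocomp Q m' 1 (qq k)" for k
    by (simp_all add: pp_def qq_def)
  have pp: "pp k \<in> el P (Suc k) 0" for k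
  proof (induction k)
    case 0 show ?case using P.unit_closed by (simp add: pp_def One_nat_def)
  next
    case (Suc k) show ?case unfolding pp_Suc by (rule P.comp_closed'[OF m(1) Suc]) auto
  qed
  have qq: "qq k \<in> el Q (Suc k) 0" for k
  proof (induction k)
    case 0 show ?case using Q.unit_closed by (simp add: qq_def One_nat_def)
  next
    case (Suc k) show ?case unfolding qq_Suc by (rule Q.comp_closed'[OF m(2) Suc]) auto
  qed
  have zero: "\<phi> (ozero P n e) = ozero Q n e'" for n
    using smult[OF P.zero_closed, of 0] P.zero_smult[OF P.zero_closed]
      Q.zero_smult[OF closed[OF P.zero_closed]] by metis
  have left': "\<phi> (ocomp P (pp k) 1 y) = ocomp Q (qq k) 1 (\<phi> y)" if "y \<in> el P n e" for k y n
    using that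
  proof (induction k)
    case 0
    then show ?case by (simp add: pp_def qq_def P.comp_unit_left[of _ n e] Q.comp_unit_left[of _ n e'] closed)
  next
    case (Suc k)
    have k: "ocomp P (pp k) 1 y \<in> el P (k + n) e"
      by (rule P.comp_closed'[OF pp Suc.prems]) auto
    have "\<phi> (ocomp P (pp (Suc k)) 1 y) = \<phi> (ocomp P m 1 (ocomp P (pp k) 1 y))"
      using P.comp_sequential[OF m(1) pp Suc.prems, of 1 1 k] by (simp add: pp_Suc One_nat_def)
    also have "\<dots> = ocomp Q m' 1 (ocomp Q (qq k) 1 (\<phi> y))" using left[OF k] Suc by metis
    also have "\<dots> = ocomp Q (qq (Suc k)) 1 (\<phi> y)"
      using Q.comp_sequential[OF m(2) qq closed[OF Suc.prems], of 1 1 k] by (simp add: qq_Suc One_nat_def)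
    finally show ?case .
  qed
  have right': "\<phi> (ocomp P y 1 (pp k)) = ocomp Q (\<phi> y) 1 (qq k)" if "y \<in> el P n e" "1 \<le> n" for k y n
    using that
  proof (induction k arbitrary: y n)
    case 0
    then show ?case by (simp add: pp_def qq_def P.comp_unit_right[of _ n e] Q.comp_unit_right[of _ n e'] closed)
  next
    case (Suc k)
    have k: "ocomp P y 1 m \<in> el P (n + 1) e"
      by (rule P.comp_closed'[OF Suc.prems(1) m(1)]) (use Suc.prems in auto)
    have "\<phi> (ocomp P y 1 (pp (Suc k))) = \<phi> (ocomp P (ocomp P y 1 m) 1 (pp k))"
      using P.comp_sequential[OF Suc.prems(1) m(1) pp, of 1 1 k] Suc.prems by (simp add: pp_Suc One_nat_def)
    also have "\<dots> = ocomp Q (ocomp Q (\<phi> y) 1 m') 1 (qq k)"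
      using right[OF Suc.prems] Suc.IH[OF k] by simp
    also have "\<dots> = ocomp Q (\<phi> y) 1 (qq (Suc k))"
      using Q.comp_sequential[OF closed[OF Suc.prems(1)] m(2) qq, of 1 1 k] Suc.prems
      by (simp add: qq_Suc One_nat_def)
    finally show ?case .
  qed
  have sum: "\<phi> (foldr (\<lambda>i t. oadd P (f i) t) xs (ozero P k e)) = foldr (\<lambda>i t. oadd Q (g i) t) xs (ozero Q k e')
      \<and> foldr (\<lambda>i t. oadd P (f i) t) xs (ozero P k e) \<in> el P k e"
    if "\<And>i. i \<in> A \<Longrightarrow> f i \<in> el P k e \<and> \<phi> (f i) = g i" "set xs \<subseteq> A" for f :: "'i \<Rightarrow> _" and g xs k A
    using that(2) by (induction xs) (auto simp: zero add[of _ k] P.zero_closed P.add_closed that(1))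
  have sum': "\<phi> (teval P a (term_sum k e F A)) = teval Q b (term_sum k e' G A)
      \<and> teval P a (term_sum k e F A) \<in> el P k e"
    if "finite A" "\<And>i. i \<in> A \<Longrightarrow> teval P a (F i) \<in> el P k e \<and> \<phi> (teval P a (F i)) = teval Q b (G i)"
    for a :: "'i \<Rightarrow> _" and b F G k and A :: "'j set"
  proof -
    have "set (SOME xs. set xs = A \<and> distinct xs) = A"
      using someI_ex[OF finite_distinct_list[OF that(1)]] by blast
    then show ?thesis unfolding teval_term_sum
      using sum[of A "\<lambda>i. teval P a (F i)" k "\<lambda>i. teval Q b (G i)"] that(2) by blast
  qed
  show ?thesis
    unfolding op_DO_def DO_def
  proof (rule conjunct1[OF sum'], goal_cases)
    case 1
    have "{(r, q). r + q = n + 1 \<and> 1 \<le> r} \<subseteq> {..n + 1} \<times> {..n + 1}" by auto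
    then show ?case by (rule finite_subset) auto
  next
    case (2 u)
    then obtain r q where u: "u = (r, q)" and rq: "r + q = n + 1" "1 \<le> r" by blast
    have xr: "ocomp P x 1 (pp (r - 1)) \<in> el P r e"
      by (rule P.comp_closed'[OF x pp]) (use rq in auto)
    have c: "ocomp P (pp q) 1 (ocomp P x 1 (pp (r - 1))) \<in> el P (n + 1) e"
      by (rule P.comp_closed'[OF pp xr]) (use rq in auto)
    have "\<phi> (ocomp P (pp q) 1 (ocomp P x 1 (pp (r - 1))))
        = ocomp Q (qq q) 1 (ocomp Q (\<phi> x) 1 (qq (r - 1)))"
      using left'[OF xr] right'[OF x] by simp
    then have "\<phi> (teval P (\<lambda>b. if b then x else m) (term_sum (n + 1) e
          (\<lambda>\<sigma>. Act (Comp (iter_prod (Gen False) (q + 1)) 1 (Comp (Gen True) 1 (iter_prod (Gen False) r))) (inv \<sigma>))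
          (shuffle_perms r q)))
       = teval Q (\<lambda>b. if b then \<phi> x else m') (term_sum (n + 1) e'
          (\<lambda>\<sigma>. Act (Comp (iter_prod (Gen False) (q + 1)) 1 (Comp (Gen True) 1 (iter_prod (Gen False) r))) (inv \<sigma>))
          (shuffle_perms r q))
       \<and> teval P (\<lambda>b. if b then x else m) (term_sum (n + 1) e
          (\<lambda>\<sigma>. Act (Comp (iter_prod (Gen False) (q + 1)) 1 (Comp (Gen True) 1 (iter_prod (Gen False) r))) (inv \<sigma>))
          (shuffle_perms r q)) \<in> el P (n + 1) e"
    proof (intro sum'[OF finite_shuffle_perms], goal_cases)
      case (1 s)
      then have "inv s permutes {1..n + 1}"
        using rq unfolding shuffle_perms_def by (auto intro: permutes_inv)
      then show ?case using c act[OF c] 1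
        by (simp add: teval_iter_prod pp_def qq_def P.act_closed)
    qed
    then show ?case unfolding u by (simp add: smult[of _ "n + 1"] P.smult_closed)
  qed
qed

section \<open>First-order extension of an operad by a parameter and its differential\<close>

text \<open>
  The operad \<open>P \<otimes> A\<close>, where \<open>A\<close> is the DG algebra spanned by \<open>1, t, \<epsilon>\<close> with \<open>d t = \<epsilon>\<close> and square-zero
  augmentation ideal: the algebra of polynomial forms on a line, truncated at first order. The tuple
  \<open>(e, x, a, b)\<close> stands for \<open>x + t a + \<epsilon> b\<close>. The degree \<open>e\<close> is recorded because moving \<open>\<epsilon>\<close>
  past \<open>x\<close> costs the sign \<open>(-1)\<^sup>e\<close>, and a bare element of \<open>P\<close> need not determine its degree.
\<close>

definition path_ext ::
  "('k::field, 'a) dg_operad_data \<Rightarrow> ('k, int \<times> 'a \<times> 'a \<times> 'a) dg_operad_data" where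
  "path_ext P = \<lparr>
     el = (\<lambda>n e. {e} \<times> el P n e \<times> el P n e \<times> el P n (e - 1)),
     ozero = (\<lambda>n e. (e, ozero P n e, ozero P n e, ozero P n (e - 1))),
     oadd = (\<lambda>(e, x, a, b) (_, x', a', b'). (e, oadd P x x', oadd P a a', oadd P b b')),
     osmult = (\<lambda>c (e, x, a, b). (e, osmult P c x, osmult P c a, osmult P c b)),
     ounit = (0, ounit P, ozero P 1 0, ozero P 1 (- 1)),
     ocomp = (\<lambda>(e, x, a, b) i (e', y, a', b'). (e + e', ocomp P x i y,
        oadd P (ocomp P a i y) (ocomp P x i a'),
        oadd P (ocomp P b i y) (osmult P ((- 1) powi e) (ocomp P x i b')))),
     oact = (\<lambda>(e, x, a, b) \<sigma>. (e, oact P x \<sigma>, oact P a \<sigma>, oact P b \<sigma>)),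
     odiff = (\<lambda>(e, x, a, b). (e + 1, odiff P x, odiff P a, oadd P a (osmult P (- 1) (odiff P b))))\<rparr>"

lemma path_ext_sel:
  "el (path_ext P) n e = {e} \<times> el P n e \<times> el P n e \<times> el P n (e - 1)"
  "ozero (path_ext P) n e = (e, ozero P n e, ozero P n e, ozero P n (e - 1))"
  "oadd (path_ext P) (e, x, a, b) (e', x', a', b') = (e, oadd P x x', oadd P a a', oadd P b b')"
  "osmult (path_ext P) c (e, x, a, b) = (e, osmult P c x, osmult P c a, osmult P c b)"
  "ounit (path_ext P) = (0, ounit P, ozero P 1 0, ozero P 1 (- 1))"
  "ocomp (path_ext P) (e, x, a, b) i (e', y, a', b') = (e + e', ocomp P x i y,
        oadd P (ocomp P a i y) (ocomp P x i a'),
        oadd P (ocomp P b i y) (osmult P ((- 1) powi e) (ocomp P x i b')))"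
  "oact (path_ext P) (e, x, a, b) \<sigma> = (e, oact P x \<sigma>, oact P a \<sigma>, oact P b \<sigma>)"
  "odiff (path_ext P) (e, x, a, b)
     = (e + 1, odiff P x, odiff P a, oadd P a (osmult P (- 1) (odiff P b)))"
  by (simp_all add: path_ext_def)

lemma path_elE:
  assumes "X \<in> el (path_ext P) n e"
  obtains x a b where "X = (e, x, a, b)" "x \<in> el P n e" "a \<in> el P n e" "b \<in> el P n (e - 1)"
  using assms by (auto simp: path_ext_sel)

lemma minus_one_powi: "(- 1 :: 'k::field) powi e = (if even e then 1 else - 1)"
  by (simp add: power_int_minus_left)

text \<open>
  In each axiom the component at \<open>1\<close> is the axiom of \<open>P\<close>, the one at \<open>t\<close> is its linearization, and the
  one at \<open>\<epsilon>\<close> is its linearization with Koszul signs; only the last needs thought.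
\<close>

lemma (in dg_operad) dg_operad_path_ext: "dg_operad (path_ext P)"
proof (unfold_locales, goal_cases)
  case (1 n e) show ?case by (simp add: path_ext_sel zero_closed)
next
  case (2 x n e y)
  then show ?case by (elim path_elE) (simp add: path_ext_sel add_closed)
next
  case (3 x n e c)
  then show ?case by (elim path_elE) (simp add: path_ext_sel smult_closed)
next
  case (4 x n e y z)
  then show ?case by (elim path_elE)
    (simp add: path_ext_sel add_assoc[of _ n e] add_assoc[of _ n "e - 1"])
next
  case (5 x n e y)
  then show ?case by (elim path_elE)
    (simp add: path_ext_sel add_commute[of _ n e] add_commute[of _ n "e - 1"])
next
  case (6 x n e)
  then show ?case by (elim path_elE) (simp add: path_ext_sel add_zero)
next
  case (7 x n e)
  then show ?case by (elim path_elE) (simp add: path_ext_sel add_neg)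
next
  case (8 x n e y c)
  then show ?case by (elim path_elE)
    (simp add: path_ext_sel smult_add[of _ n e] smult_add[of _ n "e - 1"])
next
  case (9 x n e b c)
  then show ?case by (elim path_elE)
    (simp add: path_ext_sel add_smult[of _ n e] add_smult[of _ n "e - 1"])
next
  case (10 x n e b c)
  then show ?case by (elim path_elE)
    (simp add: path_ext_sel smult_smult[of _ n e] smult_smult[of _ n "e - 1"])
next
  case (11 x n e)
  then show ?case by (elim path_elE)
    (simp add: path_ext_sel smult_one[of _ n e] smult_one[of _ n "e - 1"])
next
  case (12 x n e \<sigma>)
  then show ?case by (elim path_elE) (simp add: path_ext_sel act_closed)
next
  case (13 x n e y \<sigma>)
  then show ?case by (elim path_elE)
    (simp add: path_ext_sel act_add[of _ n e] act_add[of _ n "e - 1"])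
next
  case (14 x n e \<sigma> c)
  then show ?case by (elim path_elE)
    (simp add: path_ext_sel act_smult[of _ n e] act_smult[of _ n "e - 1"])
next
  case (15 x n e)
  then show ?case by (elim path_elE)
    (simp add: path_ext_sel act_id[of _ n e] act_id[of _ n "e - 1"])
next
  case (16 x n e \<sigma> \<tau>)
  then show ?case by (elim path_elE)
    (simp add: path_ext_sel act_act[of _ n e] act_act[of _ n "e - 1"])
next
  case 17
  show ?case by (simp add: path_ext_sel unit_closed zero_closed)
next
  case (18 X m e Y n e' i)
  from 18(1,2) obtain x a b y a' b' where
    X: "X = (e, x, a, b)" "x \<in> el P m e" "a \<in> el P m e" "b \<in> el P m (e - 1)" and
    Y: "Y = (e', y, a', b')" "y \<in> el P n e'" "a' \<in> el P n e'" "b' \<in> el P n (e' - 1)"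
    by (elim path_elE) blast
  have "ocomp P b i y \<in> el P (m + n - 1) (e + e' - 1)"
    by (rule comp_closed'[OF X(4) Y(2) 18(3,4)]) auto
  moreover have "ocomp P x i b' \<in> el P (m + n - 1) (e + e' - 1)"
    by (rule comp_closed'[OF X(2) Y(4) 18(3,4)]) auto
  ultimately show ?case
    using X Y 18(3,4) by (simp add: path_ext_sel add_closed smult_closed comp_closed)
next
  case (19 X m e X' Y n e' i)
  from 19(1-3) obtain x a b x' a' b' y a'' b'' where
    X: "X = (e, x, a, b)" "x \<in> el P m e" "a \<in> el P m e" "b \<in> el P m (e - 1)" and
    X': "X' = (e, x', a', b')" "x' \<in> el P m e" "a' \<in> el P m e" "b' \<in> el P m (e - 1)" and
    Y: "Y = (e', y, a'', b'')" "y \<in> el P n e'" "a'' \<in> el P n e'" "b'' \<in> el P n (e' - 1)"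
    by (elim path_elE) blast
  note i = 19(4,5)
  let ?N = "m + n - 1" and ?E = "e + e' - 1"
  have "ocomp P b i y \<in> el P ?N ?E" "ocomp P b' i y \<in> el P ?N ?E"
    "ocomp P x i b'' \<in> el P ?N ?E" "ocomp P x' i b'' \<in> el P ?N ?E"
    by (auto intro: comp_closed'[OF X(4) Y(2) i] comp_closed'[OF X'(4) Y(2) i]
        comp_closed'[OF X(2) Y(4) i] comp_closed'[OF X'(2) Y(4) i])
  note b = add_add_swap[OF this(1) smult_closed[OF this(3)] this(2) smult_closed[OF this(4)]]
    smult_add[OF this(3,4)]
  note a = add_add_swap[OF comp_closed[OF X(3) Y(2) i] comp_closed[OF X(2) Y(3) i]
      comp_closed[OF X'(3) Y(2) i] comp_closed[OF X'(2) Y(3) i]]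
  show ?case
    unfolding X(1) X'(1) Y(1) path_ext_sel
    by (simp only: a b comp_add_left[OF X(2) X'(2) Y(2) i] comp_add_left[OF X(2) X'(2) Y(3) i]
      comp_add_left[OF X(2) X'(2) Y(4) i] comp_add_left[OF X(3) X'(3) Y(2) i]
      comp_add_left[OF X(4) X'(4) Y(2) i])
next
  case (20 X m e Y n e' Y' i)
  from 20(1-3) obtain x a b y a' b' y' a'' b'' where
    X: "X = (e, x, a, b)" "x \<in> el P m e" "a \<in> el P m e" "b \<in> el P m (e - 1)" and
    Y: "Y = (e', y, a', b')" "y \<in> el P n e'" "a' \<in> el P n e'" "b' \<in> el P n (e' - 1)" and
    Y': "Y' = (e', y', a'', b'')" "y' \<in> el P n e'" "a'' \<in> el P n e'" "b'' \<in> el P n (e' - 1)"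
    by (elim path_elE) blast
  note i = 20(4,5)
  let ?N = "m + n - 1" and ?E = "e + e' - 1"
  have "ocomp P b i y \<in> el P ?N ?E" "ocomp P b i y' \<in> el P ?N ?E"
    "ocomp P x i b' \<in> el P ?N ?E" "ocomp P x i b'' \<in> el P ?N ?E"
    by (auto intro: comp_closed'[OF X(4) Y(2) i] comp_closed'[OF X(4) Y'(2) i]
        comp_closed'[OF X(2) Y(4) i] comp_closed'[OF X(2) Y'(4) i])
  note b = add_add_swap[OF this(1) smult_closed[OF this(3)] this(2) smult_closed[OF this(4)]]
    smult_add[OF this(3,4)]
  note a = add_add_swap[OF comp_closed[OF X(3) Y(2) i] comp_closed[OF X(2) Y(3) i]
      comp_closed[OF X(3) Y'(2) i] comp_closed[OF X(2) Y'(3) i]]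
  show ?case
    unfolding X(1) Y(1) Y'(1) path_ext_sel
    by (simp only: a b comp_add_right[OF X(2) Y(2) Y'(2) i] comp_add_right[OF X(2) Y(3) Y'(3) i]
      comp_add_right[OF X(2) Y(4) Y'(4) i] comp_add_right[OF X(3) Y(2) Y'(2) i]
      comp_add_right[OF X(4) Y(2) Y'(2) i])
next
  case (21 X m e Y n e' i c)
  from 21(1,2) obtain x a b y a' b' where
    X: "X = (e, x, a, b)" "x \<in> el P m e" "a \<in> el P m e" "b \<in> el P m (e - 1)" and
    Y: "Y = (e', y, a', b')" "y \<in> el P n e'" "a' \<in> el P n e'" "b' \<in> el P n (e' - 1)"
    by (elim path_elE) blast
  note i = 21(3,4)
  let ?N = "m + n - 1" and ?E = "e + e' - 1"
  have b: "ocomp P b i y \<in> el P ?N ?E" "ocomp P x i b' \<in> el P ?N ?E"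
    by (auto intro: comp_closed'[OF X(4) Y(2) i] comp_closed'[OF X(2) Y(4) i])
  show ?case
    unfolding X(1) Y(1) path_ext_sel
    by (simp add: comp_smult_left[OF X(2) Y(2) i] comp_smult_left[OF X(2) Y(3) i]
      comp_smult_left[OF X(2) Y(4) i] comp_smult_left[OF X(3) Y(2) i]
      comp_smult_left[OF X(4) Y(2) i] smult_smult[OF b(2)] smult_add[OF b(1) smult_closed[OF b(2)]]
      smult_add[OF comp_closed[OF X(3) Y(2) i] comp_closed[OF X(2) Y(3) i]] mult.commute)
next
  case (22 X m e Y n e' i c)
  from 22(1,2) obtain x a b y a' b' where
    X: "X = (e, x, a, b)" "x \<in> el P m e" "a \<in> el P m e" "b \<in> el P m (e - 1)" and
    Y: "Y = (e', y, a', b')" "y \<in> el P n e'" "a' \<in> el P n e'" "b' \<in> el P n (e' - 1)"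
    by (elim path_elE) blast
  note i = 22(3,4)
  let ?N = "m + n - 1" and ?E = "e + e' - 1"
  have b: "ocomp P b i y \<in> el P ?N ?E" "ocomp P x i b' \<in> el P ?N ?E"
    by (auto intro: comp_closed'[OF X(4) Y(2) i] comp_closed'[OF X(2) Y(4) i])
  show ?case
    unfolding X(1) Y(1) path_ext_sel
    by (simp add: comp_smult_right[OF X(2) Y(2) i] comp_smult_right[OF X(2) Y(3) i]
      comp_smult_right[OF X(2) Y(4) i] comp_smult_right[OF X(3) Y(2) i]
      comp_smult_right[OF X(4) Y(2) i] smult_smult[OF b(2)] smult_add[OF b(1) smult_closed[OF b(2)]]
      smult_add[OF comp_closed[OF X(3) Y(2) i] comp_closed[OF X(2) Y(3) i]] mult.commute)
next
  case (23 X m e i)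
  then show ?case
    by (elim path_elE) (simp add: path_ext_sel comp_unit_right[of _ m]
      comp_zero[of _ m e i m 1 e 0] comp_zero[of _ m e i m 1 "e - 1" "- 1"] smult_zero
      add_zero)
next
  case (24 X m e)
  then show ?case
    by (elim path_elE) (simp add: path_ext_sel comp_unit_left[of _ m]
      zero_comp[of _ m e 1 1 m e 0] zero_comp[of _ m e 1 1 m "e - 1" "- 1"] smult_one[of _ m]
      zero_add)
next
  case (25 X l e Y m e' Z n e'' i j)
  from 25(1-3) obtain x a b y a' b' z a'' b'' where
    X: "X = (e, x, a, b)" "x \<in> el P l e" "a \<in> el P l e" "b \<in> el P l (e - 1)" and
    Y: "Y = (e', y, a', b')" "y \<in> el P m e'" "a' \<in> el P m e'" "b' \<in> el P m (e' - 1)" and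
    Z: "Z = (e'', z, a'', b'')" "z \<in> el P n e''" "a'' \<in> el P n e''" "b'' \<in> el P n (e'' - 1)"
    by (elim path_elE) blast
  note i = 25(4,5) and j = 25(6,7)
  have ij: "1 \<le> i + j - 1" "i + j - 1 \<le> l + m - 1" using i j by auto
  let ?k = "i + j - 1" and ?N = "l + m + n - 2" and ?E = "e + e' + e''"
  have seq: "ocomp P (ocomp P u i v) ?k w = ocomp P u i (ocomp P v j w)"
    if "u \<in> el P l d" "v \<in> el P m d'" "w \<in> el P n d''" for u v w d d' d''
    using comp_sequential[OF that i j] .
  have in_el: "ocomp P u i (ocomp P v j w) \<in> el P ?N D"
    if "u \<in> el P l d" "v \<in> el P m d'" "w \<in> el P n d''" "D = d + d' + d''" for u v w d d' d'' D
    by (rule comp_closed'[OF that(1) comp_closed[OF that(2,3) j] i]) (use i j that in auto)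
  have "ocomp P (oadd P (ocomp P a i y) (ocomp P x i a')) ?k z
      = oadd P (ocomp P (ocomp P a i y) ?k z) (ocomp P (ocomp P x i a') ?k z)"
    by (rule comp_add_left[OF comp_closed[OF X(3) Y(2) i] comp_closed[OF X(2) Y(3) i] Z(2) ij])
  moreover have "ocomp P x i (oadd P (ocomp P a' j z) (ocomp P y j a''))
      = oadd P (ocomp P x i (ocomp P a' j z)) (ocomp P x i (ocomp P y j a''))"
    by (rule comp_add_right[OF X(2) comp_closed[OF Y(3) Z(2) j] comp_closed[OF Y(2) Z(3) j] i])
  ultimately have 1: "oadd P (ocomp P (oadd P (ocomp P a i y) (ocomp P x i a')) ?k z)
        (ocomp P (ocomp P x i y) ?k a'')
      = oadd P (ocomp P a i (ocomp P y j z)) (ocomp P x i (oadd P (ocomp P a' j z) (ocomp P y j a'')))"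
    by (simp add: seq[OF X(3) Y(2) Z(2)] seq[OF X(2) Y(3) Z(2)] seq[OF X(2) Y(2) Z(3)]
        add_assoc[of _ ?N ?E] in_el[OF X(3) Y(2) Z(2)] in_el[OF X(2) Y(3) Z(2)]
        in_el[OF X(2) Y(2) Z(3)])
  have xb: "ocomp P x i b' \<in> el P (l + m - 1) (e + e' - 1)"
    "ocomp P b i y \<in> el P (l + m - 1) (e + e' - 1)"
    by (auto intro: comp_closed'[OF X(2) Y(4) i] comp_closed'[OF X(4) Y(2) i])
  have bz: "ocomp P b' j z \<in> el P (m + n - 1) (e' + e'' - 1)"
    "ocomp P y j b'' \<in> el P (m + n - 1) (e' + e'' - 1)"
    by (auto intro: comp_closed'[OF Y(4) Z(2) j] comp_closed'[OF Y(2) Z(4) j])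
  have m: "ocomp P b i (ocomp P y j z) \<in> el P ?N (?E - 1)"
    "ocomp P x i (ocomp P b' j z) \<in> el P ?N (?E - 1)"
    "ocomp P x i (ocomp P y j b'') \<in> el P ?N (?E - 1)"
    by (auto intro: in_el[OF X(4) Y(2) Z(2)] in_el[OF X(2) Y(4) Z(2)] in_el[OF X(2) Y(2) Z(4)])
  let ?s = "(- 1 :: 'k) powi e" and ?s' = "(- 1 :: 'k) powi e'"
  have "ocomp P (oadd P (ocomp P b i y) (osmult P ?s (ocomp P x i b'))) ?k z
      = oadd P (ocomp P b i (ocomp P y j z)) (osmult P ?s (ocomp P x i (ocomp P b' j z)))"
    by (simp only: comp_add_left[OF xb(2) smult_closed[OF xb(1)] Z(2) ij]
        comp_smult_left[OF xb(1) Z(2) ij] seq[OF X(4) Y(2) Z(2)] seq[OF X(2) Y(4) Z(2)])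
  moreover have "ocomp P x i (oadd P (ocomp P b' j z) (osmult P ?s' (ocomp P y j b'')))
      = oadd P (ocomp P x i (ocomp P b' j z)) (osmult P ?s' (ocomp P x i (ocomp P y j b'')))"
    by (simp only: comp_add_right[OF X(2) bz(1) smult_closed[OF bz(2)] i]
        comp_smult_right[OF X(2) bz(2) i])
  moreover have "(- 1 :: 'k) powi (e + e') = ?s * ?s'" by (simp add: minus_one_powi)
  ultimately have 2: "oadd P (ocomp P (oadd P (ocomp P b i y) (osmult P ?s (ocomp P x i b'))) ?k z)
        (osmult P ((- 1) powi (e + e')) (ocomp P (ocomp P x i y) ?k b''))
      = oadd P (ocomp P b i (ocomp P y j z))
          (osmult P ?s (ocomp P x i (oadd P (ocomp P b' j z) (osmult P ?s' (ocomp P y j b'')))))"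
    by (simp add: seq[OF X(2) Y(2) Z(4)] add_assoc[of _ ?N "?E - 1"] smult_closed m
        smult_add[of _ ?N "?E - 1"] smult_smult[of _ ?N "?E - 1"])
  show ?case
    unfolding X(1) Y(1) Z(1) path_ext_sel by (simp only: 1 2 seq[OF X(2) Y(2) Z(2)] add.assoc)
next
  case (26 X l e Y m e' Z n e'' i j)
  from 26(1-3) obtain x a b y a' b' z a'' b'' where
    X: "X = (e, x, a, b)" "x \<in> el P l e" "a \<in> el P l e" "b \<in> el P l (e - 1)" and
    Y: "Y = (e', y, a', b')" "y \<in> el P m e'" "a' \<in> el P m e'" "b' \<in> el P m (e' - 1)" and
    Z: "Z = (e'', z, a'', b'')" "z \<in> el P n e''" "a'' \<in> el P n e''" "b'' \<in> el P n (e'' - 1)"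
    by (elim path_elE) blast
  have i: "1 \<le> i" "i \<le> l" and j: "1 \<le> j" "j \<le> l" using 26(4-6) by auto
  let ?k = "j + m - 1" and ?N = "l + m + n - 2" and ?E = "e + e' + e''"
  have k: "1 \<le> ?k" "?k \<le> l + m - 1" and i': "1 \<le> i" "i \<le> l + n - 1" using 26(4-6) by auto
  have par: "ocomp P (ocomp P u i v) ?k w
      = osmult P ((- 1) powi (d' * d'')) (ocomp P (ocomp P u j w) i v)"
    if "u \<in> el P l d" "v \<in> el P m d'" "w \<in> el P n d''" for u v w d d' d''
    using comp_parallel[OF that 26(4-6)] .
  have in_el: "ocomp P (ocomp P u j w) i v \<in> el P ?N D"
    if "u \<in> el P l d" "v \<in> el P m d'" "w \<in> el P n d''" "D = d + d' + d''" for u v w d d' d'' D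
    by (rule comp_closed'[OF comp_closed[OF that(1,3) j] that(2) i']) (use i j that in auto)
  let ?t = "(- 1 :: 'k) powi (e' * e'')"
  have m: "ocomp P (ocomp P a j z) i y \<in> el P ?N ?E"
    "ocomp P (ocomp P x j z) i a' \<in> el P ?N ?E" "ocomp P (ocomp P x j a'') i y \<in> el P ?N ?E"
    by (auto intro: in_el[OF X(3) Y(2) Z(2)] in_el[OF X(2) Y(3) Z(2)] in_el[OF X(2) Y(2) Z(3)])
  have 1: "oadd P (ocomp P (oadd P (ocomp P a i y) (ocomp P x i a')) ?k z)
        (ocomp P (ocomp P x i y) ?k a'')
      = osmult P ?t (oadd P (ocomp P (oadd P (ocomp P a j z) (ocomp P x j a'')) i y)
          (ocomp P (ocomp P x j z) i a'))"
    by (simp add: comp_add_left[OF comp_closed[OF X(3) Y(2) i] comp_closed[OF X(2) Y(3) i] Z(2) k]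
        comp_add_left[OF comp_closed[OF X(3) Z(2) j] comp_closed[OF X(2) Z(3) j] Y(2) i']
        par[OF X(3) Y(2) Z(2)] par[OF X(2) Y(3) Z(2)] par[OF X(2) Y(2) Z(3)]
        smult_add[of _ ?N ?E] add_assoc[of _ ?N ?E] smult_closed add_closed m
        add_commute[OF smult_closed[OF m(2)] smult_closed[OF m(3)]])
  have xb: "ocomp P x i b' \<in> el P (l + m - 1) (e + e' - 1)"
    "ocomp P b i y \<in> el P (l + m - 1) (e + e' - 1)"
    by (auto intro: comp_closed'[OF X(2) Y(4) i] comp_closed'[OF X(4) Y(2) i])
  have xb': "ocomp P x j b'' \<in> el P (l + n - 1) (e + e'' - 1)"
    "ocomp P b j z \<in> el P (l + n - 1) (e + e'' - 1)"
    by (auto intro: comp_closed'[OF X(2) Z(4) j] comp_closed'[OF X(4) Z(2) j])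
  have m': "ocomp P (ocomp P b j z) i y \<in> el P ?N (?E - 1)"
    "ocomp P (ocomp P x j z) i b' \<in> el P ?N (?E - 1)"
    "ocomp P (ocomp P x j b'') i y \<in> el P ?N (?E - 1)"
    by (auto intro: in_el[OF X(4) Y(2) Z(2)] in_el[OF X(2) Y(4) Z(2)] in_el[OF X(2) Y(2) Z(4)])
  let ?s = "(- 1 :: 'k) powi e"
  \<comment> \<open>interchanging \<open>b'\<close> or \<open>b''\<close>, of degree one lower, against the Koszul sign of \<open>\<epsilon>\<close>\<close>
  have s: "?s * (- 1) powi ((e' - 1) * e'') = ?t * (- 1) powi (e + e'')"
    "(- 1) powi (e + e') * (- 1) powi (e' * (e'' - 1)) = ?t * ?s"
    by (auto simp: minus_one_powi)
  have 2: "oadd P (ocomp P (oadd P (ocomp P b i y) (osmult P ?s (ocomp P x i b'))) ?k z)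
        (osmult P ((- 1) powi (e + e')) (ocomp P (ocomp P x i y) ?k b''))
      = osmult P ?t (oadd P (ocomp P (oadd P (ocomp P b j z) (osmult P ?s (ocomp P x j b''))) i y)
          (osmult P ((- 1) powi (e + e'')) (ocomp P (ocomp P x j z) i b')))"
    by (simp add: comp_add_left[OF xb(2) smult_closed[OF xb(1)] Z(2) k]
        comp_add_left[OF xb'(2) smult_closed[OF xb'(1)] Y(2) i']
        comp_smult_left[OF xb(1) Z(2) k] comp_smult_left[OF xb'(1) Y(2) i']
        par[OF X(4) Y(2) Z(2)] par[OF X(2) Y(4) Z(2)] par[OF X(2) Y(2) Z(4)]
        smult_add[of _ ?N "?E - 1"] add_assoc[of _ ?N "?E - 1"] smult_smult[of _ ?N "?E - 1"]
        smult_closed add_closed m' s add_commute[OF smult_closed[OF m'(2)] smult_closed[OF m'(3)]])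
  show ?case
    unfolding X(1) Y(1) Z(1) path_ext_sel
    by (simp only: 1 2 par[OF X(2) Y(2) Z(2)]) (simp add: algebra_simps)
next
  case (27 X m e Y n e' i \<sigma> \<tau>)
  from 27(1,2) obtain x a b y a' b' where
    X: "X = (e, x, a, b)" "x \<in> el P m e" "a \<in> el P m e" "b \<in> el P m (e - 1)" and
    Y: "Y = (e', y, a', b')" "y \<in> el P n e'" "a' \<in> el P n e'" "b' \<in> el P n (e' - 1)"
    by (elim path_elE) blast
  note i = 27(3,4) and st = 27(5,6)
  have s: "1 \<le> \<sigma> i" "\<sigma> i \<le> m" using permutes_in_image[OF st(1), of i] i by auto
  note perm = comp_perm_permutes[OF st i]
  have b: "ocomp P b (\<sigma> i) y \<in> el P (m + n - 1) (e + e' - 1)"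
    "ocomp P x (\<sigma> i) b' \<in> el P (m + n - 1) (e + e' - 1)"
    by (auto intro: comp_closed'[OF X(4) Y(2) s] comp_closed'[OF X(2) Y(4) s])
  show ?case
    unfolding X(1) Y(1) path_ext_sel
    by (simp only: comp_act[OF X(2) Y(2) i st] comp_act[OF X(3) Y(2) i st]
        comp_act[OF X(2) Y(3) i st] comp_act[OF X(4) Y(2) i st] comp_act[OF X(2) Y(4) i st]
        act_add[OF b(1) smult_closed[OF b(2)] perm] act_smult[OF b(2) perm]
        act_add[OF comp_closed[OF X(3) Y(2) s] comp_closed[OF X(2) Y(3) s] perm])
next
  case (28 X n e)
  then show ?case by (elim path_elE)
    (simp add: path_ext_sel add_closed smult_closed diff_closed diff_closed'[of _ n "e - 1"])
next
  case (29 X n e Y)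
  from 29 obtain x a b y a' b' where
    X: "X = (e, x, a, b)" "x \<in> el P n e" "a \<in> el P n e" "b \<in> el P n (e - 1)" and
    Y: "Y = (e, y, a', b')" "y \<in> el P n e" "a' \<in> el P n e" "b' \<in> el P n (e - 1)"
    by (elim path_elE) blast
  have b: "odiff P b \<in> el P n e" "odiff P b' \<in> el P n e"
    by (auto intro: diff_closed'[OF X(4)] diff_closed'[OF Y(4)])
  show ?case
    unfolding X(1) Y(1) path_ext_sel
    by (simp only: diff_add[OF X(2) Y(2)] diff_add[OF X(3) Y(3)] diff_add[OF X(4) Y(4)]
        smult_add[OF b] add_add_swap[OF X(3) Y(3) smult_closed[OF b(1)] smult_closed[OF b(2)]])
next
  case (30 X n e c)
  from 30 obtain x a b where
    X: "X = (e, x, a, b)" "x \<in> el P n e" "a \<in> el P n e" "b \<in> el P n (e - 1)"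
    by (elim path_elE) blast
  have b: "odiff P b \<in> el P n e" by (auto intro: diff_closed'[OF X(4)])
  show ?case
    unfolding X(1) path_ext_sel
    by (simp add: diff_smult[OF X(2)] diff_smult[OF X(3)] diff_smult[OF X(4)]
        smult_smult[OF b] smult_add[OF X(3) smult_closed[OF b]])
next
  case (31 X n e)
  from 31 obtain x a b where
    X: "X = (e, x, a, b)" "x \<in> el P n e" "a \<in> el P n e" "b \<in> el P n (e - 1)"
    by (elim path_elE) blast
  have b: "odiff P b \<in> el P n e" by (auto intro: diff_closed'[OF X(4)])
  have "e - 1 + 2 = e + 1" by simp
  then have "odiff P (odiff P b) = ozero P n (e + 1)" using diff_diff[OF X(4)] by (simp only:)
  then show ?case
    unfolding X(1) path_ext_sel
    by (simp add: diff_diff[OF X(2)] diff_diff[OF X(3)] diff_add[OF X(3) smult_closed[OF b]]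
        diff_smult[OF b] smult_zero add_zero[OF diff_closed[OF X(3)]] add_neg[OF diff_closed[OF X(3)]] add.commute[of 1 e])
next
  case (32 X n e \<sigma>)
  from 32(1) obtain x a b where
    X: "X = (e, x, a, b)" "x \<in> el P n e" "a \<in> el P n e" "b \<in> el P n (e - 1)"
    by (elim path_elE) blast
  have b: "odiff P b \<in> el P n e" by (auto intro: diff_closed'[OF X(4)])
  show ?case
    unfolding X(1) path_ext_sel
    by (simp only: diff_act[OF X(2) 32(2)] diff_act[OF X(3) 32(2)] diff_act[OF X(4) 32(2)]
        act_add[OF X(3) smult_closed[OF b] 32(2)] act_smult[OF b 32(2)])
next
  case (33 X m e Y n e' i)
  from 33(1,2) obtain x a b y a' b' where
    X: "X = (e, x, a, b)" "x \<in> el P m e" "a \<in> el P m e" "b \<in> el P m (e - 1)" and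
    Y: "Y = (e', y, a', b')" "y \<in> el P n e'" "a' \<in> el P n e'" "b' \<in> el P n (e' - 1)"
    by (elim path_elE) blast
  note i = 33(3,4)
  let ?N = "m + n - 1" and ?E = "e + e'" and ?s = "(- 1 :: 'k) powi e"
  have db: "odiff P b \<in> el P m e" "odiff P b' \<in> el P n e'"
    by (auto intro: diff_closed'[OF X(4)] diff_closed'[OF Y(4)])
  note dx = diff_closed[OF X(2)] diff_closed[OF X(3)] and dy = diff_closed[OF Y(2)] diff_closed[OF Y(3)]
  have m: "ocomp P (odiff P a) i y \<in> el P ?N (?E + 1)" "ocomp P a i (odiff P y) \<in> el P ?N (?E + 1)"
    "ocomp P (odiff P x) i a' \<in> el P ?N (?E + 1)" "ocomp P x i (odiff P a') \<in> el P ?N (?E + 1)"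
    by (auto intro: comp_closed'[OF dx(2) Y(2) i] comp_closed'[OF X(3) dy(1) i]
        comp_closed'[OF dx(1) Y(3) i] comp_closed'[OF X(2) dy(2) i])
  have m': "ocomp P a i y \<in> el P ?N ?E" "ocomp P x i a' \<in> el P ?N ?E"
    "ocomp P (odiff P b) i y \<in> el P ?N ?E" "ocomp P b i (odiff P y) \<in> el P ?N ?E"
    "ocomp P (odiff P x) i b' \<in> el P ?N ?E" "ocomp P x i (odiff P b') \<in> el P ?N ?E"
    by (auto intro: comp_closed'[OF X(3) Y(2) i] comp_closed'[OF X(2) Y(3) i]
        comp_closed'[OF db(1) Y(2) i] comp_closed'[OF X(4) dy(1) i]
        comp_closed'[OF dx(1) Y(4) i] comp_closed'[OF X(2) db(2) i])
  have b: "ocomp P b i y \<in> el P ?N (?E - 1)" "ocomp P x i b' \<in> el P ?N (?E - 1)"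
    by (auto intro: comp_closed'[OF X(4) Y(2) i] comp_closed'[OF X(2) Y(4) i])
  have 1: "odiff P (oadd P (ocomp P a i y) (ocomp P x i a'))
    = oadd P (oadd P (ocomp P (odiff P a) i y) (ocomp P (odiff P x) i a'))
        (osmult P ?s (oadd P (ocomp P a i (odiff P y)) (ocomp P x i (odiff P a'))))"
    by (simp add: diff_add[OF m'(1,2)] diff_comp[OF X(3) Y(2) i] diff_comp[OF X(2) Y(3) i]
        smult_add[OF m(2,4)] add_add_swap[OF m(1) smult_closed[OF m(2)] m(3) smult_closed[OF m(4)]])
  have s: "?s * ?s = 1" "(- 1 :: 'k) powi (e + 1) = - ?s" "(- 1 :: 'k) powi (e - 1) = - ?s"
    by (auto simp: minus_one_powi)
  note norm = smult_add[of _ ?N ?E] smult_smult[of _ ?N ?E] smult_one[of _ ?N ?E]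
    smult_closed add_closed m' s add_assoc[of _ ?N ?E] add_left_commute[of _ ?N ?E]
    add_commute[of _ ?N ?E]
  have 2: "oadd P (oadd P (ocomp P a i y) (ocomp P x i a'))
      (osmult P (- 1) (odiff P (oadd P (ocomp P b i y) (osmult P ?s (ocomp P x i b')))))
    = oadd P (oadd P (ocomp P (oadd P a (osmult P (- 1) (odiff P b))) i y)
         (osmult P ((- 1) powi (e + 1)) (ocomp P (odiff P x) i b')))
       (osmult P ?s (oadd P (ocomp P b i (odiff P y))
         (osmult P ?s (ocomp P x i (oadd P a' (osmult P (- 1) (odiff P b')))))))"
    by (simp add: diff_add[OF b(1) smult_closed[OF b(2)]] diff_smult[OF b(2)]
        diff_comp[OF X(4) Y(2) i] diff_comp[OF X(2) Y(4) i]
        comp_add_left[OF X(3) smult_closed[OF db(1)] Y(2) i] comp_smult_left[OF db(1) Y(2) i]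
        comp_add_right[OF X(2) Y(3) smult_closed[OF db(2)] i] comp_smult_right[OF X(2) db(2) i] norm)
  show ?case
    unfolding X(1) Y(1) path_ext_sel
    by (simp only: 1 2 diff_comp[OF X(2) Y(2) i]) simp
qed

section \<open>Retracts and cohomology\<close>

context dg_operad
begin

lemma equiv_cohomologous: "equiv (cocycles P n e) (cohomologous P n e)"
proof (rule equivI)
  have d: "odiff P b \<in> el P n e" if "b \<in> el P n (e - 1)" for b
    by (rule diff_closed'[OF that]) simp
  show "cohomologous P n e \<subseteq> cocycles P n e \<times> cocycles P n e" by (auto simp: cohomologous_def)
  show "refl_on (cocycles P n e) (cohomologous P n e)"
  proof (rule refl_onI)
    fix x assume x: "x \<in> cocycles P n e"
    have "x = oadd P x (odiff P (ozero P n (e - 1)))"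
      using x by (simp add: cocycles_def diff_zero[of e "e - 1"] add_zero)
    then show "(x, x) \<in> cohomologous P n e"
      using x zero_closed by (auto simp: cohomologous_def)
  qed
  show "sym (cohomologous P n e)"
  proof (rule symI)
    fix x y assume "(x, y) \<in> cohomologous P n e"
    then obtain b where xy: "x \<in> cocycles P n e" "y \<in> cocycles P n e" and b: "b \<in> el P n (e - 1)"
      and y: "y = oadd P x (odiff P b)" by (auto simp: cohomologous_def)
    have "x = oadd P y (odiff P (osmult P (- 1) b))"
      using xy y b d by (simp add: cocycles_def diff_smult[of _ n "e - 1"] add_cancel_right[of _ n e])
    then show "(y, x) \<in> cohomologous P n e" using xy smult_closed[OF b] by (auto simp: cohomologous_def)
  qed
  show "trans (cohomologous P n e)"
  proof (rule transI)
    fix x y z assume "(x, y) \<in> cohomologous P n e" "(y, z) \<in> cohomologous P n e"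
    then obtain b c where xz: "x \<in> cocycles P n e" "z \<in> cocycles P n e"
      and b: "b \<in> el P n (e - 1)" "c \<in> el P n (e - 1)"
      and z: "z = oadd P (oadd P x (odiff P b)) (odiff P c)" by (auto simp: cohomologous_def)
    have "z = oadd P x (odiff P (oadd P b c))"
      using xz z b d by (simp add: cocycles_def diff_add[of _ n "e - 1"] add_assoc[of _ n e])
    then show "(x, z) \<in> cohomologous P n e" using xz add_closed[OF b] by (auto simp: cohomologous_def)
  qed
qed

end

lemma (in dg_operad_hom) hom_cocycles: "x \<in> cocycles P n e \<Longrightarrow> f x \<in> cocycles Q n e"
  by (auto simp: cocycles_def hom_closed hom_zero simp flip: hom_diff)

lemma (in dg_operad_hom) hom_cohomologous:
  assumes "(x, y) \<in> cohomologous P n e"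
  shows "(f x, f y) \<in> cohomologous Q n e"
proof -
  obtain b where xy: "x \<in> cocycles P n e" "y \<in> cocycles P n e" and b: "b \<in> el P n (e - 1)"
    and y: "y = oadd P x (odiff P b)" using assms by (auto simp: cohomologous_def)
  have "odiff P b \<in> el P n e" by (rule P.diff_closed'[OF b]) simp
  then have "f y = oadd Q (f x) (odiff Q (f b))"
    using xy b by (simp add: y cocycles_def hom_add[of _ n e] hom_diff)
  then show ?thesis using xy(1,2)[THEN hom_cocycles] hom_closed[OF b] unfolding cohomologous_def by blast
qed

lemma (in dg_operad_hom) cohomology_map_class:
  assumes "x \<in> cocycles P n e"
  shows "cohomology_map Q n e f (cohomologous P n e `` {x}) = cohomologous Q n e `` {f x}"
proof -
  note eq = equiv_class_eq[OF Q.equiv_cohomologous]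
  have "f x \<in> f ` (cohomologous P n e `` {x})"
    using equiv_class_self[OF P.equiv_cohomologous assms] by blast
  moreover have "cohomologous Q n e `` {y} = cohomologous Q n e `` {f x}"
    if "y \<in> f ` (cohomologous P n e `` {x})" for y
    using that hom_cohomologous eq by blast
  ultimately show ?thesis unfolding cohomology_map_def by blast
qed

theorem quasi_isomorphismI:
  assumes "dg_operad_hom P Q f" "dg_operad_hom Q P r"
    and retract: "\<And>n e x. x \<in> el P n e \<Longrightarrow> r (f x) = x"
    and ess_surj: "\<And>n e y. y \<in> cocycles Q n e \<Longrightarrow> \<exists>x\<in>cocycles P n e. (f x, y) \<in> cohomologous Q n e"
  shows "quasi_isomorphism P Q f"
proof -
  interpret F: dg_operad_hom P Q f by fact
  interpret R: dg_operad_hom Q P r by fact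
  have "bij_betw (cohomology_map Q n e f) (cohomology P n e) (cohomology Q n e)" for n e
  proof (rule bij_betw_imageI)
    show "inj_on (cohomology_map Q n e f) (cohomology P n e)"
    proof (rule inj_onI)
      fix X Y assume XY: "X \<in> cohomology P n e" "Y \<in> cohomology P n e"
        and eq: "cohomology_map Q n e f X = cohomology_map Q n e f Y"
      obtain x y where x: "x \<in> cocycles P n e" "X = cohomologous P n e `` {x}"
        and y: "y \<in> cocycles P n e" "Y = cohomologous P n e `` {y}"
        using XY by (auto simp: cohomology_def elim!: quotientE)
      have "cohomologous Q n e `` {f x} = cohomologous Q n e `` {f y}"
        using eq x y by (simp add: F.cohomology_map_class)
      then have "(f x, f y) \<in> cohomologous Q n e"
        using eq_equiv_class[OF _ F.Q.equiv_cohomologous] F.hom_cocycles[OF y(1)] by blast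
      then have "(r (f x), r (f y)) \<in> cohomologous P n e" by (rule R.hom_cohomologous)
      then have "(x, y) \<in> cohomologous P n e" using x(1) y(1) by (simp add: cocycles_def retract[of _ n e])
      then show "X = Y" using x y equiv_class_eq[OF F.P.equiv_cohomologous] by simp
    qed
    show "cohomology_map Q n e f ` cohomology P n e = cohomology Q n e"
    proof
      show "cohomology_map Q n e f ` cohomology P n e \<subseteq> cohomology Q n e"
        unfolding cohomology_def
        by (auto elim!: quotientE simp: F.cohomology_map_class intro!: quotientI F.hom_cocycles)
      show "cohomology Q n e \<subseteq> cohomology_map Q n e f ` cohomology P n e"
      proof
        fix Y assume "Y \<in> cohomology Q n e"
        then obtain y where y: "y \<in> cocycles Q n e" "Y = cohomologous Q n e `` {y}"
          by (auto simp: cohomology_def elim!: quotientE)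
        obtain x where x: "x \<in> cocycles P n e" "(f x, y) \<in> cohomologous Q n e"
          using ess_surj[OF y(1)] by blast
        have "Y = cohomology_map Q n e f (cohomologous P n e `` {x})"
          using x y equiv_class_eq[OF F.Q.equiv_cohomologous x(2)]
          by (simp add: F.cohomology_map_class)
        then show "Y \<in> cohomology_map Q n e f ` cohomology P n e"
          using x(1) by (auto simp: cohomology_def intro: quotientI)
      qed
    qed
  qed
  then show ?thesis unfolding quasi_isomorphism_def using assms(1) by blast
qed

section \<open>Acyclicity in positive weight\<close>

text \<open>
  A derivation \<open>E\<close> with a null-homotopy \<open>h\<close>. The model is the Euler derivation of a grading, which
  multiplies an element of weight \<open>w\<close> by \<open>w\<close>; here the weights are only visible through \<open>E\<close>.
\<close>

locale euler_homotopy = dg_operad P for P :: "('k::field_char_0, 'a) dg_operad_data" +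
  fixes E h :: "'a \<Rightarrow> 'a"
  assumes E_closed: "x \<in> el P n e \<Longrightarrow> E x \<in> el P n e"
    and E_add: "\<lbrakk>x \<in> el P n e; y \<in> el P n e\<rbrakk> \<Longrightarrow> E (oadd P x y) = oadd P (E x) (E y)"
    and E_smult: "x \<in> el P n e \<Longrightarrow> E (osmult P c x) = osmult P c (E x)"
    and E_unit: "E (ounit P) = ozero P 1 0"
    and E_comp: "\<lbrakk>x \<in> el P m e; y \<in> el P n e'; 1 \<le> i; i \<le> m\<rbrakk>
      \<Longrightarrow> E (ocomp P x i y) = oadd P (ocomp P (E x) i y) (ocomp P x i (E y))"
    and E_act: "\<lbrakk>x \<in> el P n e; \<sigma> permutes {1..n}\<rbrakk> \<Longrightarrow> E (oact P x \<sigma>) = oact P (E x) \<sigma>"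
    and E_diff: "x \<in> el P n e \<Longrightarrow> E (odiff P x) = odiff P (E x)"
    and h_closed: "x \<in> el P n e \<Longrightarrow> h x \<in> el P n (e - 1)"
    and h_zero: "h (ozero P n e) = ozero P n (e - 1)"
    and h_diff: "x \<in> el P n e \<Longrightarrow> h (odiff P x) = oadd P (E x) (osmult P (- 1) (odiff P (h x)))"
begin

definition shifted :: "nat \<Rightarrow> 'a \<Rightarrow> 'a" where
  "shifted w x = oadd P (E x) (osmult P (- of_nat w) x)"

text \<open>
  The sum of the generalized eigenspaces of \<open>E\<close> for the eigenvalues \<open>w \<ge> 1\<close>, described by peeling off
  one factor \<open>E - w\<close> at a time. In this form closure under the operations needs no decomposition into
  eigenvectors.
\<close>

inductive positive_weight :: "nat \<Rightarrow> int \<Rightarrow> 'a \<Rightarrow> bool" for n e where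
  zero: "positive_weight n e (ozero P n e)"
| step: "\<lbrakk>x \<in> el P n e; 1 \<le> w; positive_weight n e (shifted w x)\<rbrakk> \<Longrightarrow> positive_weight n e x"

lemma positive_weight_closed: "positive_weight n e x \<Longrightarrow> x \<in> el P n e"
  by (auto elim: positive_weight.cases intro: zero_closed)

lemma E_zero: "E (ozero P n e) = ozero P n e"
  using E_smult[OF zero_closed, of 0 n e] E_closed[OF zero_closed, of n e]
  by (simp add: zero_smult[of _ n e] zero_closed)

lemma shifted_zero: "shifted w (ozero P n e) = ozero P n e"
  by (simp add: shifted_def E_zero smult_zero add_zero zero_closed)

lemma shifted_closed: "x \<in> el P n e \<Longrightarrow> shifted w x \<in> el P n e"
  by (simp add: shifted_def E_closed add_closed smult_closed)

lemma shifted_add: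
  assumes "x \<in> el P n e" "y \<in> el P n e"
  shows "shifted w (oadd P x y) = oadd P (shifted w x) (shifted w y)"
  using assms
  by (simp add: shifted_def E_add[of _ n e] smult_add[of _ n e] E_closed smult_closed
      add_add_swap[of _ n e])

lemma shifted_shifted:
  assumes x: "x \<in> el P n e"
  shows "shifted v (shifted w x) = shifted w (shifted v x)"
  using x
  by (simp add: shifted_def E_add[of _ n e] E_smult[of _ n e] smult_add[of _ n e] E_closed smult_closed
      smult_smult[of _ n e] add_closed add_assoc[of _ n e] add_left_commute[of _ n e] mult.commute)

lemma positive_weight_shifted: "positive_weight n e x \<Longrightarrow> positive_weight n e (shifted w x)"
proof (induction rule: positive_weight.induct)
  case zero
  then show ?case by (simp add: shifted_zero positive_weight.zero)
next
  case (step x v)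
  then show ?case
    using shifted_shifted[of x n e v w] by (metis positive_weight.step shifted_closed)
qed

text \<open>
  Peeling factors off \<open>x\<close> acts on \<open>y\<close> too, which is harmless because the factors commute.
\<close>

lemma positive_weight_add:
  "positive_weight n e x \<Longrightarrow> positive_weight n e y \<Longrightarrow> positive_weight n e (oadd P x y)"
proof (induction arbitrary: y rule: positive_weight.induct)
  case zero
  then show ?case by (simp add: zero_add positive_weight_closed)
next
  case (step x w)
  have y: "y \<in> el P n e" using step by (simp add: positive_weight_closed)
  have "positive_weight n e (shifted w (oadd P x y))"
    using step.IH[OF positive_weight_shifted[OF step.prems]] shifted_add[OF step(1) y] by simp
  then show ?case by (rule positive_weight.step[OF add_closed[OF step(1) y] step(2)])
qed

text \<open>
  Scalars, permutations, the differential and composition with an element of weight 0 are of this kind.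
\<close>

lemma positive_weight_map:
  assumes "positive_weight n e x" and closed: "\<And>x. x \<in> el P n e \<Longrightarrow> f x \<in> el P m d"
    and zero: "f (ozero P n e) = ozero P m d"
    and shift: "\<And>w x. x \<in> el P n e \<Longrightarrow> shifted w (f x) = f (shifted w x)"
  shows "positive_weight m d (f x)"
  using assms(1)
proof (induction rule: positive_weight.induct)
  case zero
  show ?case by (simp add: assms(3) positive_weight.zero)
next
  case (step x w)
  then show ?case using positive_weight.step[OF closed[OF step(1)] step(2)] shift[OF step(1)] by simp
qed

lemma positive_weight_smult: "positive_weight n e x \<Longrightarrow> positive_weight n e (osmult P c x)"
  by (rule positive_weight_map[where n = n and e = e and f = "osmult P c"])
    (simp_all add: smult_closed smult_zero shifted_def E_smult[of _ n e] smult_add[of _ n e] E_closed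
      smult_smult[of _ n e] mult.commute)

lemma positive_weight_act:
  "positive_weight n e x \<Longrightarrow> \<sigma> permutes {1..n} \<Longrightarrow> positive_weight n e (oact P x \<sigma>)"
  by (rule positive_weight_map[where n = n and e = e and f = "\<lambda>x. oact P x \<sigma>"])
    (simp_all add: act_closed act_zero shifted_def E_act[of _ n e] act_add[of _ n e] E_closed
      smult_closed act_smult[of _ n e])

lemma positive_weight_diff: "positive_weight n e x \<Longrightarrow> positive_weight n (e + 1) (odiff P x)"
  by (rule positive_weight_map[where n = n and e = e and f = "odiff P"])
    (simp_all add: diff_closed diff_zero shifted_def E_diff[of _ n e] diff_add[of _ n e] E_closed
      smult_closed diff_smult[of _ n e])

text \<open>
  \<open>E - (v + w)\<close> on a composition is \<open>(E - v) \<otimes> 1 + 1 \<otimes> (E - w)\<close>, as \<open>E\<close> is a derivation: weights add.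
\<close>

lemma shifted_comp:
  assumes x: "x \<in> el P m e" and y: "y \<in> el P n e'" and i: "1 \<le> i" "i \<le> m"
  shows "shifted (v + w) (ocomp P x i y)
    = oadd P (ocomp P (shifted v x) i y) (ocomp P x i (shifted w y))"
proof -
  note c = comp_closed[OF x y i]
  note Ex = comp_closed[OF E_closed[OF x] y i] and Ey = comp_closed[OF x E_closed[OF y] i]
  have "osmult P (- of_nat (v + w)) (ocomp P x i y)
      = oadd P (osmult P (- of_nat v) (ocomp P x i y)) (osmult P (- of_nat w) (ocomp P x i y))"
    using add_smult[OF c, of "- of_nat v" "- of_nat w"] by (simp add: add.commute)
  then show ?thesis
    by (simp add: shifted_def E_comp[OF x y i] comp_add_left[OF E_closed[OF x] smult_closed[OF x] y i]
        comp_add_right[OF x E_closed[OF y] smult_closed[OF y] i] comp_smult_left[OF x y i]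
        comp_smult_right[OF x y i] add_add_swap[OF Ex Ey smult_closed[OF c] smult_closed[OF c]])
qed

lemma shifted_weight_0: "x \<in> el P n e \<Longrightarrow> E x = ozero P n e \<Longrightarrow> shifted 0 x = ozero P n e"
  by (simp add: shifted_def zero_smult[of _ n e] add_zero zero_closed)

lemma positive_weight_comp_left:
  assumes x: "positive_weight m e x" and y: "y \<in> el P n e'" "E y = ozero P n e'"
    and i: "1 \<le> i" "i \<le> m"
  shows "positive_weight (m + n - 1) (e + e') (ocomp P x i y)"
proof (rule positive_weight_map[OF x, where f = "\<lambda>x. ocomp P x i y"])
  show "ocomp P (ozero P m e) i y = ozero P (m + n - 1) (e + e')" using y i by (simp add: zero_comp)
  fix w x assume "x \<in> el P m e"
  then show "shifted w (ocomp P x i y) = ocomp P (shifted w x) i y"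
    using shifted_comp[of x m e y n e' i w 0] y i shifted_closed[of x m e w]
      shifted_weight_0[OF y]
    by (simp add: comp_zero[of x m e i "m + n - 1"] add_zero[OF comp_closed])
qed (use y i comp_closed in auto)

lemma positive_weight_comp_right:
  assumes y: "positive_weight n e' y" and x: "x \<in> el P m e" "E x = ozero P m e"
    and i: "1 \<le> i" "i \<le> m"
  shows "positive_weight (m + n - 1) (e + e') (ocomp P x i y)"
proof (rule positive_weight_map[OF y, where f = "\<lambda>y. ocomp P x i y"])
  show "ocomp P x i (ozero P n e') = ozero P (m + n - 1) (e + e')" using x i by (simp add: comp_zero)
  fix w y assume "y \<in> el P n e'"
  then show "shifted w (ocomp P x i y) = ocomp P x i (shifted w y)"
    using shifted_comp[of x m e y n e' i 0 w] x i shifted_closed[of y n e' w]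
      shifted_weight_0[OF x]
    by (simp add: zero_comp[of y n e' i m "m + n - 1"] zero_add[OF comp_closed])
qed (use x i comp_closed in auto)

lemma positive_weight_comp:
  assumes "positive_weight m e x" "positive_weight n e' y" and i: "1 \<le> i" "i \<le> m"
  shows "positive_weight (m + n - 1) (e + e') (ocomp P x i y)"
  using assms(1,2)
proof (induction arbitrary: y rule: positive_weight.induct)
  case zero
  then show ?case using i positive_weight_closed
    by (simp add: zero_comp[of y n e' i m "m + n - 1"] positive_weight.zero)
next
  case (step x v)
  note x = step(1-4)
  from step.prems show ?case
  proof (induction rule: positive_weight.induct)
    case zero
    then show ?case using i x
      by (simp add: comp_zero[of x m e i "m + n - 1"] positive_weight.zero)
  next
    case (step y w)
    have "positive_weight n e' y" by (rule positive_weight.step[OF step(1-3)])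
    then have "positive_weight (m + n - 1) (e + e') (shifted (v + w) (ocomp P x i y))"
      unfolding shifted_comp[OF x(1) step(1) i] by (intro positive_weight_add x(4) step.IH)
    then show ?case
      using x(2) by (intro positive_weight.step[OF comp_closed[OF x(1) step(1) i], of "v + w"]) auto
  qed
qed

text \<open>
  If \<open>x\<close> is closed then \<open>E x = d (h x)\<close>, so \<open>w x = d (h x) - (E - w) x\<close>, and the last term is closed and
  has one factor less to peel off. Division by \<open>w\<close> is where characteristic 0 enters.
\<close>

lemma positive_weight_exact:
  assumes "positive_weight n e x" "odiff P x = ozero P n (e + 1)"
  shows "\<exists>b\<in>el P n (e - 1). x = odiff P b"
  using assms
proof (induction rule: positive_weight.induct)
  case zero
  show ?case using diff_zero[of e "e - 1" n] zero_closed by (intro bexI[of _ "ozero P n (e - 1)"]) auto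
next
  case (step x w)
  have dx: "odiff P (shifted w x) = ozero P n (e + 1)"
    using step by (simp add: shifted_def diff_add[of _ n e] E_closed smult_closed diff_smult
        smult_zero add_zero zero_closed E_zero flip: E_diff)
  obtain b where b: "b \<in> el P n (e - 1)" "shifted w x = odiff P b"
    using step.IH[OF dx] by blast
  have hx: "h x \<in> el P n (e - 1)" by (rule h_closed[OF step(1)])
  have dh: "odiff P (h x) \<in> el P n e" by (rule diff_closed'[OF hx]) simp
  have db: "odiff P b \<in> el P n e" by (rule diff_closed'[OF b(1)]) simp
  have "oadd P (E x) (osmult P (- 1) (odiff P (h x))) = ozero P n e"
    using h_diff[OF step(1)] step.prems h_zero[of n "e + 1"] by simp
  then have "E x = odiff P (h x)"
    using add_eq_zeroD[OF E_closed[OF step(1)] smult_closed[OF dh, of "- 1"]]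
    by (simp add: smult_smult[OF dh] smult_one[OF dh])
  then have "oadd P (odiff P (h x)) (osmult P (- of_nat w) x) = odiff P b"
    using b(2) by (simp add: shifted_def)
  then have *: "osmult P (of_nat w) x = oadd P (odiff P (h x)) (osmult P (- 1) (odiff P b))" 
  proof -
    assume a: "oadd P (odiff P (h x)) (osmult P (- of_nat w) x) = odiff P b"
    have wx: "osmult P (of_nat w) x \<in> el P n e" "osmult P (- of_nat w) x \<in> el P n e"
      using step(1) by (auto intro: smult_closed)
    have "oadd P (odiff P (h x)) (osmult P (- 1) (odiff P b))
      = oadd P (odiff P (h x)) (oadd P (osmult P (- 1) (odiff P (h x))) (osmult P (of_nat w) x))"
      unfolding a[symmetric] using step(1) by (simp add: smult_add[OF dh wx(2)] smult_smult)
    also have "\<dots> = osmult P (of_nat w) x"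
      using wx dh by (simp add: smult_closed add_neg[of _ n e] zero_add flip: add_assoc[of _ n e])
    finally show ?thesis by simp
  qed
  let ?c = "oadd P (h x) (osmult P (- 1) b)"
  have c: "?c \<in> el P n (e - 1)" using hx b(1) by (simp add: add_closed smult_closed)
  have "x = osmult P (1 / of_nat w) (osmult P (of_nat w) x)"
    using step(1,2) by (simp add: smult_smult[of x n e] smult_one[of x n e])
  also have "\<dots> = odiff P (osmult P (1 / of_nat w) ?c)"
    unfolding * using hx b(1)
    by (simp add: diff_smult[OF c] diff_add[of _ n "e - 1"] smult_closed diff_smult[of _ n "e - 1"])
  finally show ?case using smult_closed[OF c] by blast
qed

end

section \<open>Exact Batalin-Vilkovisky pairs\<close>

lemma (in dg_operad) op_DO_closed:
  assumes "m \<in> el P 2 0" "x \<in> el P 1 e"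
  shows "op_DO P m n e x \<in> el P (n + 1) e"
proof -
  define pr :: "('k, bool) presentation" where
    "pr = \<lparr>gens = UNIV, gen_arity = (\<lambda>b. if b then 1 else 2),
       gen_degree = (\<lambda>b. if b then e else 0), rels = {}\<rparr>"
  have "is_term pr (n + 1) e (DO (Gen False) n e (Gen True))"
    by (intro is_term_DO is_term_Gen) (simp_all add: pr_def)
  then show ?thesis unfolding op_DO_def by (rule teval_closed) (use assms in \<open>simp add: pr_def\<close>)
qed

lemma (in dg_operad) op_DO_smult:
  assumes m: "m \<in> el P 2 0" and x: "x \<in> el P 1 e"
  shows "op_DO P m n e (osmult P c x) = osmult P c (op_DO P m n e x)"
  by (rule sym, rule op_DO_natural[OF dg_operad_axioms dg_operad_axioms m m _ _ _ _ _ _ x])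
    (auto simp: smult_closed smult_add smult_smult mult.commute act_smult
      comp_smult_left[OF _ m] comp_smult_right[OF m])

text \<open>
  For a closed product \<open>m\<close> the differential commutes, without signs, with \<open>m\<close> on either side.
\<close>

lemma (in dg_operad) op_DO_diff:
  assumes m: "m \<in> el P 2 0" "odiff P m = ozero P 2 1" and x: "x \<in> el P 1 e"
  shows "op_DO P m n (e + 1) (odiff P x) = odiff P (op_DO P m n e x)"
proof (rule sym, rule op_DO_natural[OF dg_operad_axioms dg_operad_axioms m(1) m(1) _ _ _ _ _ _ x])
  fix k y assume y: "y \<in> el P k e"
  have "odiff P (ocomp P m 1 y)
      = oadd P (ocomp P (odiff P m) 1 y) (osmult P ((- 1) powi 0) (ocomp P m 1 (odiff P y)))"
    by (rule diff_comp[OF m(1) y]) simp_all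
  moreover have "ocomp P (odiff P m) 1 y = ozero P (k + 1) (e + 1)"
    unfolding m(2) by (rule zero_comp[OF y]) auto
  moreover have "ocomp P m 1 (odiff P y) \<in> el P (k + 1) (e + 1)"
    by (rule comp_closed'[OF m(1) diff_closed[OF y]]) auto
  ultimately show "odiff P (ocomp P m 1 y) = ocomp P m 1 (odiff P y)"
    by (simp add: smult_one zero_add)
next
  fix k y assume y: "y \<in> el P k e" and k: "1 \<le> k"
  have "odiff P (ocomp P y 1 m)
      = oadd P (ocomp P (odiff P y) 1 m) (osmult P ((- 1) powi e) (ocomp P y 1 (odiff P m)))"
    by (rule diff_comp[OF y m(1)]) (use k in simp_all)
  moreover have "ocomp P y 1 (odiff P m) = ozero P (k + 1) (e + 1)"
    unfolding m(2) by (rule comp_zero[OF y]) (use k in auto)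
  moreover have "ocomp P (odiff P y) 1 m \<in> el P (k + 1) (e + 1)"
    by (rule comp_closed'[OF diff_closed[OF y] m(1)]) (use k in auto)
  ultimately show "odiff P (ocomp P y 1 m) = ocomp P (odiff P y) 1 m"
    by (simp add: smult_zero add_zero)
qed (auto simp: diff_closed diff_add diff_smult diff_act)

text \<open>
  A product without \<open>t\<close> and \<open>\<epsilon>\<close> components, of even degree, acts separately on the three components;
  each of the three projections is therefore an instance of \<open>op_DO_natural\<close>.
\<close>

lemma op_DO_path_ext:
  assumes "dg_operad P" and m: "m \<in> el P 2 0"
    and x: "x \<in> el P 1 e" "a \<in> el P 1 e" "b \<in> el P 1 (e - 1)"
  shows "op_DO (path_ext P) (0, m, ozero P 2 0, ozero P 2 (- 1)) n e (e, x, a, b)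
    = (e, op_DO P m n e x, op_DO P m n e a, op_DO P m n (e - 1) b)"
proof -
  interpret dg_operad P by fact
  interpret T: dg_operad "path_ext P" by (rule dg_operad_path_ext)
  let ?M = "(0, m, ozero P 2 0, ozero P 2 (- 1))" and ?X = "(e, x, a, b)"
  let ?Y = "op_DO (path_ext P) ?M n e ?X"
  have M: "?M \<in> el (path_ext P) 2 0" and X: "?X \<in> el (path_ext P) 1 e"
    using m x by (auto simp: path_ext_sel zero_closed)
  have M_comp: "ocomp (path_ext P) ?M 1 (e, y, c, d) = (e, ocomp P m 1 y, ocomp P m 1 c, ocomp P m 1 d)"
    if "y \<in> el P k e" "c \<in> el P k e" "d \<in> el P k (e - 1)" for k y c d
  proof -
    have "ocomp P m 1 c \<in> el P (k + 1) e" "ocomp P m 1 d \<in> el P (k + 1) (e - 1)"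
      by (auto intro: comp_closed'[OF m that(2)] comp_closed'[OF m that(3)])
    moreover have "ocomp P (ozero P 2 0) 1 y = ozero P (k + 1) e"
      "ocomp P (ozero P 2 (- 1)) 1 y = ozero P (k + 1) (e - 1)"
      by (auto intro: zero_comp[OF that(1)])
    ultimately show ?thesis by (simp add: path_ext_sel zero_add smult_one)
  qed
  have comp_M: "ocomp (path_ext P) (e, y, c, d) 1 ?M = (e, ocomp P y 1 m, ocomp P c 1 m, ocomp P d 1 m)"
    if "y \<in> el P k e" "c \<in> el P k e" "d \<in> el P k (e - 1)" "1 \<le> k" for k y c d
  proof -
    have "ocomp P c 1 m \<in> el P (k + 1) e" "ocomp P d 1 m \<in> el P (k + 1) (e - 1)"
      using that(4) by (auto intro: comp_closed'[OF that(2) m] comp_closed'[OF that(3) m])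
    moreover have "ocomp P y 1 (ozero P 2 0) = ozero P (k + 1) e"
      "ocomp P y 1 (ozero P 2 (- 1)) = ozero P (k + 1) (e - 1)"
      using that(4) by (auto intro: comp_zero[OF that(1)])
    ultimately show ?thesis by (simp add: path_ext_sel add_zero smult_zero)
  qed
  note nat = op_DO_natural[OF T.dg_operad_axioms dg_operad_axioms M m _ _ _ _ _ _ X]
  have "fst (snd ?Y) = op_DO P m n e (fst (snd ?X))"
    by (rule nat) (auto elim!: path_elE simp: path_ext_sel(3,4,7) M_comp comp_M)
  moreover have "fst (snd (snd ?Y)) = op_DO P m n e (fst (snd (snd ?X)))"
    by (rule nat) (auto elim!: path_elE simp: path_ext_sel(3,4,7) M_comp comp_M)
  moreover have "snd (snd (snd ?Y)) = op_DO P m n (e - 1) (snd (snd (snd ?X)))"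
    by (rule nat) (auto elim!: path_elE simp: path_ext_sel(3,4,7) M_comp comp_M)
  moreover have "fst ?Y = e" using T.op_DO_closed[OF M X, of n] by (auto simp: path_ext_sel(1))
  ultimately show ?thesis by (metis fst_conv snd_conv prod.collapse)
qed

definition commutative_product :: "('k::field, 'a) dg_operad_data \<Rightarrow> 'a \<Rightarrow> bool" where
  "commutative_product P m \<longleftrightarrow> m \<in> el P 2 0 \<and> odiff P m = ozero P 2 1 \<and>
     oact P m (Transposition.transpose 1 2) = m \<and> ocomp P m 1 m = ocomp P m 2 m"

definition exact_BV_pair :: "('k::field, 'a) dg_operad_data \<Rightarrow> 'a \<Rightarrow> 'a \<Rightarrow> bool" where
  "exact_BV_pair P m x \<longleftrightarrow> commutative_product P m \<and> x \<in> el P 1 (- 2) \<and>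
     ocomp P x 1 (odiff P x) = ocomp P (odiff P x) 1 x \<and> op_DO P m 2 (- 2) x = ozero P 3 (- 2)"

lemma commutative_product_presented:
  assumes "g \<in> gens p" "gen_arity p g = 2" "gen_degree p g = 0" "comm_rels (Gen g) \<subseteq> rels p"
  shows "commutative_product (presented_operad p) (gen_class p g)"
proof -
  have "is_term p 2 0 (Gen g)" using is_term_Gen[OF assms(1-3)] .
  then have "teval (presented_operad p) (gen_class p) s = teval (presented_operad p) (gen_class p) t"
    if "(s, t) \<in> comm_rels (Gen g)" for s t
    using that assms(4) comm_rels_same_type presented_relation by blast
  from this[of "Diff (Gen g)"] this[of "Act (Gen g) _"] this[of "Comp (Gen g) 1 (Gen g)"]
  show ?thesis
    using gen_class_closed[OF assms(1)] assms(2,3)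
    by (simp add: commutative_product_def comm_rels_def)
qed

lemma teval_comm_rels:
  assumes "commutative_product Q (teval Q a \<mu>)" "(s, t) \<in> comm_rels \<mu>"
  shows "teval Q a s = teval Q a t"
  using assms by (auto simp: commutative_product_def comm_rels_def)

abbreviation com_mu :: "('k::field, com_gen) oterm set" where
  "com_mu \<equiv> gen_class com_presentation Com_mu"

abbreviation ebv_mu :: "('k::field, ebv_gen) oterm set" where
  "ebv_mu \<equiv> gen_class ebv_presentation EBV_mu"

abbreviation ebv_i :: "('k::field, ebv_gen) oterm set" where
  "ebv_i \<equiv> gen_class ebv_presentation EBV_i"

lemma com_presentation_type:
  "gen_arity com_presentation g = 2" "gen_degree com_presentation g = 0"
  by (simp_all add: com_presentation_def)

lemma com_commutative_product: "commutative_product com_operad com_mu"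
  unfolding com_operad_def
  by (rule commutative_product_presented) (simp_all add: com_presentation_def)

lemma bvd_commutative_product:
  "commutative_product bvd_operad (gen_class bvd_presentation BVD_mu)"
  unfolding bvd_operad_def
  by (rule commutative_product_presented) (auto simp: bvd_presentation_def bvd_rels_def Let_def)

lemma ebv_exact_BV_pair: "exact_BV_pair ebv_operad ebv_mu ebv_i"
proof -
  let ?p = "ebv_presentation :: ('a, ebv_gen) presentation"
  have "commutative_product (presented_operad ?p) ebv_mu"
    by (rule commutative_product_presented) (auto simp: ebv_presentation_def ebv_rels_def Let_def)
  moreover have "ebv_i \<in> el (presented_operad ?p) 1 (- 2)"
    using gen_class_closed[of EBV_i ?p] by (simp add: ebv_presentation_def)
  moreover have "teval (presented_operad ?p) (gen_class ?p) s = teval (presented_operad ?p) (gen_class ?p) t"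
    if "(s, t) \<in> ebv_rels" for s t
    using that ebv_rels_same_type by (intro presented_relation) (auto simp: ebv_presentation_def)
  from this[of "Comp (Gen EBV_i) 1 (Diff (Gen EBV_i))" "Comp (Diff (Gen EBV_i)) 1 (Gen EBV_i)"]
    this[of "DO (Gen EBV_mu) 2 (- 2) (Gen EBV_i)" "Zero 3 (- 2)"]
  have "ocomp (presented_operad ?p) ebv_i 1 (odiff (presented_operad ?p) ebv_i)
      = ocomp (presented_operad ?p) (odiff (presented_operad ?p) ebv_i) 1 ebv_i"
    "op_DO (presented_operad ?p) ebv_mu 2 (- 2) ebv_i = ozero (presented_operad ?p) 3 (- 2)"
    by (simp_all add: ebv_rels_def Let_def teval_DO)
  ultimately show ?thesis by (simp add: exact_BV_pair_def ebv_operad_def)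
qed

lemma com_hom_exists:
  fixes Q :: "('k::field, 'a) dg_operad_data"
  assumes "dg_operad Q" "commutative_product Q m"
  shows "\<exists>f. dg_operad_hom com_operad Q f \<and> f com_mu = m"
proof -
  let ?p = "com_presentation :: ('k, com_gen) presentation"
  have "\<exists>f. dg_operad_hom (presented_operad ?p) Q f \<and> (\<forall>g\<in>gens ?p. f (gen_class ?p g) = m)"
    using assms
    by (intro presented_operad_hom_exists[where a = "\<lambda>_. m"])
      (auto simp: com_presentation_def commutative_product_def comm_rels_def)
  then show ?thesis by (auto simp: com_operad_def com_presentation_def)
qed

lemma ebv_hom_exists:
  fixes Q :: "('k::field, 'a) dg_operad_data"
  assumes "dg_operad Q" "exact_BV_pair Q m x"
  shows "\<exists>f. dg_operad_hom ebv_operad Q f \<and> f ebv_mu = m \<and> f ebv_i = x"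
proof -
  let ?p = "ebv_presentation :: ('k, ebv_gen) presentation"
  let ?a = "\<lambda>g. case g of EBV_mu \<Rightarrow> m | EBV_i \<Rightarrow> x"
  have "\<exists>f. dg_operad_hom (presented_operad ?p) Q f \<and> (\<forall>g\<in>gens ?p. f (gen_class ?p g) = ?a g)"
  proof (rule presented_operad_hom_exists[OF assms(1)])
    show "?a g \<in> el Q (gen_arity ?p g) (gen_degree ?p g)" for g
      using assms(2)
      by (cases g) (auto simp: ebv_presentation_def exact_BV_pair_def commutative_product_def)
    show "teval Q ?a s = teval Q ?a t" if "(s, t) \<in> rels ?p" for s t
      using that assms(2) teval_comm_rels[of Q ?a "Gen EBV_mu" s t]
      by (auto simp: ebv_presentation_def ebv_rels_def Let_def exact_BV_pair_def teval_DO)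
  qed
  then obtain f where "dg_operad_hom (presented_operad ?p) Q f" "\<forall>g\<in>gens ?p. f (gen_class ?p g) = ?a g"
    by blast
  then show ?thesis by (intro exI[of _ f]) (simp add: ebv_operad_def ebv_presentation_def)
qed

text \<open>
  This gives the retraction onto \<open>C\<close>.
\<close>

lemma exact_BV_pair_zero:
  assumes "dg_operad Q" "commutative_product Q m"
  shows "exact_BV_pair Q m (ozero Q 1 (- 2))"
proof -
  interpret dg_operad Q by fact
  have m: "m \<in> el Q 2 0" using assms(2) by (simp add: commutative_product_def)
  have z: "ozero Q 1 (- 2) = osmult Q 0 (ozero Q 1 (- 2))" by (simp add: smult_zero)
  have "op_DO Q m 2 (- 2) (ozero Q 1 (- 2)) = osmult Q 0 (op_DO Q m 2 (- 2) (ozero Q 1 (- 2)))"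
    by (subst z) (rule op_DO_smult[OF m zero_closed])
  also have "\<dots> = ozero Q 3 (- 2)"
    by (rule zero_smult) (use op_DO_closed[OF m zero_closed, of 2] in simp)
  finally show ?thesis
    using assms(2)
    by (simp add: exact_BV_pair_def zero_closed diff_zero[of "- 1"] zero_comp[OF zero_closed])
qed

text \<open>
  The element \<open>X = x + t x\<close> has differential \<open>d x + t (d x) + \<epsilon> x\<close>. In \<open>X (d X) = (d X) X\<close> the \<open>\<epsilon>\<close>
  components of both sides are \<open>x x\<close>, as \<open>x\<close> has even degree.
\<close>

lemma exact_BV_pair_path_ext:
  assumes "dg_operad P" "exact_BV_pair P m x"
  shows "exact_BV_pair (path_ext P) (0, m, ozero P 2 0, ozero P 2 (- 1)) (- 2, x, x, ozero P 1 (- 3))"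
proof -
  interpret dg_operad P by fact
  have m: "m \<in> el P 2 0" "odiff P m = ozero P 2 1" "oact P m (Transposition.transpose 1 2) = m"
      "ocomp P m 1 m = ocomp P m 2 m"
    and x: "x \<in> el P 1 (- 2)" "ocomp P x 1 (odiff P x) = ocomp P (odiff P x) 1 x"
      "op_DO P m 2 (- 2) x = ozero P 3 (- 2)"
    using assms(2) by (simp_all add: exact_BV_pair_def commutative_product_def)
  have t: "Transposition.transpose 1 2 permutes {1..2::nat}" by (rule permutes_swap_id) auto
  have "commutative_product (path_ext P) (0, m, ozero P 2 0, ozero P 2 (- 1))"
    by (simp add: commutative_product_def path_ext_sel m zero_closed diff_zero act_zero[OF t]
        smult_zero add_zero zero_comp[OF m(1)] comp_zero[OF m(1)])
  moreover have "op_DO P m 2 (- 3) (ozero P 1 (- 3)) = ozero P 3 (- 3)"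
  proof -
    have "op_DO P m 2 (- 3) (osmult P 0 (ozero P 1 (- 3)))
        = osmult P 0 (op_DO P m 2 (- 3) (ozero P 1 (- 3)))"
      by (rule op_DO_smult[OF m(1) zero_closed])
    also have "\<dots> = ozero P 3 (- 3)"
      by (rule zero_smult) (use op_DO_closed[OF m(1) zero_closed, of 2] in simp)
    finally show ?thesis by (simp add: smult_zero)
  qed
  then have "op_DO (path_ext P) (0, m, ozero P 2 0, ozero P 2 (- 1)) 2 (- 2) (- 2, x, x, ozero P 1 (- 3))
      = ozero (path_ext P) 3 (- 2)"
    using op_DO_path_ext[OF assms(1) m(1) x(1) x(1), of "ozero P 1 (- 3)"] zero_closed[of 1 "- 3"]
    by (simp add: path_ext_sel x)
  moreover have "ocomp P x 1 x \<in> el P 1 (- 4)" by (rule comp_closed'[OF x(1) x(1)]) auto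
  moreover have dx: "odiff P x \<in> el P 1 (- 1)" by (rule diff_closed'[OF x(1)]) simp
  moreover have "ocomp P x 1 (odiff P x) \<in> el P 1 (- 3)" by (rule comp_closed'[OF x(1) dx]) auto
  moreover have "ocomp P (ozero P 1 (- 3)) 1 (odiff P x) = ozero P 1 (- 4)"
    "ocomp P (odiff P x) 1 (ozero P 1 (- 3)) = ozero P 1 (- 4)"
    by (auto intro: zero_comp[OF dx] comp_zero[OF dx])
  ultimately show ?thesis
    by (simp add: exact_BV_pair_def path_ext_sel x zero_closed diff_zero[of "- 2"] smult_zero
        add_zero[of _ 1 "- 2"] add_zero[of _ 1 "- 4"] zero_add[of _ 1 "- 4"] smult_one[of _ 1 "- 4"])
qed

section \<open>The morphism from the trivialized to the exact operad\<close>

lemma (in dg_operad) teval_term_sum_zero: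
  assumes "finite A" "\<And>i. i \<in> A \<Longrightarrow> teval P a (F i) = ozero P n e"
  shows "teval P a (term_sum n e F A) = ozero P n e"
proof -
  have "set (SOME xs. set xs = A \<and> distinct xs) = A"
    using someI_ex[OF finite_distinct_list[OF assms(1)]] by blast
  moreover have "foldr (\<lambda>i t. oadd P (teval P a (F i)) t) xs (ozero P n e) = ozero P n e"
    if "set xs \<subseteq> A" for xs
    using that by (induction xs) (auto simp: assms(2) add_zero zero_closed)
  ultimately show ?thesis by (simp add: teval_term_sum)
qed

text \<open>
  In a nested bracket of length at least 2 either some \<open>\<phi>\<^sub>q\<close> with \<open>q \<ge> 2\<close> occurs, which is 0, or the
  innermost bracket is \<open>[x, d x] = 0\<close>, the sign of the commutator being trivial as \<open>x\<close> is even.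
\<close>

lemma (in dg_operad) teval_nested_bracket:
  assumes x: "x \<in> el P 1 (- 2)" "ocomp P x 1 (odiff P x) = ocomp P (odiff P x) 1 x"
    and a: "a (BVD_phi 1) = x" "\<And>n. n \<ge> 2 \<Longrightarrow> a (BVD_phi n) = ozero P 1 (- 2 * int n)"
    and "\<forall>r\<in>set (q # q' # qs). 1 \<le> r"
  shows "teval P a (nested_bracket (q # q' # qs)) = ozero P 1 (1 - 2 * int (sum_list (q # q' # qs)))"
  using assms(5)
proof (induction qs arbitrary: q q')
  have phi: "a (BVD_phi n) \<in> el P 1 (- 2 * int n)" if "1 \<le> n" for n
    using that x(1) a zero_closed by (cases "n = 1") auto
  case Nil
  then have q: "1 \<le> q" "1 \<le> q'" by auto
  have sign: "(- 1 :: 'k) powi (- 2 * int q * (1 - 2 * int q')) = 1" by (simp add: minus_one_powi)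
  have d: "odiff P (a (BVD_phi q')) \<in> el P 1 (1 - 2 * int q')"
    by (rule diff_closed'[OF phi[OF q(2)]]) simp
  consider "q = 1" "q' = 1" | "2 \<le> q'" | "2 \<le> q" using q by linarith
  then show ?case
  proof cases
    case 1
    have "ocomp P (odiff P x) 1 x \<in> el P 1 (- 3)"
      using comp_closed'[OF diff_closed[OF x(1)] x(1), of 1 1 "- 3"] by simp
    then show ?thesis using sign by (simp add: 1 bracket_def a(1) x(2) add_neg)
  next
    case 2
    then have "odiff P (a (BVD_phi q')) = ozero P 1 (1 - 2 * int q')" by (simp add: a(2) diff_zero)
    then show ?thesis
      using phi[OF q(1)]
      by (simp add: bracket_def smult_zero add_zero[OF zero_closed]
          comp_zero[of _ 1 "- (2 * int q)" 1 1 1 "1 - 2 * (int q + int q')"]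
          zero_comp[of _ 1 "- (2 * int q)" 1 1 1 "1 - 2 * (int q + int q')"])
  next
    case 3
    then show ?thesis
      using d
      by (simp add: bracket_def smult_zero add_zero[OF zero_closed] a(2)
          comp_zero[of _ 1 "1 - 2 * int q'" 1 1 1 "1 - 2 * (int q + int q')"]
          zero_comp[of _ 1 "1 - 2 * int q'" 1 1 1 "1 - 2 * (int q + int q')"])
  qed
next
  have phi: "a (BVD_phi n) \<in> el P 1 (- 2 * int n)" if "1 \<le> n" for n
    using that x(1) a zero_closed by (cases "n = 1") auto
  case (Cons r qs)
  let ?s = "1 - 2 * int (sum_list (q' # r # qs))" and ?t = "1 - 2 * int (sum_list (q # q' # r # qs))"
  have "teval P a (nested_bracket (q' # r # qs)) = ozero P 1 ?s" using Cons by simp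
  moreover have "ocomp P (a (BVD_phi q)) 1 (ozero P 1 ?s) = ozero P 1 ?t"
    "ocomp P (ozero P 1 ?s) 1 (a (BVD_phi q)) = ozero P 1 ?t"
    using Cons.prems by (auto intro: comp_zero[OF phi] zero_comp[OF phi])
  ultimately show ?case
    by (simp add: bracket_def smult_zero add_zero[OF zero_closed] del: sum_list.Cons nested_bracket.simps
        add: nested_bracket.simps(3)[of q q'])
qed

lemma bvd_hom_exists:
  fixes Q :: "('k::field_char_0, 'a) dg_operad_data"
  assumes "dg_operad Q" "exact_BV_pair Q m x"
  shows "\<exists>g. dg_operad_hom bvd_operad Q g \<and> g (gen_class bvd_presentation BVD_mu) = m \<and>
    g (gen_class bvd_presentation BVD_Delta) = osmult Q (- 1) (odiff Q x) \<and>
    g (gen_class bvd_presentation (BVD_phi 1)) = x \<and>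
    (\<forall>n\<ge>2. g (gen_class bvd_presentation (BVD_phi n)) = ozero Q 1 (- 2 * int n))"
proof -
  interpret dg_operad Q by fact
  let ?p = "bvd_presentation :: ('k, bvd_gen) presentation"
  define a where "a = (\<lambda>g. case g of BVD_mu \<Rightarrow> m | BVD_Delta \<Rightarrow> osmult Q (- 1) (odiff Q x)
    | BVD_phi n \<Rightarrow> if n = 1 then x else ozero Q 1 (- 2 * int n))"
  have m: "m \<in> el Q 2 0" "odiff Q m = ozero Q 2 1" "commutative_product Q m"
    and x: "x \<in> el Q 1 (- 2)" "ocomp Q x 1 (odiff Q x) = ocomp Q (odiff Q x) 1 x"
      "op_DO Q m 2 (- 2) x = ozero Q 3 (- 2)"
    using assms(2) by (simp_all add: exact_BV_pair_def commutative_product_def)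
  have dx: "odiff Q x \<in> el Q 1 (- 1)" by (rule diff_closed'[OF x(1)]) simp
  have ddx: "odiff Q (odiff Q x) = ozero Q 1 0" using diff_diff[OF x(1)] by simp
  \<comment> \<open>the differential of \<open>x (d x) = (d x) x\<close> reads \<open>(d x) (d x) = - (d x) (d x)\<close>\<close>
  have dxdx: "ocomp Q (odiff Q x) 1 (odiff Q x) = ozero Q 1 (- 2)"
  proof -
    let ?y = "ocomp Q (odiff Q x) 1 (odiff Q x)"
    have y: "?y \<in> el Q 1 (- 2)" by (rule comp_closed'[OF dx dx]) auto
    have "odiff Q (ocomp Q x 1 (odiff Q x)) = ?y"
      using diff_comp[OF x(1) dx, of 1] ddx
      by (simp add: comp_zero[OF x(1), of 1 1 1 "- 2"] smult_zero add_zero[OF y])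
    moreover have "odiff Q (ocomp Q (odiff Q x) 1 x) = osmult Q (- 1) ?y"
      using diff_comp[OF dx x(1), of 1] ddx
      by (simp add: zero_comp[OF x(1), of 1 1 1 "- 2"] zero_add[OF smult_closed[OF y]])
    ultimately have "?y = osmult Q (- 1) ?y" using x(2) by simp
    then have "oadd Q ?y ?y = ozero Q 1 (- 2)" using add_neg[OF y] by simp
    then have "osmult Q 2 ?y = ozero Q 1 (- 2)"
      using add_smult[OF y, of 1 1] by (simp add: smult_one[OF y])
    then have "osmult Q (1 / 2) (osmult Q 2 ?y) = ozero Q 1 (- 2)" by (simp add: smult_zero)
    then show ?thesis by (simp add: smult_smult[OF y] smult_one[OF y])
  qed
  have a_phi: "a (BVD_phi 1) = x" "\<And>n. n \<ge> 2 \<Longrightarrow> a (BVD_phi n) = ozero Q 1 (- 2 * int n)"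
    by (simp_all add: a_def)
  have "\<exists>g. dg_operad_hom (presented_operad ?p) Q g \<and> (\<forall>b\<in>gens ?p. g (gen_class ?p b) = a b)"
  proof (rule presented_operad_hom_exists[OF assms(1)])
    show "a g \<in> el Q (gen_arity ?p g) (gen_degree ?p g)" if "g \<in> gens ?p" for g
      using that m(1) x(1) dx by (auto simp: bvd_presentation_def a_def smult_closed zero_closed)
    have rel: "teval Q a s = teval Q a t"
      if "(s, t) \<in> comm_rels (Gen BVD_mu)" for s t
      by (rule teval_comm_rels[OF _ that]) (simp add: a_def m(3))
    have phi: "teval Q a (phi_rel_lhs n) = ozero Q 1 (1 - 2 * int n)" if n: "2 \<le> n" for n
    proof -
      have fin: "finite {qs. length qs = k \<and> sum_list qs = n \<and> (\<forall>q\<in>set qs. 1 \<le> q)}" for k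
        by (rule finite_subset[OF _ finite_lists_length_eq[of "{..n}" k]])
          (auto intro: member_le_sum_list)
      have "teval Q a (term_sum 1 (1 - 2 * int n) nested_bracket
          {qs. length qs = k \<and> sum_list qs = n \<and> (\<forall>q\<in>set qs. 1 \<le> q)}) = ozero Q 1 (1 - 2 * int n)"
        if k: "2 \<le> k" for k
      proof (rule teval_term_sum_zero[OF fin])
        fix qs assume qs: "qs \<in> {qs. length qs = k \<and> sum_list qs = n \<and> (\<forall>q\<in>set qs. 1 \<le> q)}"
        then obtain q q' rs where *: "qs = q # q' # rs"
          using k by (cases qs; cases "tl qs") auto
        show "teval Q a (nested_bracket qs) = ozero Q 1 (1 - 2 * int n)"
          using teval_nested_bracket[OF x(1,2) a_phi, of q q' rs] qs unfolding *
          by (simp del: nested_bracket.simps sum_list.Cons)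
      qed
      then have "teval Q a (term_sum 1 (1 - 2 * int n)
         (\<lambda>p. Scale (1 / fact p) (term_sum 1 (1 - 2 * int n) nested_bracket
            {qs. length qs = p \<and> sum_list qs = n \<and> (\<forall>q\<in>set qs. q \<ge> 1)})) {2..n})
          = ozero Q 1 (1 - 2 * int n)"
        by (intro teval_term_sum_zero) (auto simp: smult_zero)
      moreover have "odiff Q (a (BVD_phi n)) = ozero Q 1 (1 - 2 * int n)"
        using n by (simp add: a_phi diff_zero)
      ultimately show ?thesis by (simp add: phi_rel_lhs_def add_zero zero_closed)
    qed
    have "op_DO Q m 2 (- 1) (osmult Q (- 1) (odiff Q x)) = ozero Q 3 (- 1)"
      using op_DO_smult[OF m(1) dx, of 2 "- 1"] op_DO_diff[OF m(1,2) x(1), of 2]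
      by (simp add: x(3) diff_zero smult_zero)
    moreover have "ocomp Q (osmult Q (- 1) (odiff Q x)) 1 (osmult Q (- 1) (odiff Q x)) = ozero Q 1 (- 2)"
      using comp_smult_left[OF dx smult_closed[OF dx], of 1 "- 1" "- 1"]
        comp_smult_right[OF dx dx, of 1 "- 1"]
      by (simp add: dxdx smult_zero)
    ultimately show "teval Q a s = teval Q a t" if "(s, t) \<in> rels ?p" for s t
      using that rel[of s t] phi ddx dx
      by (auto simp: bvd_presentation_def bvd_rels_def Let_def teval_DO a_def diff_smult[OF dx]
          smult_zero smult_smult[OF dx] smult_one[OF dx])
  qed
  then obtain g where g: "dg_operad_hom (presented_operad ?p) Q g" "\<forall>b\<in>gens ?p. g (gen_class ?p b) = a b"
    by blast
  show ?thesis
    by (intro exI[of _ g]) (use g in \<open>auto simp: bvd_operad_def bvd_presentation_def a_def\<close>)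
qed

section \<open>The weight homotopy on the exact operad\<close>

lemma path_ext_projection:
  assumes "dg_operad P"
  shows "dg_operad_hom (path_ext P) P (\<lambda>X. fst (snd X))"
proof -
  interpret dg_operad P by fact
  interpret T: dg_operad "path_ext P" by (rule dg_operad_path_ext)
  show ?thesis
    by unfold_locales (auto elim!: path_elE simp: path_ext_sel(3-))
qed

text \<open>
  A morphism \<open>x \<mapsto> x + t E(x) + \<epsilon> h(x)\<close> packs a derivation \<open>E\<close> that commutes with \<open>d\<close> together with a
  derivation \<open>h\<close> of degree \<open>-1\<close>; since \<open>d t = \<epsilon>\<close>, compatibility with differentials at \<open>\<epsilon>\<close> is
  \<open>h d = E - d h\<close>.
\<close>

lemma euler_homotopyI:
  assumes "dg_operad_hom P (path_ext P) \<Phi>" and id: "\<And>n e x. x \<in> el P n e \<Longrightarrow> fst (snd (\<Phi> x)) = x"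
  shows "euler_homotopy P (\<lambda>x. fst (snd (snd (\<Phi> x)))) (\<lambda>x. snd (snd (snd (\<Phi> x))))"
proof -
  interpret F: dg_operad_hom P "path_ext P" \<Phi> by fact
  define E where "E = (\<lambda>x. fst (snd (snd (\<Phi> x))))"
  define h where "h = (\<lambda>x. snd (snd (snd (\<Phi> x))))"
  have Phi: "\<Phi> x = (e, x, E x, h x)" "E x \<in> el P n e" "h x \<in> el P n (e - 1)" if "x \<in> el P n e" for x n e
    using F.hom_closed[OF that] id[OF that] by (auto elim!: path_elE simp: E_def h_def)
  have Eh: "E x = a" "h x = b" if "\<Phi> x = (e, y, a, b)" for x e y a b
    using that by (simp_all add: E_def h_def)
  show ?thesis
    unfolding E_def[symmetric] h_def[symmetric]
  proof (unfold_locales, goal_cases)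
    case (1 x n e) then show ?case by (rule Phi)
  next
    case (2 x n e y)
    show ?case
      by (rule Eh(1)[OF F.hom_add[OF 2, unfolded Phi(1)[OF 2(1)] Phi(1)[OF 2(2)] path_ext_sel]])
  next
    case (3 x n e c)
    show ?case by (rule Eh(1)[OF F.hom_smult[OF 3, unfolded Phi(1)[OF 3] path_ext_sel]])
  next
    case 4
    show ?case by (rule Eh(1)[OF F.hom_unit[unfolded path_ext_sel]])
  next
    case (5 x m e y n e' i)
    show ?case
      by (rule Eh(1)[OF F.hom_comp[OF 5, unfolded Phi(1)[OF 5(1)] Phi(1)[OF 5(2)] path_ext_sel]])
  next
    case (6 x n e \<sigma>)
    show ?case by (rule Eh(1)[OF F.hom_act[OF 6, unfolded Phi(1)[OF 6(1)] path_ext_sel]])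
  next
    case (7 x n e)
    show ?case by (rule Eh(1)[OF F.hom_diff[OF 7, unfolded Phi(1)[OF 7] path_ext_sel]])
  next
    case (8 x n e) then show ?case by (rule Phi)
  next
    case (9 n e)
    show ?case by (rule Eh(2)[OF F.hom_zero[unfolded path_ext_sel]])
  next
    case (10 x n e)
    show ?case by (rule Eh(2)[OF F.hom_diff[OF 10, unfolded Phi(1)[OF 10] path_ext_sel]])
  qed
qed

lemma ebv_euler_homotopy:
  obtains E h where "euler_homotopy (ebv_operad :: ('k::field_char_0, ('k, ebv_gen) oterm set) dg_operad_data) E h"
    "E ebv_mu = ozero ebv_operad 2 0" "E ebv_i = ebv_i"
proof -
  let ?P = "ebv_operad :: ('k, ('k, ebv_gen) oterm set) dg_operad_data"
  have P: "dg_operad ?P" unfolding ebv_operad_def by (rule dg_operad_presented)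
  obtain \<Phi> where Phi: "dg_operad_hom ?P (path_ext ?P) \<Phi>"
    "\<Phi> ebv_mu = (0, ebv_mu, ozero ?P 2 0, ozero ?P 2 (- 1))"
    "\<Phi> ebv_i = (- 2, ebv_i, ebv_i, ozero ?P 1 (- 3))"
    using ebv_hom_exists[OF dg_operad.dg_operad_path_ext[OF P]
        exact_BV_pair_path_ext[OF P ebv_exact_BV_pair]] by blast
  have "((\<lambda>X. fst (snd X)) \<circ> \<Phi>) x = x" if x: "x \<in> el ?P n e" for x n e
  proof (rule presented_operad_hom_unique)
    show "dg_operad_hom (presented_operad ebv_presentation) ?P ((\<lambda>X. fst (snd X)) \<circ> \<Phi>)"
      using dg_operad_hom_comp[OF Phi(1) path_ext_projection[OF P]] by (simp add: ebv_operad_def)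
    show "dg_operad_hom (presented_operad ebv_presentation) ?P (\<lambda>x. x)"
      using dg_operad_hom_id[OF P] by (simp add: ebv_operad_def)
    show "((\<lambda>X. fst (snd X)) \<circ> \<Phi>) (gen_class ebv_presentation g) = gen_class ebv_presentation g" for g
      by (cases g) (simp_all add: Phi)
    show "x \<in> el (presented_operad ebv_presentation) n e" using x by (simp add: ebv_operad_def)
  qed
  then have "euler_homotopy ?P (\<lambda>x. fst (snd (snd (\<Phi> x)))) (\<lambda>x. snd (snd (snd (\<Phi> x))))"
    by (intro euler_homotopyI[OF Phi(1)]) auto
  then show thesis by (rule that) (simp_all add: Phi)
qed

section \<open>The commutative operad inside the exact operad\<close>

lemma com_diff_zero:
  fixes x :: "('k::field, com_gen) oterm set"
  assumes "x \<in> el com_operad n e"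
  shows "odiff com_operad x = ozero com_operad n (e + 1)"
proof -
  interpret dg_operad "com_operad :: ('k, ('k, com_gen) oterm set) dg_operad_data" unfolding com_operad_def by (rule dg_operad_presented)
  have "x \<in> el (presented_operad com_presentation) n e" using assms by (simp add: com_operad_def)
  then show ?thesis
  proof (induction rule: presented_operad_induct)
    case (gen g)
    have "commutative_product com_operad (com_mu :: ('k, com_gen) oterm set)"
      by (rule com_commutative_product)
    then show ?case
      by (cases g) (simp add: commutative_product_def com_operad_def com_presentation_type)
  next
    case (zero n e)
    show ?case using diff_zero[of "e + 1" e n] by (simp add: com_operad_def)
  next
    case (add n e x y)
    then show ?case
      by (simp add: com_operad_def[symmetric] diff_add[of _ n e] add_zero zero_closed)
  next
    case (smult n e x c)
    then show ?case by (simp add: com_operad_def[symmetric] diff_smult[of _ n e] smult_zero)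
  next
    case unit
    show ?case using diff_unit by (simp add: com_operad_def)
  next
    case (comp m e n e' x y i)
    then show ?case
      using zero_comp[of y n e' i m "m + n - 1" "e + e' + 1" "e + 1"]
        comp_zero[of x m e i "m + n - 1" n "e + e' + 1" "e' + 1"]
      by (simp add: com_operad_def[symmetric] diff_comp[of _ m e _ n e'] smult_zero add_zero zero_closed)
  next
    case (act n e x \<sigma>)
    then show ?case by (simp add: com_operad_def[symmetric] diff_act[of _ n e] act_zero)
  next
    case (diff n e x)
    then show ?case using diff_diff[of x n e] by (simp add: com_operad_def[symmetric] add.assoc)
  qed
qed

lemma (in euler_homotopy) E_comm_image:
  fixes F :: "('k, com_gen) oterm set \<Rightarrow> 'a"
  assumes "dg_operad_hom com_operad P F" "E (F com_mu) = ozero P 2 0" "c \<in> el com_operad n e"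
  shows "E (F c) = ozero P n e"
proof -
  interpret F: dg_operad_hom com_operad P F by fact
  have "c \<in> el (presented_operad com_presentation) n e" using assms(3) by (simp add: com_operad_def)
  then show ?thesis
  proof (induction rule: presented_operad_induct)
    case (gen g)
    show ?case using assms(2) by (cases g) (simp add: com_presentation_type)
  next
    case (zero n e)
    show ?case by (simp add: com_operad_def[symmetric] F.hom_zero E_zero)
  next
    case (add n e x y)
    then show ?case
      by (simp add: com_operad_def[symmetric] F.hom_add[of _ n e] E_add[of _ n e] F.hom_closed
          add_zero zero_closed)
  next
    case (smult n e x c)
    then show ?case
      by (simp add: com_operad_def[symmetric] F.hom_smult[of _ n e] E_smult[of _ n e] F.hom_closed
          smult_zero)
  next
    case unit
    show ?case by (simp add: com_operad_def[symmetric] F.hom_unit E_unit)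
  next
    case (comp m e n e' x y i)
    then have xy: "F x \<in> el P m e" "F y \<in> el P n e'"
      by (simp_all add: com_operad_def[symmetric] F.hom_closed)
    show ?case
      using comp zero_comp[OF xy(2) comp(3,4) refl refl, of e] comp_zero[OF xy(1) comp(3,4) refl refl, of n e']
      by (simp add: com_operad_def[symmetric] F.hom_comp[of _ m e _ n e'] E_comp[OF xy]
          add_zero zero_closed)
  next
    case (act n e x \<sigma>)
    then show ?case
      by (simp add: com_operad_def[symmetric] F.hom_act[of _ n e] E_act[of _ n e] F.hom_closed act_zero)
  next
    case (diff n e x)
    then show ?case
      by (simp add: com_operad_def[symmetric] F.hom_diff[of _ n e] E_diff[of _ n e] F.hom_closed diff_zero)
  qed
qed

text \<open>
  The elements that split in this way contain the generators, \<open>\<mu>\<close> being in the image and \<open>i\<close> an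
  eigenvector with eigenvalue 1, and are closed under all operations: in a composition of two of them
  only the product of the two image parts has weight 0.
\<close>

lemma ebv_decomposition:
  fixes E h :: "('k::field_char_0, ebv_gen) oterm set \<Rightarrow> ('k, ebv_gen) oterm set"
    and F :: "('k, com_gen) oterm set \<Rightarrow> ('k, ebv_gen) oterm set"
  assumes "euler_homotopy ebv_operad E h" "E ebv_mu = ozero ebv_operad 2 0" "E ebv_i = ebv_i"
    and "dg_operad_hom com_operad ebv_operad F" "F com_mu = ebv_mu"
    and "x \<in> el ebv_operad n e"
  shows "\<exists>c\<in>el com_operad n e. \<exists>p. euler_homotopy.positive_weight ebv_operad E n e p
    \<and> x = oadd ebv_operad (F c) p"
proof -
  interpret euler_homotopy ebv_operad E h by fact
  interpret F: dg_operad_hom com_operad ebv_operad F by fact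
  have EF: "E (F c) = ozero ebv_operad n e" if "c \<in> el com_operad n e" for c n e
    by (rule E_comm_image[OF assms(4) _ that]) (simp add: assms(2,5))
  define split where "split n e x \<longleftrightarrow>
    (\<exists>c\<in>el com_operad n e. \<exists>p. positive_weight n e p \<and> x = oadd ebv_operad (F c) p)" for n e x
  have splitI: "split n e (oadd ebv_operad (F c) p)"
    if "c \<in> el com_operad n e" "positive_weight n e p" for n e c p
    using that by (auto simp: split_def)
  have split_F: "split n e (F c)" if "c \<in> el com_operad n e" for n e c
    using splitI[OF that positive_weight.zero] add_zero[OF F.hom_closed[OF that]] by simp
  have split_pos: "split n e p" if "positive_weight n e p" for n e p
    using splitI[OF F.P.zero_closed that] zero_add[OF positive_weight_closed[OF that]]
    by (simp add: F.hom_zero)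
  have "x \<in> el (presented_operad ebv_presentation) n e" using assms(6) by (simp add: ebv_operad_def)
  then have "split n e x"
  proof (induction rule: presented_operad_induct)
    case (gen g)
    show ?case
    proof (cases g)
      case EBV_mu
      have "com_mu \<in> el com_operad 2 0"
        using com_commutative_product by (auto simp: commutative_product_def)
      from split_F[OF this] show ?thesis using EBV_mu assms(5) by (simp add: ebv_presentation_def)
    next
      case EBV_i
      have i: "ebv_i \<in> el ebv_operad 1 (- 2)" using ebv_exact_BV_pair by (auto simp: exact_BV_pair_def)
      then have "shifted 1 ebv_i = ozero ebv_operad 1 (- 2)"
        by (simp add: shifted_def assms(3) add_neg[OF i])
      then have "positive_weight 1 (- 2) ebv_i"
        using positive_weight.step[OF i, of 1] positive_weight.zero by simp
      from split_pos[OF this] show ?thesis using EBV_i by (simp add: ebv_presentation_def)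
    qed
  next
    case (zero n e)
    show ?case using split_pos[OF positive_weight.zero] by (simp add: ebv_operad_def)
  next
    case (add n e x y)
    from add(3,4) obtain c p c' p' where c: "c \<in> el com_operad n e" "c' \<in> el com_operad n e"
      and p: "positive_weight n e p" "positive_weight n e p'"
      and xy: "x = oadd ebv_operad (F c) p" "y = oadd ebv_operad (F c') p'"
      by (auto simp: split_def)
    have "oadd ebv_operad x y = oadd ebv_operad (F (oadd com_operad c c')) (oadd ebv_operad p p')"
      using c p[THEN positive_weight_closed]
      by (simp add: xy F.hom_add[of _ n e] F.hom_closed add_add_swap[of _ n e])
    then show ?case
      using splitI[OF F.P.add_closed[OF c] positive_weight_add[OF p]] by (simp add: ebv_operad_def)
  next
    case (smult n e x k)
    from smult(2) obtain c p where c: "c \<in> el com_operad n e" and p: "positive_weight n e p"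
      and x: "x = oadd ebv_operad (F c) p" by (auto simp: split_def)
    have "osmult ebv_operad k x = oadd ebv_operad (F (osmult com_operad k c)) (osmult ebv_operad k p)"
      using c positive_weight_closed[OF p]
      by (simp add: x F.hom_smult[of _ n e] F.hom_closed smult_add[of _ n e])
    then show ?case
      using splitI[OF F.P.smult_closed[OF c] positive_weight_smult[OF p]] by (simp add: ebv_operad_def)
  next
    case unit
    show ?case using split_F[OF F.P.unit_closed] F.hom_unit by (simp add: ebv_operad_def)
  next
    case (comp m e n e' x y i)
    from comp(5,6) obtain c p c' p' where c: "c \<in> el com_operad m e" "c' \<in> el com_operad n e'"
      and p: "positive_weight m e p" "positive_weight n e' p'"
      and xy: "x = oadd ebv_operad (F c) p" "y = oadd ebv_operad (F c') p'"
      by (auto simp: split_def)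
    note i = comp(3,4)
    note Fc = F.hom_closed[OF c(1)] F.hom_closed[OF c(2)]
    note pc = p[THEN positive_weight_closed]
    let ?N = "m + n - 1" and ?E = "e + e'"
    let ?q = "oadd ebv_operad (ocomp ebv_operad (F c) i p')
      (oadd ebv_operad (ocomp ebv_operad p i (F c')) (ocomp ebv_operad p i p'))"
    have q: "positive_weight ?N ?E ?q"
      by (intro positive_weight_add positive_weight_comp[OF p i]
          positive_weight_comp_left[OF p(1) Fc(2) EF[OF c(2)] i]
          positive_weight_comp_right[OF p(2) Fc(1) EF[OF c(1)] i])
    have "ocomp ebv_operad x i y = oadd ebv_operad (F (ocomp com_operad c i c')) ?q"
      using comp_closed[OF Fc i] comp_closed[OF Fc(1) pc(2) i] comp_closed[OF pc(1) Fc(2) i]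
        comp_closed[OF pc i]
      by (simp add: xy F.hom_comp[OF c i] comp_add_left[OF Fc(1) pc(1) add_closed[OF Fc(2) pc(2)] i]
          comp_add_right[OF Fc(1) Fc(2) pc(2) i] comp_add_right[OF pc(1) Fc(2) pc(2) i]
          add_assoc[of _ ?N ?E] add_closed)
    then show ?case using splitI[OF F.P.comp_closed[OF c i] q] by (simp add: ebv_operad_def)
  next
    case (act n e x \<sigma>)
    from act(3) obtain c p where c: "c \<in> el com_operad n e" and p: "positive_weight n e p"
      and x: "x = oadd ebv_operad (F c) p" by (auto simp: split_def)
    have "oact ebv_operad x \<sigma> = oadd ebv_operad (F (oact com_operad c \<sigma>)) (oact ebv_operad p \<sigma>)"
      using c positive_weight_closed[OF p] act(2)
      by (simp add: x F.hom_act[of _ n e] F.hom_closed act_add[of _ n e])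
    then show ?case
      using splitI[OF F.P.act_closed[OF c act(2)] positive_weight_act[OF p act(2)]]
      by (simp add: ebv_operad_def)
  next
    case (diff n e x)
    from diff(2) obtain c p where c: "c \<in> el com_operad n e" and p: "positive_weight n e p"
      and x: "x = oadd ebv_operad (F c) p" by (auto simp: split_def)
    have "odiff ebv_operad x = oadd ebv_operad (F (odiff com_operad c)) (odiff ebv_operad p)"
      using c positive_weight_closed[OF p]
      by (simp add: x F.hom_diff[of _ n e] F.hom_closed diff_add[of _ n e])
    then show ?case
      using splitI[OF F.P.diff_closed[OF c] positive_weight_diff[OF p]] by (simp add: ebv_operad_def)
  qed
  then show ?thesis by (simp add: split_def)
qed

theorem com_to_ebv_quasi_isomorphism:
  fixes F :: "('k::field_char_0, com_gen) oterm set \<Rightarrow> ('k, ebv_gen) oterm set"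
  assumes F: "dg_operad_hom com_operad ebv_operad F" and mu: "F com_mu = ebv_mu"
  shows "quasi_isomorphism com_operad ebv_operad F"
proof -
  obtain E h where Eh: "euler_homotopy (ebv_operad :: ('k, ('k, ebv_gen) oterm set) dg_operad_data) E h"
    "E ebv_mu = ozero ebv_operad 2 0" "E ebv_i = ebv_i"
    by (rule ebv_euler_homotopy)
  interpret euler_homotopy ebv_operad E h by fact
  interpret F: dg_operad_hom com_operad ebv_operad F by fact
  obtain r where r: "dg_operad_hom ebv_operad com_operad r" "r ebv_mu = (com_mu :: ('k, com_gen) oterm set)"
    using ebv_hom_exists[OF F.P.dg_operad_axioms
        exact_BV_pair_zero[OF F.P.dg_operad_axioms com_commutative_product]] by blast
  show ?thesis
  proof (rule quasi_isomorphismI[OF F r(1)])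
    fix n e and x :: "('k, com_gen) oterm set" assume x: "x \<in> el com_operad n e"
    have "(r \<circ> F) x = x"
    proof (rule presented_operad_hom_unique)
      show "dg_operad_hom (presented_operad com_presentation) com_operad (r \<circ> F)"
        using dg_operad_hom_comp[OF F r(1)] by (simp add: com_operad_def)
      show "dg_operad_hom (presented_operad com_presentation) com_operad
          (\<lambda>x :: ('k, com_gen) oterm set. x)"
        using dg_operad_hom_id[OF F.P.dg_operad_axioms] by (simp add: com_operad_def)
      show "(r \<circ> F) (gen_class com_presentation g) = gen_class com_presentation g" for g
        by (cases g) (simp add: mu r(2))
      show "x \<in> el (presented_operad com_presentation) n e" using x by (simp add: com_operad_def)
    qed
    then show "r (F x) = x" by simp
  next
    fix n e and y :: "('k, ebv_gen) oterm set" assume y: "y \<in> cocycles ebv_operad n e"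
    then have "y \<in> el ebv_operad n e" by (simp add: cocycles_def)
    from ebv_decomposition[OF Eh F mu this]
    obtain c p where c: "c \<in> el com_operad n e" and p: "positive_weight n e p"
      and y_eq: "y = oadd ebv_operad (F c) p" by blast
    have pc: "p \<in> el ebv_operad n e" by (rule positive_weight_closed[OF p])
    have c': "c \<in> cocycles com_operad n e" using c by (simp add: cocycles_def com_diff_zero)
    have "odiff ebv_operad (F c) = ozero ebv_operad n (e + 1)"
      using F.hom_cocycles[OF c'] by (simp add: cocycles_def)
    then have "odiff ebv_operad p = ozero ebv_operad n (e + 1)"
      using y diff_add[OF F.hom_closed[OF c] pc] zero_add[OF diff_closed[OF pc]]
      by (simp add: cocycles_def y_eq)
    then obtain b where "b \<in> el ebv_operad n (e - 1)" "p = odiff ebv_operad b"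
      using positive_weight_exact[OF p] by blast
    then show "\<exists>x\<in>cocycles com_operad n e. (F x, y) \<in> cohomologous ebv_operad n e"
      using c' y F.hom_cocycles[OF c'] y_eq by (auto simp: cohomologous_def)
  qed
qed

theorem theorem1p3:
  shows "(\<exists>f. com_to_bvd (f :: ('k::field_char_0, com_gen) oterm set \<Rightarrow> ('k, bvd_gen) oterm set)) \<and>
    (\<exists>g. bvd_to_ebv (g :: ('k, bvd_gen) oterm set \<Rightarrow> ('k, ebv_gen) oterm set)) \<and>
    (\<forall>(f :: ('k, com_gen) oterm set \<Rightarrow> ('k, bvd_gen) oterm set)
      (g :: ('k, bvd_gen) oterm set \<Rightarrow> ('k, ebv_gen) oterm set).
      com_to_bvd f \<and> bvd_to_ebv g \<longrightarrow> quasi_isomorphism com_operad ebv_operad (g \<circ> f))"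
proof (intro conjI allI impI)
  have bvd: "dg_operad (bvd_operad :: ('k, ('k, bvd_gen) oterm set) dg_operad_data)"
    and ebv: "dg_operad (ebv_operad :: ('k, ('k, ebv_gen) oterm set) dg_operad_data)"
    by (simp_all add: bvd_operad_def ebv_operad_def dg_operad_presented)
  show "\<exists>f. com_to_bvd (f :: ('k, com_gen) oterm set \<Rightarrow> ('k, bvd_gen) oterm set)"
    unfolding com_to_bvd_def by (rule com_hom_exists[OF bvd bvd_commutative_product])
  show "\<exists>g. bvd_to_ebv (g :: ('k, bvd_gen) oterm set \<Rightarrow> ('k, ebv_gen) oterm set)"
    unfolding bvd_to_ebv_def by (rule bvd_hom_exists[OF ebv ebv_exact_BV_pair])
  fix f :: "('k, com_gen) oterm set \<Rightarrow> ('k, bvd_gen) oterm set"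
    and g :: "('k, bvd_gen) oterm set \<Rightarrow> ('k, ebv_gen) oterm set"
  assume "com_to_bvd f \<and> bvd_to_ebv g"
  then show "quasi_isomorphism com_operad ebv_operad (g \<circ> f)"
    by (intro com_to_ebv_quasi_isomorphism dg_operad_hom_comp)
      (auto simp: com_to_bvd_def bvd_to_ebv_def)
qed

end
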